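(* Let $\varepsilon\in(0,1]$, consider a pseudometric-weighted correlation clustering instance with $n\ge2$ vertices, let $\mathcal C^0$ be a clustering with $\operatorname{obj}(\mathcal C^0)\le\frac{20}{3}\mathrm{OPT}$, and let $\mathcal K$ be the atom partition and $E_{\mathrm{adm}}$ the set of admissible pairs constructed from $\mathcal C^0$ and $\varepsilon$. Then $\mathcal K$ and $E_{\mathrm{adm}}$ are computable in polynomial time and satisfy: (i) There exists an atom-respecting clustering $\mathcal C_1^\star$ of cost at most $(1+\varepsilon)\mathrm{OPT}$. (ii) If two distinct atoms are contained in one cluster of $\mathcal C_1^\star$, every pair between them is admissible. (iii) The total admissible-pair weight satisfies $$w(E_{\mathrm{adm}})\le 128\,\alpha\left(\frac{2\alpha}{\varepsilon}\right)^{2t_0+1}\mathrm{OPT},\qquad t_0=297.$$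
   Context: Instance: a set $V$ of $n$ vertices; $\binom V2=E^+\uplus E^-$ (positive/negative pairs, arbitrary); weights $w_{uv}=w_{vu}\ge0$, $w_{uu}=0$, $w_{uv}\le w_{ua}+w_{av}$ for all $u,v,a\in V$. For a partition (clustering) $\mathcal C$ of $V$, $\operatorname{obj}(\mathcal C)$ is the total weight of positive pairs whose endpoints lie in different parts plus the total weight of negative pairs whose endpoints lie in the same part; $\mathrm{OPT}=\min_{\mathcal C}\operatorname{obj}(\mathcal C)$. For $A,B\subseteq V$, $w(A,B)=\sum_{a\in A}\sum_{b\in B}w_{ab}$; $w^+(A,B)$, $w^-(A,B)$ are the same ordered sums restricted to positive, resp. negative, pairs; $w(u,A)=w(\{u\},A)$. $N_u^+=\{v\ne u:uv\in E^+\}$. For a set $F$ of unordered pairs, $w(F)=\sum_{uv\in F}w_{uv}$. Atoms. Fix an absolute constant $\beta$ with $0<\beta\le\frac{2\sqrt7-5}{6}$. For $u\in C\in\mathcal C^0$ put $d_C(u)=w(u,N_u^+\triangle C)$ and $M_C=\{u\in C:d_C(u)>\frac\beta2w(u,C)\}$. The partition $\mathcal K$ is obtained by processing each $C\in\mathcal C^0$: if $\sum_{u\in M_C}d_C(u)>\frac{\beta^2}{20}w(C,C)$, put every singleton $\{u\}$, $u\in C$, in $\mathcal K$; otherwise put $\{u\}$ in $\mathcal K$ for each $u\in M_C$, and also $C\setminus M_C$ if it is nonempty. Elements of $\mathcal K$ are atoms. A clustering is atom-respecting if each atom is contained in one of its parts. $\alpha\ge1$ is a fixed absolute constant (depending only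 on $\beta$) such that $\operatorname{obj}(\mathcal K)\le\alpha\,\mathrm{OPT}$ for every instance and every $\mathcal C^0$ with $\operatorname{obj}(\mathcal C^0)\le\frac{20}3\mathrm{OPT}$. Admissible pairs. For an atom $K$ let $d(K)=\sum_{L\in\mathcal K,\,L\ne K}w^+(K,L)$, and let $\mathcal K_+$ be the set of atoms with $d(K)>0$. On $\mathcal K_+$ let $D=\operatorname{diag}(d(K))$, $P(K,L)=w^+(K,L)/d(K)$ for $K\ne L$, $P(K,K)=0$, $P_{\mathrm{lazy}}=(I+P)/2$, $t_0=297$, $Q=PP_{\mathrm{lazy}}^{t_0}$, and $\Gamma=DQD^{-1}Q^\top D$. Extend $\Gamma$ by zero rows and columns to all of $\mathcal K$ ($\Gamma=0$ if $\mathcal K_+=\emptyset$). Let $\tau=\varepsilon/(2\alpha)$. For $u,v$ in distinct atoms $K_u,K_v$, the pair $uv$ belongs to $E_{\mathrm{adm}}$ (is admissible) if and only if $w(K_u,K_v)<64\,\tau^{-(2t_0+1)}\Gamma_{K_u,K_v}$. Pairs inside one atom are never in $E_{\mathrm{adm}}$. Polynomial time means polynomial in the input size, given the instance, $\mathcal C^0$ and $\varepsilon$. *)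

theory Defs
  imports Complex_Main "HOL-Library.Disjoint_Sets" "HOL-Library.Log_Nat"
begin

section \<open>Pseudometric-weighted correlation clustering\<close>

text \<open>Unordered pairs are two-element sets.\<close>

record 'a cc =
  verts :: "'a set"
  pos_pairs :: "'a set set"
  neg_pairs :: "'a set set"
  wt :: "'a \<Rightarrow> 'a \<Rightarrow> real"

definition cc_instance :: "'a cc \<Rightarrow> bool" where
  "cc_instance I \<longleftrightarrow>
     finite (verts I) \<and>
     pos_pairs I \<union> neg_pairs I = {{u, v} | u v. u \<in> verts I \<and> v \<in> verts I \<and> u \<noteq> v} \<and>
     pos_pairs I \<inter> neg_pairs I = {} \<and>
     (\<forall>u\<in>verts I. \<forall>v\<in>verts I. wt I u v = wt I v u \<and> 0 \<le> wt I u v) \<and>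
     (\<forall>u\<in>verts I. wt I u u = 0) \<and>
     (\<forall>u\<in>verts I. \<forall>v\<in>verts I. \<forall>a\<in>verts I. wt I u v \<le> wt I u a + wt I a v)"

definition pair_wt :: "'a cc \<Rightarrow> 'a set \<Rightarrow> real" where
  "pair_wt I e = (THE x. \<exists>u v. e = {u, v} \<and> u \<noteq> v \<and> x = wt I u v)"

lemma pair_wt_eq:
  assumes "cc_instance I" "u \<in> verts I" "v \<in> verts I" "u \<noteq> v"
  shows "pair_wt I {u, v} = wt I u v"
  unfolding pair_wt_def
proof (rule the_equality)
  show "\<exists>a b. {u, v} = {a, b} \<and> a \<noteq> b \<and> wt I u v = wt I a b"
    using assms(4) by blast
next
  fix x assume "\<exists>a b. {u, v} = {a, b} \<and> a \<noteq> b \<and> x = wt I a b"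
  then obtain a b where "{u, v} = {a, b}" "x = wt I a b" by blast
  moreover have "wt I u v = wt I v u"
    using assms(1-3) by (simp add: cc_instance_def)
  ultimately show "x = wt I u v"
    by (metis doubleton_eq_iff)
qed

definition wt_pairs :: "'a cc \<Rightarrow> 'a set set \<Rightarrow> real" where
  "wt_pairs I F = (\<Sum>e\<in>F. pair_wt I e)"

definition wt_sets :: "'a cc \<Rightarrow> 'a set \<Rightarrow> 'a set \<Rightarrow> real" where
  "wt_sets I A B = (\<Sum>a\<in>A. \<Sum>b\<in>B. wt I a b)"

definition wt_pos :: "'a cc \<Rightarrow> 'a set \<Rightarrow> 'a set \<Rightarrow> real" where
  "wt_pos I A B = (\<Sum>a\<in>A. \<Sum>b\<in>B. if {a, b} \<in> pos_pairs I then wt I a b else 0)"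

definition same_part :: "'a set set \<Rightarrow> 'a set \<Rightarrow> bool" where
  "same_part \<C> e \<longleftrightarrow> (\<exists>C\<in>\<C>. e \<subseteq> C)"

definition obj :: "'a cc \<Rightarrow> 'a set set \<Rightarrow> real" where
  "obj I \<C> = wt_pairs I {e \<in> pos_pairs I. \<not> same_part \<C> e}
           + wt_pairs I {e \<in> neg_pairs I. same_part \<C> e}"

definition OPT :: "'a cc \<Rightarrow> real" where
  "OPT I = Min (obj I ` {\<C>. partition_on (verts I) \<C>})"

section \<open>Atoms\<close>

definition pos_nbrs :: "'a cc \<Rightarrow> 'a \<Rightarrow> 'a set" where
  "pos_nbrs I u = {v \<in> verts I. v \<noteq> u \<and> {u, v} \<in> pos_pairs I}"

definition deviation :: "'a cc \<Rightarrow> 'a set \<Rightarrow> 'a \<Rightarrow> real" where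
  "deviation I C u = wt_sets I {u} (sym_diff (pos_nbrs I u) C)"

definition marked :: "real \<Rightarrow> 'a cc \<Rightarrow> 'a set \<Rightarrow> 'a set" where
  "marked \<beta> I C = {u \<in> C. deviation I C u > \<beta> / 2 * wt_sets I {u} C}"

definition cluster_atoms :: "real \<Rightarrow> 'a cc \<Rightarrow> 'a set \<Rightarrow> 'a set set" where
  "cluster_atoms \<beta> I C =
     (if (\<Sum>u\<in>marked \<beta> I C. deviation I C u) > \<beta>\<^sup>2 / 20 * wt_sets I C C
      then {{u} | u. u \<in> C}
      else {{u} | u. u \<in> marked \<beta> I C} \<union> ({C - marked \<beta> I C} - {{}}))"

definition atoms :: "real \<Rightarrow> 'a cc \<Rightarrow> 'a set set \<Rightarrow> 'a set set" where
  "atoms \<beta> I \<C>\<^sub>0 = (\<Union>C\<in>\<C>\<^sub>0. cluster_atoms \<beta> I C)"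

definition atom_respecting :: "'a set set \<Rightarrow> 'a set set \<Rightarrow> bool" where
  "atom_respecting \<K> \<C> \<longleftrightarrow> (\<forall>K\<in>\<K>. \<exists>C\<in>\<C>. K \<subseteq> C)"

text \<open>
  The defining property of the constant \<open>\<alpha>\<close>; the instances range over all vertex sets contained
  in the type \<open>'a\<close>.
\<close>

definition atom_cost_bound :: "'a itself \<Rightarrow> real \<Rightarrow> real \<Rightarrow> bool" where
  "atom_cost_bound _ \<beta> \<alpha> \<longleftrightarrow>
     (\<forall>(I :: 'a cc) \<C>\<^sub>0. cc_instance I \<and> partition_on (verts I) \<C>\<^sub>0 \<and>
        obj I \<C>\<^sub>0 \<le> 20 / 3 * OPT I \<longrightarrow> obj I (atoms \<beta> I \<C>\<^sub>0) \<le> \<alpha> * OPT I)"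

section \<open>Admissible pairs\<close>

text \<open>Matrices indexed by a finite set \<open>S\<close>, as functions of two indices.\<close>

type_synonym 'i mtx = "'i \<Rightarrow> 'i \<Rightarrow> real"

definition mtx_mult :: "'i set \<Rightarrow> 'i mtx \<Rightarrow> 'i mtx \<Rightarrow> 'i mtx" where
  "mtx_mult S A B = (\<lambda>i j. \<Sum>k\<in>S. A i k * B k j)"

definition mtx_diag :: "('i \<Rightarrow> real) \<Rightarrow> 'i mtx" where
  "mtx_diag f = (\<lambda>i j. if i = j then f i else 0)"

fun mtx_pow :: "'i set \<Rightarrow> 'i mtx \<Rightarrow> nat \<Rightarrow> 'i mtx" where
  "mtx_pow S A 0 = mtx_diag (\<lambda>_. 1)"
| "mtx_pow S A (Suc k) = mtx_mult S A (mtx_pow S A k)"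

definition mtx_transpose :: "'i mtx \<Rightarrow> 'i mtx" where
  "mtx_transpose A = (\<lambda>i j. A j i)"

definition t0 :: nat where
  "t0 = 297"

definition atom_deg :: "'a cc \<Rightarrow> 'a set set \<Rightarrow> 'a set \<Rightarrow> real" where
  "atom_deg I \<K> K = (\<Sum>L\<in>\<K> - {K}. wt_pos I K L)"

definition pos_atoms :: "'a cc \<Rightarrow> 'a set set \<Rightarrow> 'a set set" where
  "pos_atoms I \<K> = {K \<in> \<K>. atom_deg I \<K> K > 0}"

definition walk :: "'a cc \<Rightarrow> 'a set set \<Rightarrow> 'a set mtx" where
  "walk I \<K> = (\<lambda>K L. if K = L then 0 else wt_pos I K L / atom_deg I \<K> K)"

definition lazy_walk :: "'a cc \<Rightarrow> 'a set set \<Rightarrow> 'a set mtx" where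
  "lazy_walk I \<K> = (\<lambda>K L. (mtx_diag (\<lambda>_. 1) K L + walk I \<K> K L) / 2)"

definition Qmat :: "'a cc \<Rightarrow> 'a set set \<Rightarrow> 'a set mtx" where
  "Qmat I \<K> = mtx_mult (pos_atoms I \<K>) (walk I \<K>) (mtx_pow (pos_atoms I \<K>) (lazy_walk I \<K>) t0)"

definition Gamma_mat :: "'a cc \<Rightarrow> 'a set set \<Rightarrow> 'a set mtx" where
  "Gamma_mat I \<K> =
     (let S = pos_atoms I \<K>;
          D = mtx_diag (atom_deg I \<K>);
          Dinv = mtx_diag (\<lambda>K. 1 / atom_deg I \<K> K);
          Q = Qmat I \<K>
      in (\<lambda>K L. if K \<in> S \<and> L \<in> S
                then mtx_mult S (mtx_mult S (mtx_mult S (mtx_mult S D Q) Dinv) (mtx_transpose Q)) D K L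
                else 0))"

definition admissible :: "real \<Rightarrow> real \<Rightarrow> 'a cc \<Rightarrow> 'a set set \<Rightarrow> 'a set set" where
  "admissible \<alpha> \<epsilon> I \<K> =
     (let \<tau> = \<epsilon> / (2 * \<alpha>)
      in {{u, v} | u v K L. K \<in> \<K> \<and> L \<in> \<K> \<and> K \<noteq> L \<and> u \<in> K \<and> v \<in> L \<and>
            wt_sets I K L < 64 * \<tau> powi (- (2 * int t0 + 1)) * Gamma_mat I \<K> K L})"

section \<open>A random access machine with natural-number and real registers\<close>

text \<open>
  Programs of a while language over two families of registers, both addressed by a name and a list
  of natural-number indices. Natural-number operations are always charged by the bit lengths of the
  numbers involved. The charge for a real number is a parameter \<open>sz\<close> of the cost semantics:
  \<^item> with \<open>sz = (\<lambda>_. 1)\<close> every real operation has unit cost (the real RAM; there is no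
    rounding operation);
  \<^item> with \<open>sz = real_bits\<close>, on rational data, every value is charged by its bit length
    (the logarithmic-cost RAM, polynomially equivalent to Turing machines). Programs contain no
    real constants, so all register contents stay rational.
\<close>

datatype nexp =
    NConst nat
  | NRead string "nexp list"
  | NAdd nexp nexp
  | NSub nexp nexp
  | NMul nexp nexp

datatype rexp =
    ROfNat nexp
  | RRead string "nexp list"
  | RAdd rexp rexp
  | RSub rexp rexp
  | RMul rexp rexp
  | RDiv rexp rexp

datatype bexp =
    NLess nexp nexp
  | RLess rexp rexp
  | BNot bexp
  | BAnd bexp bexp

datatype com =
    Skip
  | NAssign string "nexp list" nexp
  | RAssign string "nexp list" rexp
  | Seq com com
  | Cond bexp com com
  | While bexp com

record store =
  nreg :: "string \<Rightarrow> nat list \<Rightarrow> nat"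
  rreg :: "string \<Rightarrow> nat list \<Rightarrow> real"

fun nval :: "store \<Rightarrow> nexp \<Rightarrow> nat" where
  "nval s (NConst k) = k"
| "nval s (NRead x es) = nreg s x (map (nval s) es)"
| "nval s (NAdd a b) = nval s a + nval s b"
| "nval s (NSub a b) = nval s a - nval s b"
| "nval s (NMul a b) = nval s a * nval s b"

fun rval :: "store \<Rightarrow> rexp \<Rightarrow> real" where
  "rval s (ROfNat e) = real (nval s e)"
| "rval s (RRead x es) = rreg s x (map (nval s) es)"
| "rval s (RAdd a b) = rval s a + rval s b"
| "rval s (RSub a b) = rval s a - rval s b"
| "rval s (RMul a b) = rval s a * rval s b"
| "rval s (RDiv a b) = rval s a / rval s b"

fun bval :: "store \<Rightarrow> bexp \<Rightarrow> bool" where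
  "bval s (NLess a b) \<longleftrightarrow> nval s a < nval s b"
| "bval s (RLess a b) \<longleftrightarrow> rval s a < rval s b"
| "bval s (BNot b) \<longleftrightarrow> \<not> bval s b"
| "bval s (BAnd a b) \<longleftrightarrow> bval s a \<and> bval s b"

definition nat_bits :: "nat \<Rightarrow> nat" where
  "nat_bits k = floorlog 2 k"

text \<open>
  Bit length of a rational number: numerator plus denominator of its shortest representation as a
  fraction. Only used for rational arguments.
\<close>

definition real_bits :: "real \<Rightarrow> nat" where
  "real_bits x = (LEAST k. \<exists>p q :: int. q \<noteq> 0 \<and> x = of_int p / of_int q \<and>
                     k = nat_bits (nat \<bar>p\<bar>) + nat_bits (nat \<bar>q\<bar>))"

text \<open>Every node of an expression is charged one unit plus the size of its value.\<close>

fun ncost :: "store \<Rightarrow> nexp \<Rightarrow> nat" where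
  "ncost s (NConst k) = 1 + nat_bits k"
| "ncost s (NRead x es) = 1 + sum_list (map (ncost s) es) + nat_bits (nval s (NRead x es))"
| "ncost s (NAdd a b) = 1 + ncost s a + ncost s b + nat_bits (nval s (NAdd a b))"
| "ncost s (NSub a b) = 1 + ncost s a + ncost s b + nat_bits (nval s (NSub a b))"
| "ncost s (NMul a b) = 1 + ncost s a + ncost s b + nat_bits (nval s (NMul a b))"

fun rcost :: "(real \<Rightarrow> nat) \<Rightarrow> store \<Rightarrow> rexp \<Rightarrow> nat" where
  "rcost sz s (ROfNat e) = 1 + ncost s e + sz (rval s (ROfNat e))"
| "rcost sz s (RRead x es) = 1 + sum_list (map (ncost s) es) + sz (rval s (RRead x es))"
| "rcost sz s (RAdd a b) = 1 + rcost sz s a + rcost sz s b + sz (rval s (RAdd a b))"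
| "rcost sz s (RSub a b) = 1 + rcost sz s a + rcost sz s b + sz (rval s (RSub a b))"
| "rcost sz s (RMul a b) = 1 + rcost sz s a + rcost sz s b + sz (rval s (RMul a b))"
| "rcost sz s (RDiv a b) = 1 + rcost sz s a + rcost sz s b + sz (rval s (RDiv a b))"

fun bcost :: "(real \<Rightarrow> nat) \<Rightarrow> store \<Rightarrow> bexp \<Rightarrow> nat" where
  "bcost sz s (NLess a b) = 1 + ncost s a + ncost s b"
| "bcost sz s (RLess a b) = 1 + rcost sz s a + rcost sz s b"
| "bcost sz s (BNot b) = 1 + bcost sz s b"
| "bcost sz s (BAnd a b) = 1 + bcost sz s a + bcost sz s b"

definition nset :: "string \<Rightarrow> nat list \<Rightarrow> nat \<Rightarrow> store \<Rightarrow> store" where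
  "nset x is k s = s\<lparr>nreg := (nreg s)(x := (nreg s x)(is := k))\<rparr>"

definition rset :: "string \<Rightarrow> nat list \<Rightarrow> real \<Rightarrow> store \<Rightarrow> store" where
  "rset x is r s = s\<lparr>rreg := (rreg s)(x := (rreg s x)(is := r))\<rparr>"

text \<open>\<open>exec sz c s t s'\<close>: started in \<open>s\<close>, program \<open>c\<close> halts in \<open>s'\<close> after time \<open>t\<close>.\<close>

inductive exec :: "(real \<Rightarrow> nat) \<Rightarrow> com \<Rightarrow> store \<Rightarrow> nat \<Rightarrow> store \<Rightarrow> bool" for sz where
  Skip: "exec sz Skip s 1 s"
| NAssign: "exec sz (NAssign x es e) s (1 + sum_list (map (ncost s) es) + ncost s e)
              (nset x (map (nval s) es) (nval s e) s)"
| RAssign: "exec sz (RAssign x es e) s (1 + sum_list (map (ncost s) es) + rcost sz s e)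
              (rset x (map (nval s) es) (rval s e) s)"
| Seq: "exec sz c s t s' \<Longrightarrow> exec sz d s' t' s'' \<Longrightarrow> exec sz (Seq c d) s (1 + t + t') s''"
| CondTrue: "bval s b \<Longrightarrow> exec sz c s t s' \<Longrightarrow> exec sz (Cond b c d) s (1 + bcost sz s b + t) s'"
| CondFalse: "\<not> bval s b \<Longrightarrow> exec sz d s t s' \<Longrightarrow> exec sz (Cond b c d) s (1 + bcost sz s b + t) s'"
| WhileFalse: "\<not> bval s b \<Longrightarrow> exec sz (While b c) s (1 + bcost sz s b) s"
| WhileTrue: "bval s b \<Longrightarrow> exec sz c s t s' \<Longrightarrow> exec sz (While b c) s' t' s'' \<Longrightarrow>
    exec sz (While b c) s (1 + bcost sz s b + t + t') s''"

lemma exec_deterministic: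
  "exec sz c s t s' \<Longrightarrow> exec sz c s u s'' \<Longrightarrow> t = u \<and> s' = s''"
proof (induction arbitrary: u s'' rule: exec.induct)
  case (Seq c s t s' d t' s1)
  from Seq.prems show ?case by (cases rule: exec.cases) (auto dest!: Seq.IH)
next
  case (CondTrue s b c t s' d)
  from CondTrue.prems CondTrue.hyps show ?case by (cases rule: exec.cases) (auto dest!: CondTrue.IH)
next
  case (CondFalse s b d t s' c)
  from CondFalse.prems CondFalse.hyps show ?case by (cases rule: exec.cases) (auto dest!: CondFalse.IH)
next
  case (WhileTrue s b c t s' t' s1)
  from WhileTrue.prems WhileTrue.hyps show ?case by (cases rule: exec.cases) (auto dest!: WhileTrue.IH)
qed (auto elim: exec.cases)

section \<open>Polynomial-time computability of the atoms and the admissible pairs\<close>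

text \<open>
  Vertices are numbered \<open>0, \<dots>, n - 1\<close>. A partition is encoded by arbitrary vertex labels, equal
  labels meaning the same part.
\<close>

definition label_partition :: "nat \<Rightarrow> (nat \<Rightarrow> nat) \<Rightarrow> nat set set" where
  "label_partition n f = {{v. v < n \<and> f v = f u} | u. u < n}"

text \<open>The constants \<open>\<beta>\<close> and \<open>\<alpha>\<close> are preloaded registers and do not count as input.\<close>

definition input_store ::
    "real \<Rightarrow> real \<Rightarrow> real \<Rightarrow> nat \<Rightarrow> nat cc \<Rightarrow> (nat \<Rightarrow> nat) \<Rightarrow> store" where
  "input_store \<beta> \<alpha> \<epsilon> n I f =
     \<lparr>nreg = (\<lambda>x is.
        if x = ''n'' \<and> is = [] then n
        else if x = ''pos'' \<and> (\<exists>u<n. \<exists>v<n. is = [u, v] \<and> {u, v} \<in> pos_pairs I) then 1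
        else if x = ''label'' \<and> length is = 1 \<and> hd is < n then f (hd is)
        else 0),
      rreg = (\<lambda>x is.
        if x = ''w'' \<and> length is = 2 \<and> is ! 0 < n \<and> is ! 1 < n then wt I (is ! 0) (is ! 1)
        else if x = ''eps'' \<and> is = [] then \<epsilon>
        else if x = ''beta'' \<and> is = [] then \<beta>
        else if x = ''alpha'' \<and> is = [] then \<alpha>
        else 0)\<rparr>"

definition input_size ::
    "(real \<Rightarrow> nat) \<Rightarrow> real \<Rightarrow> nat \<Rightarrow> nat cc \<Rightarrow> (nat \<Rightarrow> nat) \<Rightarrow> nat" where
  "input_size sz \<epsilon> n I f =
     (\<Sum>u<n. \<Sum>v<n. 1 + sz (wt I u v)) + (\<Sum>u<n. 1 + nat_bits (f u)) + sz \<epsilon>"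

definition output_correct ::
    "nat \<Rightarrow> nat set set \<Rightarrow> nat set set \<Rightarrow> store \<Rightarrow> bool" where
  "output_correct n \<K> E s \<longleftrightarrow>
     label_partition n (\<lambda>u. nreg s ''atom'' [u]) = \<K> \<and>
     (\<forall>u<n. \<forall>v<n. nreg s ''adm'' [u, v] = (if {u, v} \<in> E then 1 else 0))"

text \<open>
  One program, with one polynomial bound, serves all instances: in the unit-cost model for arbitrary
  real data, and in the logarithmic-cost model whenever all data are rational.
\<close>

definition polytime_atoms_admissible :: "real \<Rightarrow> real \<Rightarrow> bool" where
  "polytime_atoms_admissible \<beta> \<alpha> \<longleftrightarrow>
     (\<exists>prog a k. \<forall>n (I :: nat cc) \<C>\<^sub>0 f \<epsilon> sz.
        cc_instance I \<and> verts I = {..<n} \<and> 2 \<le> n \<and> 0 < \<epsilon> \<and> \<epsilon> \<le> 1 \<and>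
        partition_on (verts I) \<C>\<^sub>0 \<and> obj I \<C>\<^sub>0 \<le> 20 / 3 * OPT I \<and>
        label_partition n f = \<C>\<^sub>0 \<and>
        (sz = (\<lambda>_. 1) \<or>
         sz = real_bits \<and> \<beta> \<in> \<rat> \<and> \<alpha> \<in> \<rat> \<and> \<epsilon> \<in> \<rat> \<and> (\<forall>u<n. \<forall>v<n. wt I u v \<in> \<rat>)) \<longrightarrow>
        (\<exists>t s. exec sz prog (input_store \<beta> \<alpha> \<epsilon> n I f) t s \<and>
           t \<le> a * input_size sz \<epsilon> n I f ^ k \<and>
           output_correct n (atoms \<beta> I \<C>\<^sub>0) (admissible \<alpha> \<epsilon> I (atoms \<beta> I \<C>\<^sub>0)) s))"

end

theory Submission
  imports Defs
begin

text \<open>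
  Almost all weight inside an atom is positive and little positive weight leaves it, so an optimal
  clustering can be changed, without extra cost, into one that respects the atoms. Among the
  atom-respecting clusterings, \<open>\<C>\<^sub>1\<close> minimises the cost plus \<open>\<tau> d(K)\<close> for every atom \<open>K\<close> that is not a
  cluster of its own. Since the degrees \<open>d(K)\<close> add up to at most \<open>2 \<alpha> OPT\<close>, this penalty costs at most
  \<open>\<epsilon> OPT\<close>. By minimality, every atom in a larger cluster \<open>C\<close> keeps a \<open>\<tau>\<close>-fraction of its degree inside
  \<open>C\<close>, and every cut of \<open>C\<close> carries more positive than negative weight.

  By the triangle inequality the weights inside \<open>C\<close> have conductance at least 1/3, hence the positive
  weights have conductance at least 1/6. Cheeger's inequality gives the spectral gap 1/144 of the lazy
  walk on \<open>C\<close>, and the number \<open>t0\<close> of steps suffices for mixing up to a constant factor: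
  \<open>\<Gamma>(K, L)\<close> of the walk on \<open>C\<close> is more than \<open>d(K) d(L) / (4 vol)\<close>, while \<open>w(K, L) \<le> 16 d(K) d(L) / vol\<close>.
  Passing from the walk on \<open>C\<close> to the walk on all atoms loses the factor \<open>\<tau>\<close> once per lazy step and once
  more in the middle. The bound on the admissible weight holds because the entries of \<open>\<Gamma>\<close> sum to the
  total degree.

  The algorithm fills a fixed number of arrays, each by sums of \<open>n\<close> terms over earlier arrays. As the
  number of arrays is constant, all bit lengths stay polynomial.
\<close>

section \<open>Reversible Markov chains\<close>

text \<open>The factors D and D^-1 make \<Gamma> a Gram matrix: by reversibility, \<Gamma>(K, L) is
  d(K) d(L) times the inner product, weighted by d, of the one-step densities of K and L after t0
  lazy steps. The non-lazy first step matters: a walk that stays at K has density 1 / d(K) there,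
  whose norm is not controlled by 1 / vol when d(K) is small; after one step it is controlled by the
  largest ratio w(K, L) vol / (d(K) d(L)). Laziness makes the walk operator positive semidefinite,
  so a bound on its quadratic form becomes a contraction by Cauchy-Schwarz alone, without
  eigenvalues.

  The expansion argument meets a mismatch: the triangle inequality compares a set with its
  complement by numbers of vertices, while stationary mass is measured by degrees. Cheeger's
  inequality is therefore proved with a second, arbitrary weight that decides which side of a cut is
  small.

  The bound on \<beta> enters as \<beta> \<le> 1/20; it makes large atoms so nearly positive that
  the repair estimates close.\<close>

lemma weighted_Cauchy_Schwarz:
  fixes c x y :: "'i \<Rightarrow> real"
  assumes "\<And>i. i \<in> S \<Longrightarrow> 0 \<le> c i"
  shows "(\<Sum>i\<in>S. c i * x i * y i)\<^sup>2 \<le> (\<Sum>i\<in>S. c i * (x i)\<^sup>2) * (\<Sum>i\<in>S. c i * (y i)\<^sup>2)"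
proof -
  define a where "a = (\<Sum>i\<in>S. c i * (x i)\<^sup>2)"
  define b where "b = (\<Sum>i\<in>S. c i * x i * y i)"
  define e where "e = (\<Sum>i\<in>S. c i * (y i)\<^sup>2)"
  have q: "0 \<le> s\<^sup>2 * a + 2 * s * r * b + r\<^sup>2 * e" for s r
  proof -
    have "0 \<le> (\<Sum>i\<in>S. c i * (s * x i + r * y i)\<^sup>2)"
      using assms by (intro sum_nonneg) auto
    also have "\<dots> = s\<^sup>2 * a + 2 * s * r * b + r\<^sup>2 * e"
      unfolding a_def b_def e_def sum_distrib_left sum.distrib[symmetric]
      by (intro sum.cong) (auto simp: power2_eq_square algebra_simps)
    finally show ?thesis .
  qed
  have "0 \<le> a" "0 \<le> e" unfolding a_def e_def using assms by (auto intro!: sum_nonneg)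
  show ?thesis unfolding a_def[symmetric] b_def[symmetric] e_def[symmetric]
  proof (cases "a = 0")
    case True
    have "b = 0"
    proof (rule ccontr)
      assume "b \<noteq> 0"
      \<comment> \<open>For a = 0 the form is linear in s, and this s gives it the value -1.\<close>
      with q[of "-(e + 1) / (2 * b)" 1] True \<open>0 \<le> e\<close> show False by (simp add: field_simps)
    qed
    with True show "b\<^sup>2 \<le> a * e" by simp
  next
    case False
    with q[of "-b" a] have "0 \<le> a * (a * e - b\<^sup>2)" by (simp add: power2_eq_square algebra_simps)
    with False \<open>0 \<le> a\<close> show "b\<^sup>2 \<le> a * e" by (simp add: zero_le_mult_iff)
  qed
qed

section \<open>Matrices over a finite index set\<close>

lemma mtx_mult_assoc:
  "mtx_mult S (mtx_mult S A B) C = mtx_mult S A (mtx_mult S B C)"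
proof (intro ext)
  fix i j
  have "mtx_mult S (mtx_mult S A B) C i j = (\<Sum>k\<in>S. \<Sum>l\<in>S. A i l * B l k * C k j)"
    by (simp add: mtx_mult_def sum_distrib_right)
  also have "\<dots> = (\<Sum>l\<in>S. \<Sum>k\<in>S. A i l * B l k * C k j)" by (rule sum.swap)
  also have "\<dots> = mtx_mult S A (mtx_mult S B C) i j"
    by (simp add: mtx_mult_def sum_distrib_left mult.assoc)
  finally show "mtx_mult S (mtx_mult S A B) C i j = mtx_mult S A (mtx_mult S B C) i j" .
qed

lemma mtx_diag_left:
  assumes "finite S" "i \<in> S"
  shows "mtx_mult S (mtx_diag f) A i j = f i * A i j"
proof -
  have "mtx_mult S (mtx_diag f) A i j = (\<Sum>k\<in>S. if k = i then f i * A i j else 0)"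
    unfolding mtx_mult_def mtx_diag_def by (intro sum.cong) auto
  with assms show ?thesis by simp
qed

lemma mtx_diag_right:
  assumes "finite S" "j \<in> S"
  shows "mtx_mult S A (mtx_diag f) i j = A i j * f j"
proof -
  have "mtx_mult S A (mtx_diag f) i j = (\<Sum>k\<in>S. if k = j then A i j * f j else 0)"
    unfolding mtx_mult_def mtx_diag_def by (intro sum.cong) auto
  with assms show ?thesis by simp
qed

lemma mtx_mult_cong:
  assumes "\<And>k. k \<in> S \<Longrightarrow> A i k = A' i k" "\<And>k. k \<in> S \<Longrightarrow> B k j = B' k j"
  shows "mtx_mult S A B i j = mtx_mult S A' B' i j"
  unfolding mtx_mult_def using assms by (intro sum.cong) auto

text \<open>\<open>mtx_pow\<close> multiplies from the left, but reversibility of the powers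
  produces the factor on the right. The indices stay in \<open>S\<close> because
  \<open>mtx_diag (\<lambda>_. 1)\<close> acts as the identity only there.\<close>

lemma mtx_pow_commute:
  assumes "finite S" "i \<in> S" "j \<in> S"
  shows "mtx_mult S A (mtx_pow S A t) i j = mtx_mult S (mtx_pow S A t) A i j"
  using assms(2,3)
proof (induction t arbitrary: i j)
  case 0
  with assms(1) show ?case by (simp add: mtx_diag_left mtx_diag_right)
next
  case (Suc t)
  have "mtx_mult S A (mtx_pow S A (Suc t)) i j = mtx_mult S A (mtx_mult S (mtx_pow S A t) A) i j"
    using Suc unfolding mtx_pow.simps by (intro mtx_mult_cong[OF refl]) auto
  also have "\<dots> = mtx_mult S (mtx_pow S A (Suc t)) A i j"
    by (simp add: mtx_mult_assoc)
  finally show ?case .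
qed

section \<open>Random walks on weighted graphs\<close>

locale wgraph =
  fixes S :: "'i set" and W :: "'i mtx" and d :: "'i \<Rightarrow> real"
  assumes fin: "finite S"
    and W_sym: "\<And>i j. i \<in> S \<Longrightarrow> j \<in> S \<Longrightarrow> W i j = W j i"
    and W_nonneg: "\<And>i j. i \<in> S \<Longrightarrow> j \<in> S \<Longrightarrow> 0 \<le> W i j"
    and deg: "\<And>i. i \<in> S \<Longrightarrow> d i = (\<Sum>j\<in>S. W i j)"
    and d_pos: "\<And>i. i \<in> S \<Longrightarrow> 0 < d i"
begin

definition "P = (\<lambda>i j. W i j / d i)"
definition "A = (\<lambda>i j. (mtx_diag (\<lambda>_. 1) i j + P i j) / 2)"
definition "Q t = mtx_mult S P (mtx_pow S A t)"
definition "Gam t = (\<lambda>i j. d i * d j * (\<Sum>m\<in>S. Q t i m * Q t j m / d m))"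

lemma P_nonneg: "i \<in> S \<Longrightarrow> j \<in> S \<Longrightarrow> 0 \<le> P i j"
  by (simp add: P_def W_nonneg d_pos less_imp_le)

lemma A_nonneg: "i \<in> S \<Longrightarrow> j \<in> S \<Longrightarrow> 0 \<le> A i j"
  by (auto simp: A_def mtx_diag_def intro!: add_nonneg_nonneg P_nonneg)

lemma pow_nonneg: "i \<in> S \<Longrightarrow> j \<in> S \<Longrightarrow> 0 \<le> mtx_pow S A t i j"
proof (induction t arbitrary: i j)
  case 0 then show ?case by (simp add: mtx_diag_def)
next
  case (Suc t)
  then show ?case by (auto simp: mtx_mult_def intro!: sum_nonneg mult_nonneg_nonneg A_nonneg)
qed

lemma Q_nonneg: "i \<in> S \<Longrightarrow> j \<in> S \<Longrightarrow> 0 \<le> Q t i j"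
  by (auto simp: Q_def mtx_mult_def intro!: sum_nonneg mult_nonneg_nonneg P_nonneg pow_nonneg)

lemma Gam_nonneg: "i \<in> S \<Longrightarrow> j \<in> S \<Longrightarrow> 0 \<le> Gam t i j"
  unfolding Gam_def
  by (intro sum_nonneg mult_nonneg_nonneg divide_nonneg_nonneg Q_nonneg less_imp_le[OF d_pos])

lemma P_stoch: "i \<in> S \<Longrightarrow> (\<Sum>j\<in>S. P i j) = 1"
  using deg[of i] d_pos[of i] by (simp add: P_def sum_divide_distrib[symmetric])

lemma A_stoch: "i \<in> S \<Longrightarrow> (\<Sum>j\<in>S. A i j) = 1"
  using fin by (simp add: A_def sum_divide_distrib[symmetric] sum.distrib P_stoch mtx_diag_def)

lemma mult_stoch:
  assumes "\<And>i. i \<in> S \<Longrightarrow> (\<Sum>j\<in>S. X i j) = 1" "\<And>i. i \<in> S \<Longrightarrow> (\<Sum>j\<in>S. Y i j) = 1" "i \<in> S"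
  shows "(\<Sum>j\<in>S. mtx_mult S X Y i j) = (1::real)"
proof -
  have "(\<Sum>j\<in>S. mtx_mult S X Y i j) = (\<Sum>k\<in>S. X i k * (\<Sum>j\<in>S. Y k j))"
    unfolding mtx_mult_def sum_distrib_left by (rule sum.swap)
  with assms show ?thesis by simp
qed

lemma pow_stoch: "i \<in> S \<Longrightarrow> (\<Sum>j\<in>S. mtx_pow S A t i j) = 1"
  by (induction t arbitrary: i) (use fin in \<open>auto simp: mtx_diag_def intro!: mult_stoch A_stoch\<close>)

lemma Q_stoch: "i \<in> S \<Longrightarrow> (\<Sum>j\<in>S. Q t i j) = 1"
  unfolding Q_def by (intro mult_stoch P_stoch pow_stoch)

lemma A_rev: "i \<in> S \<Longrightarrow> j \<in> S \<Longrightarrow> d i * A i j = d j * A j i"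
  using d_pos[of i] d_pos[of j] W_sym[of i j] by (auto simp: A_def P_def mtx_diag_def field_simps)

lemma pow_rev: "i \<in> S \<Longrightarrow> j \<in> S \<Longrightarrow> d i * mtx_pow S A t i j = d j * mtx_pow S A t j i"
proof (induction t arbitrary: i j)
  case 0 then show ?case by (simp add: mtx_diag_def)
next
  case (Suc t)
  have "d i * mtx_pow S A (Suc t) i j = (\<Sum>k\<in>S. (d i * A i k) * mtx_pow S A t k j)"
    by (simp add: mtx_mult_def sum_distrib_left mult.assoc)
  also have "\<dots> = (\<Sum>k\<in>S. A k i * (d k * mtx_pow S A t k j))"
    using Suc.prems by (intro sum.cong) (simp_all add: A_rev)
  also have "\<dots> = (\<Sum>k\<in>S. A k i * (d j * mtx_pow S A t j k))"
    using Suc by (intro sum.cong) simp_all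
  also have "\<dots> = d j * mtx_mult S (mtx_pow S A t) A j i"
    by (simp add: mtx_mult_def sum_distrib_left mult_ac)
  also have "\<dots> = d j * mtx_pow S A (Suc t) j i"
    using Suc.prems fin by (simp add: mtx_pow_commute)
  finally show ?case .
qed

text \<open>The products \<open>d l * P l k\<close> are the symmetric weights, whose sum over
  \<open>l\<close> is \<open>d k\<close>; reversibility of the lazy powers then turns the column sum
  into a row sum, which is 1.\<close>

lemma Q_stationary:
  assumes "m \<in> S"
  shows "(\<Sum>l\<in>S. d l * Q t l m) = d m"
proof -
  have "(\<Sum>l\<in>S. d l * Q t l m) = (\<Sum>l\<in>S. \<Sum>k\<in>S. d l * P l k * mtx_pow S A t k m)"
    by (simp add: Q_def mtx_mult_def sum_distrib_left mult.assoc)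
  also have "\<dots> = (\<Sum>k\<in>S. (\<Sum>l\<in>S. W k l) * mtx_pow S A t k m)"
    unfolding sum_distrib_right
    by (subst sum.swap, intro sum.cong refl) (use d_pos in \<open>force simp: P_def W_sym\<close>)
  also have "\<dots> = (\<Sum>k\<in>S. d m * mtx_pow S A t m k)"
    using assms by (intro sum.cong refl) (simp add: deg[symmetric] pow_rev)
  also have "\<dots> = d m"
    using assms by (simp add: sum_distrib_left[symmetric] pow_stoch)
  finally show ?thesis .
qed

text \<open>Summing over \<open>j\<close> first, stationarity cancels the division by
  \<open>d m\<close>, and the rows of \<open>Q t\<close> sum to 1.\<close>

lemma Gam_total: "(\<Sum>i\<in>S. \<Sum>j\<in>S. Gam t i j) = (\<Sum>i\<in>S. d i)"
proof (intro sum.cong refl)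
  fix i assume i: "i \<in> S"
  have "(\<Sum>j\<in>S. Gam t i j) = (\<Sum>m\<in>S. d i * Q t i m / d m * (\<Sum>j\<in>S. d j * Q t j m))"
    unfolding Gam_def sum_distrib_left
    by (subst sum.swap) (simp add: mult_ac)
  also have "\<dots> = (\<Sum>m\<in>S. d i * Q t i m)"
    using d_pos by (intro sum.cong refl) (force simp: Q_stationary)
  also have "\<dots> = d i" using i by (simp add: sum_distrib_left[symmetric] Q_stoch)
  finally show "(\<Sum>j\<in>S. Gam t i j) = d i" .
qed

lemma Gam_mtx:
  assumes "i \<in> S" "j \<in> S"
  shows "mtx_mult S (mtx_mult S (mtx_mult S (mtx_mult S (mtx_diag d) (Q t))
           (mtx_diag (\<lambda>k. 1 / d k))) (mtx_transpose (Q t))) (mtx_diag d) i j = Gam t i j"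
proof -
  have "mtx_mult S (mtx_mult S (mtx_mult S (mtx_diag d) (Q t)) (mtx_diag (\<lambda>k. 1 / d k)))
          (mtx_transpose (Q t)) i j = (\<Sum>m\<in>S. d i * Q t i m * (1 / d m) * Q t j m)"
    unfolding mtx_mult_def[of S "mtx_mult S (mtx_mult S (mtx_diag d) (Q t)) _"]
    using assms fin by (intro sum.cong refl) (simp add: mtx_diag_right mtx_diag_left mtx_transpose_def)
  with assms fin show ?thesis
    by (simp add: mtx_diag_right Gam_def sum_distrib_left sum_distrib_right mult_ac)
qed

section \<open>The lazy walk as a positive semidefinite operator\<close>

definition ip :: "('i \<Rightarrow> real) \<Rightarrow> ('i \<Rightarrow> real) \<Rightarrow> real" where
  "ip f g = (\<Sum>i\<in>S. d i * f i * g i)"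

definition ap :: "('i \<Rightarrow> real) \<Rightarrow> 'i \<Rightarrow> real" where
  "ap f i = (\<Sum>j\<in>S. A i j * f j)"

lemma ip_commute: "ip f g = ip g f"
  by (simp add: ip_def mult_ac)

lemma ip_CS: "(ip f g)\<^sup>2 \<le> ip f f * ip g g"
  using weighted_Cauchy_Schwarz[of S d f g] d_pos
  by (simp add: ip_def power2_eq_square less_imp_le mult_ac)

lemma ip_nonneg: "0 \<le> ip f f"
  unfolding ip_def using d_pos by (intro sum_nonneg) (simp add: less_imp_le mult.assoc)

lemma pair_sum_left: "(\<Sum>i\<in>S. \<Sum>j\<in>S. W i j * h i) = (\<Sum>i\<in>S. d i * h i)"
  by (simp add: deg sum_distrib_right)

lemma pair_sum_right: "(\<Sum>i\<in>S. \<Sum>j\<in>S. W i j * h j) = (\<Sum>i\<in>S. d i * h i)"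
  by (subst sum.swap) (simp add: deg sum_distrib_right W_sym)

lemma ap_eq: "i \<in> S \<Longrightarrow> ap f i = (f i + (\<Sum>j\<in>S. W i j * f j) / d i) / 2"
proof -
  assume i: "i \<in> S"
  have "ap f i = (\<Sum>j\<in>S. (if i = j then f j else 0) / 2 + (W i j * f j / d i) / 2)"
    unfolding ap_def A_def P_def mtx_diag_def by (intro sum.cong) (auto simp: field_simps)
  also have "\<dots> = (f i + (\<Sum>j\<in>S. W i j * f j) / d i) / 2"
    using i fin by (simp add: sum.distrib sum_divide_distrib[symmetric] add_divide_distrib)
  finally show ?thesis .
qed

text \<open>Laziness turns the bilinear form of the walk into a sum of products with nonnegative
  weights. Symmetry, positive semidefiniteness and a Cauchy-Schwarz inequality for the form can be
  read off from it.\<close>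

lemma ip_ap: "ip f (ap g) = (\<Sum>i\<in>S. \<Sum>j\<in>S. W i j * (f i + f j) * (g i + g j)) / 4"
proof -
  have "ip f (ap g) = (\<Sum>i\<in>S. d i * f i * g i / 2 + (\<Sum>j\<in>S. W i j * (f i * g j)) / 2)"
    unfolding ip_def
  proof (intro sum.cong refl)
    fix i assume "i \<in> S"
    then have "d i * f i * ap g i = d i * f i * g i / 2 + f i * (\<Sum>j\<in>S. W i j * g j) / 2"
      using d_pos[of i] by (simp add: ap_eq field_simps)
    then show "d i * f i * ap g i = d i * f i * g i / 2 + (\<Sum>j\<in>S. W i j * (f i * g j)) / 2"
      by (simp add: sum_distrib_left mult_ac)
  qed
  then have 1: "ip f (ap g) = (ip f g + (\<Sum>i\<in>S. \<Sum>j\<in>S. W i j * (f i * g j))) / 2"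
    by (simp add: sum.distrib sum_divide_distrib[symmetric] ip_def)
  have sw: "(\<Sum>i\<in>S. \<Sum>j\<in>S. W i j * (f j * g i)) = (\<Sum>i\<in>S. \<Sum>j\<in>S. W i j * (f i * g j))"
    by (subst sum.swap) (simp add: W_sym)
  have "(\<Sum>i\<in>S. \<Sum>j\<in>S. W i j * (f i + f j) * (g i + g j)) =
     (\<Sum>i\<in>S. \<Sum>j\<in>S. W i j * (f i * g i)) + (\<Sum>i\<in>S. \<Sum>j\<in>S. W i j * (f j * g j)) +
     ((\<Sum>i\<in>S. \<Sum>j\<in>S. W i j * (f i * g j)) + (\<Sum>i\<in>S. \<Sum>j\<in>S. W i j * (f j * g i)))"
    unfolding sum.distrib[symmetric] by (intro sum.cong refl) (simp add: algebra_simps)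
  also have "\<dots> = 2 * ip f g + 2 * (\<Sum>i\<in>S. \<Sum>j\<in>S. W i j * (f i * g j))"
    unfolding pair_sum_left pair_sum_right sw by (simp add: ip_def mult.assoc)
  finally show ?thesis using 1 by simp
qed

lemma ip_ap_commute: "ip f (ap g) = ip (ap f) g"
  unfolding ip_ap ip_commute[of "ap f"] by (simp add: mult_ac)

text \<open>The Dirichlet form. The usual factor 1/2 for ordered pairs is halved once more because
  the walk is lazy.\<close>

lemma ip_minus_ap:
  "ip f f - ip f (ap f) = (\<Sum>i\<in>S. \<Sum>j\<in>S. W i j * (f i - f j)\<^sup>2) / 4"
proof -
  have "(\<Sum>i\<in>S. \<Sum>j\<in>S. W i j * (f i - f j)\<^sup>2) + (\<Sum>i\<in>S. \<Sum>j\<in>S. W i j * (f i + f j) * (f i + f j))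
     = 2 * (\<Sum>i\<in>S. \<Sum>j\<in>S. W i j * (f i)\<^sup>2) + 2 * (\<Sum>i\<in>S. \<Sum>j\<in>S. W i j * (f j)\<^sup>2)"
    unfolding sum.distrib[symmetric] sum_distrib_left
    by (intro sum.cong refl) (simp add: algebra_simps power2_eq_square)
  also have "\<dots> = 4 * ip f f"
    unfolding pair_sum_left pair_sum_right by (simp add: ip_def power2_eq_square mult.assoc)
  finally show ?thesis by (simp add: ip_ap)
qed

lemma ap_psd_CS: "(ip f (ap g))\<^sup>2 \<le> ip f (ap f) * ip g (ap g)"
proof -
  have "(\<Sum>p\<in>S \<times> S. W (fst p) (snd p) * (f (fst p) + f (snd p)) * (g (fst p) + g (snd p)))\<^sup>2
     \<le> (\<Sum>p\<in>S \<times> S. W (fst p) (snd p) * (f (fst p) + f (snd p))\<^sup>2) *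
       (\<Sum>p\<in>S \<times> S. W (fst p) (snd p) * (g (fst p) + g (snd p))\<^sup>2)"
    by (intro weighted_Cauchy_Schwarz) (auto simp: W_nonneg)
  then show ?thesis
    by (simp add: ip_ap sum.cartesian_product power2_eq_square power_divide mult.assoc
        case_prod_beta field_simps)
qed

lemma ap_one: "i \<in> S \<Longrightarrow> ap (\<lambda>_. c) i = c"
  by (simp add: ap_def sum_distrib_right[symmetric] A_stoch)

lemma ip_ap_one: "ip (\<lambda>_. 1) (ap f) = ip (\<lambda>_. 1) f"
  unfolding ip_ap_commute by (simp add: ip_def ap_one)

lemma ap_funpow: "i \<in> S \<Longrightarrow> (ap ^^ t) f i = (\<Sum>j\<in>S. mtx_pow S A t i j * f j)"
proof (induction t arbitrary: i)
  case 0
  have "(\<Sum>j\<in>S. mtx_diag (\<lambda>_. 1) i j * f j) = (\<Sum>j\<in>S. if j = i then f i else 0)"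
    by (intro sum.cong) (auto simp: mtx_diag_def)
  with 0 fin show ?case by simp
next
  case (Suc t)
  have "(ap ^^ Suc t) f i = (\<Sum>k\<in>S. A i k * (\<Sum>j\<in>S. mtx_pow S A t k j * f j))"
    by (simp add: ap_def[of "(ap ^^ t) f"] Suc.IH)
  also have "\<dots> = (\<Sum>j\<in>S. mtx_pow S A (Suc t) i j * f j)"
    unfolding mtx_pow.simps mtx_mult_def sum_distrib_left sum_distrib_right
    by (subst sum.swap) (simp add: mult.assoc)
  finally show ?case .
qed

text \<open>The distribution after one step from \<open>i\<close>, as a density with respect to the
  measure \<open>d\<close>.\<close>

definition dens :: "'i \<Rightarrow> 'i \<Rightarrow> real" where
  "dens i j = W i j / (d i * d j)"

text \<open>By reversibility, dividing by the stationary measure turns the distribution of the walk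
  from \<open>i\<close> into the operator \<open>ap\<close> iterated on a density.\<close>

lemma Q_over_d:
  assumes "i \<in> S" "m \<in> S"
  shows "Q t i m / d m = (ap ^^ t) (dens i) m"
proof -
  have "(ap ^^ t) (dens i) m = (\<Sum>j\<in>S. mtx_pow S A t m j * dens i j)"
    using assms by (simp add: ap_funpow)
  also have "\<dots> = (\<Sum>j\<in>S. P i j * mtx_pow S A t j m / d m)"
  proof (intro sum.cong refl)
    fix j assume "j \<in> S"
    then show "mtx_pow S A t m j * dens i j = P i j * mtx_pow S A t j m / d m"
      using pow_rev[of m j t] d_pos[of m] d_pos[of j] d_pos[of i] assms
      by (simp add: dens_def P_def field_simps)
  qed
  also have "\<dots> = Q t i m / d m"
    by (simp add: Q_def mtx_mult_def sum_divide_distrib)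
  finally show ?thesis by simp
qed

lemma Gam_ip:
  assumes "i \<in> S" "j \<in> S"
  shows "Gam t i j = d i * d j * ip ((ap ^^ t) (dens i)) ((ap ^^ t) (dens j))"
proof -
  have "(\<Sum>m\<in>S. Q t i m * Q t j m / d m) = (\<Sum>m\<in>S. d m * (Q t i m / d m) * (Q t j m / d m))"
    using d_pos by (intro sum.cong refl) force
  also have "\<dots> = ip ((ap ^^ t) (dens i)) ((ap ^^ t) (dens j))"
    unfolding ip_def using assms by (intro sum.cong refl) (simp add: Q_over_d)
  finally show ?thesis by (simp add: Gam_def)
qed

text \<open>The squared norm of \<open>ap f\<close> is the form evaluated at \<open>f\<close> and
  \<open>ap f\<close>. Cauchy-Schwarz for the form leaves one factor to which the gap applies at
  \<open>ap f\<close>, again orthogonal to the constants; after cancelling, the gap at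
  \<open>f\<close> gives the second \<rho>.\<close>

lemma ap_contracts:
  assumes gap: "\<And>f. ip (\<lambda>_. 1) f = 0 \<Longrightarrow> ip f (ap f) \<le> \<rho> * ip f f" and "0 \<le> \<rho>"
    and f: "ip (\<lambda>_. 1) f = 0"
  shows "ip (ap f) (ap f) \<le> \<rho>\<^sup>2 * ip f f"
proof (cases "ip (ap f) (ap f) = 0")
  case True
  then show ?thesis using ip_nonneg[of f] by simp
next
  case False
  then have pos: "0 < ip (ap f) (ap f)" using ip_nonneg[of "ap f"] by linarith
  have m0: "ip (\<lambda>_. 1) (ap f) = 0" using f by (simp add: ip_ap_one)
  have nn: "0 \<le> ip f (ap f)"
    unfolding ip_ap mult.assoc by (auto simp: W_nonneg intro!: sum_nonneg)
  have "(ip (ap f) (ap f))\<^sup>2 = (ip f (ap (ap f)))\<^sup>2"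
    by (simp add: ip_ap_commute)
  also have "\<dots> \<le> ip f (ap f) * ip (ap f) (ap (ap f))" by (rule ap_psd_CS)
  also have "\<dots> \<le> ip f (ap f) * (\<rho> * ip (ap f) (ap f))"
    using gap[OF m0] nn by (rule mult_left_mono)
  finally have "ip (ap f) (ap f) \<le> \<rho> * ip f (ap f)"
    using pos by (simp add: power2_eq_square mult_ac)
  also have "\<dots> \<le> \<rho> * (\<rho> * ip f f)" using gap[OF f] \<open>0 \<le> \<rho>\<close> by (rule mult_left_mono)
  finally show ?thesis by (simp add: power2_eq_square mult_ac)
qed

lemma ap_funpow_contracts:
  assumes gap: "\<And>f. ip (\<lambda>_. 1) f = 0 \<Longrightarrow> ip f (ap f) \<le> \<rho> * ip f f" and "0 \<le> \<rho>"
    and f: "ip (\<lambda>_. 1) f = 0"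
  shows "ip (\<lambda>_. 1) ((ap ^^ t) f) = 0 \<and> ip ((ap ^^ t) f) ((ap ^^ t) f) \<le> \<rho> ^ (2 * t) * ip f f"
proof (induction t)
  case 0 with f show ?case by simp
next
  case (Suc t)
  have "ip (ap ((ap ^^ t) f)) (ap ((ap ^^ t) f)) \<le> \<rho>\<^sup>2 * ip ((ap ^^ t) f) ((ap ^^ t) f)"
    using Suc ap_contracts[OF gap \<open>0 \<le> \<rho>\<close>] by blast
  also have "\<dots> \<le> \<rho>\<^sup>2 * (\<rho> ^ (2 * t) * ip f f)"
    using Suc by (intro mult_left_mono) auto
  finally show ?case using Suc by (simp add: ip_ap_one power2_eq_square mult_ac)
qed

text \<open>The densities \<open>dens i\<close> split into the constant \<open>1 / vol\<close>, which gives the main term, and a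
  part orthogonal to the constants, which shrinks by the factor \<open>\<rho>\<close> in every lazy step. The bound on
  \<open>W\<close> limits the squared norm of the densities to \<open>c / vol\<close>, independently of \<open>i\<close>.\<close>

lemma Gam_lower:
  assumes gap: "\<And>f. ip (\<lambda>_. 1) f = 0 \<Longrightarrow> ip f (ap f) \<le> \<rho> * ip f f" and "0 \<le> \<rho>"
    and vol: "vol = (\<Sum>i\<in>S. d i)"
    and W_le: "\<And>i j. i \<in> S \<Longrightarrow> j \<in> S \<Longrightarrow> W i j \<le> c * d i * d j / vol"
    and "i \<in> S" "j \<in> S"
  shows "(1 - c * \<rho> ^ (2 * t)) * d i * d j / vol \<le> Gam t i j"
proof -
  have vpos: "0 < vol" unfolding vol using fin \<open>i \<in> S\<close> d_pos by (intro sum_pos) auto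
  define z where "z k = (\<lambda>m. dens k m - 1 / vol)" for k
  have one: "ip (\<lambda>_. 1) (dens k) = 1" if "k \<in> S" for k
  proof -
    have "ip (\<lambda>_. 1) (dens k) = (\<Sum>m\<in>S. P k m)"
      unfolding ip_def using d_pos by (intro sum.cong refl) (force simp: dens_def P_def)
    with that show ?thesis by (simp add: P_stoch)
  qed
  have z0: "ip (\<lambda>_. 1) (z k) = 0" if "k \<in> S" for k
  proof -
    have "ip (\<lambda>_. 1) (z k) = ip (\<lambda>_. 1) (dens k) - (\<Sum>i\<in>S. d i) / vol"
      by (simp add: ip_def z_def algebra_simps sum_subtractf sum_divide_distrib)
    with that vpos show ?thesis by (simp add: one vol)
  qed
  \<comment> \<open>Projecting away the constants does not increase the norm. In the squared norm of
    \<open>dens k\<close>, one density is at most \<open>c / vol\<close> and the rest is a row of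
    \<open>P\<close>, which sums to 1.\<close>
  have znorm: "ip (z k) (z k) \<le> c / vol" if k: "k \<in> S" for k
  proof -
    have "ip (dens k) (dens k) = ip (z k) (z k) + 2 / vol * ip (\<lambda>_. 1) (z k) + (1 / vol)\<^sup>2 * (\<Sum>i\<in>S. d i)"
      unfolding ip_def sum_distrib_left sum.distrib[symmetric] z_def
      by (intro sum.cong refl) (simp add: algebra_simps power2_eq_square)
    then have "ip (z k) (z k) \<le> ip (dens k) (dens k)"
      using vpos by (simp add: z0[OF k] vol[symmetric])
    also have "\<dots> \<le> (\<Sum>m\<in>S. c / vol * P k m)"
      unfolding ip_def
    proof (intro sum_mono)
      fix m assume m: "m \<in> S"
      have "d m * dens k m * dens k m = P k m * (W k m / (d k * d m))"
        using d_pos[OF m] d_pos[OF k] by (simp add: dens_def P_def field_simps)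
      also have "\<dots> \<le> P k m * (c / vol)"
        using W_le[OF k m] d_pos[OF m] d_pos[OF k] vpos P_nonneg[OF k m]
        by (intro mult_left_mono) (simp_all add: field_simps)
      finally show "d m * dens k m * dens k m \<le> c / vol * P k m" by (simp add: mult.commute)
    qed
    also have "\<dots> = c / vol" using P_stoch[OF k] by (simp only: sum_distrib_left[symmetric] mult_1_right)
    finally show ?thesis .
  qed
  have shift: "(ap ^^ t) (dens k) m = 1 / vol + (ap ^^ t) (z k) m" if "m \<in> S" for k m t
    using that
  proof (induction t arbitrary: m)
    case 0 show ?case by (simp add: z_def)
  next
    case (Suc t)
    have "(ap ^^ Suc t) (dens k) m = ap (\<lambda>_. 1 / vol) m + ap ((ap ^^ t) (z k)) m"
      by (simp add: ap_def[of "(ap ^^ t) _"] ap_def[of "\<lambda>_. _"] Suc.IH distrib_left sum.distrib)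
    with Suc.prems show ?case by (simp add: ap_one)
  qed
  let ?x = "(ap ^^ t) (z i)" and ?y = "(ap ^^ t) (z j)"
  have x: "ip (\<lambda>_. 1) ?x = 0" "ip ?x ?x \<le> \<rho> ^ (2 * t) * ip (z i) (z i)"
   and y: "ip (\<lambda>_. 1) ?y = 0" "ip ?y ?y \<le> \<rho> ^ (2 * t) * ip (z j) (z j)"
    using ap_funpow_contracts[OF gap \<open>0 \<le> \<rho>\<close>] z0 \<open>i \<in> S\<close> \<open>j \<in> S\<close> by blast+
  let ?r = "\<rho> ^ (2 * t) * (c / vol)"
  have xr: "ip ?x ?x \<le> ?r" and yr: "ip ?y ?y \<le> ?r"
    using x(2) y(2) znorm[OF \<open>i \<in> S\<close>] znorm[OF \<open>j \<in> S\<close>] \<open>0 \<le> \<rho>\<close>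
    by (meson mult_left_mono order_trans zero_le_power)+
  have r0: "0 \<le> ?r" using xr ip_nonneg[of ?x] by linarith
  have "(ip ?x ?y)\<^sup>2 \<le> ip ?x ?x * ip ?y ?y" by (rule ip_CS)
  also have "\<dots> \<le> ?r * ?r" using xr yr ip_nonneg r0 by (intro mult_mono) auto
  finally have "\<bar>ip ?x ?y\<bar> \<le> ?r"
    using r0 by (metis abs_le_square_iff abs_of_nonneg power2_eq_square)
  then have xy: "- ?r \<le> ip ?x ?y" by linarith
  have "ip ((ap ^^ t) (dens i)) ((ap ^^ t) (dens j)) =
      (1 / vol)\<^sup>2 * (\<Sum>i\<in>S. d i) + 1 / vol * ip (\<lambda>_. 1) ?x + 1 / vol * ip (\<lambda>_. 1) ?y + ip ?x ?y"
    unfolding ip_def sum_distrib_left sum.distrib[symmetric]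
    by (intro sum.cong refl) (simp add: shift algebra_simps power2_eq_square)
  also have "\<dots> = 1 / vol + ip ?x ?y" using vpos by (simp add: x y vol[symmetric] power2_eq_square)
  finally have "Gam t i j = d i * d j * (1 / vol + ip ?x ?y)"
    using Gam_ip \<open>i \<in> S\<close> \<open>j \<in> S\<close> by simp
  also have "\<dots> \<ge> d i * d j * (1 / vol - ?r)"
    using xy d_pos \<open>i \<in> S\<close> \<open>j \<in> S\<close> by (intro mult_left_mono) (auto simp: less_imp_le)
  finally show ?thesis
    by (simp add: left_diff_distrib right_diff_distrib diff_divide_distrib mult_ac)
qed

end

section \<open>Cheeger's inequality\<close>

definition cut :: "'i set \<Rightarrow> 'i mtx \<Rightarrow> 'i set \<Rightarrow> real" where
  "cut S W T = (\<Sum>i\<in>S. \<Sum>j\<in>S. if i \<in> T \<and> j \<notin> T then W i j else 0)"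

text \<open>Layer-cake argument by induction on the number of distinct nonzero values. Truncating
  \<open>g\<close> at its second largest value \<open>m'\<close> changes both sides by multiples of
  \<open>m - m'\<close>, and \<open>level\<close> compares them on the top level set. The factor 2
  reflects that each cut pair occurs in both orders on the right.\<close>

lemma coarea:
  fixes g :: "'i \<Rightarrow> real"
  assumes fin: "finite S"
    and sym: "\<And>i j. i \<in> S \<Longrightarrow> j \<in> S \<Longrightarrow> W i j = W j i"
    and g0: "\<And>i. i \<in> S \<Longrightarrow> 0 \<le> g i"
    and level: "\<And>t. 0 \<le> t \<Longrightarrow> (\<Sum>i\<in>S. if g i > t then d i else 0) \<le> \<kappa> * cut S W {i. g i > t}"
  shows "2 * (\<Sum>i\<in>S. d i * g i) \<le> \<kappa> * (\<Sum>i\<in>S. \<Sum>j\<in>S. W i j * \<bar>g i - g j\<bar>)"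
  using g0 level
proof (induction "card (g ` S - {0})" arbitrary: g rule: less_induct)
  case less
  show ?case
  proof (cases "\<forall>i\<in>S. g i = 0")
    case True
    then show ?thesis by simp
  next
    case False
    define m where "m = Max (g ` S)"
    \<comment> \<open>Inserting 0 covers the case that \<open>m\<close> is the only value.\<close>
    define m' where "m' = Max (insert 0 (g ` S - {m}))"
    define g' where "g' i = min (g i) m'" for i
    define T where "T = {i. g i > m'}"
    have gm: "g i \<le> m" if "i \<in> S" for i unfolding m_def using fin that by simp
    obtain i0 where i0: "i0 \<in> S" "g i0 \<noteq> 0" using False by blast
    then have m_in: "m \<in> g ` S" unfolding m_def using fin by (intro Max_in) auto
    have m_pos: "0 < m" using gm[OF i0(1)] less.prems(1)[OF i0(1)] i0(2) by linarith
    have m'_in: "m' \<in> insert 0 (g ` S - {m})" unfolding m'_def using fin by (intro Max_in) auto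
    have m'0: "0 \<le> m'" unfolding m'_def using fin by simp
    have m'm: "m' < m" using m'_in m_pos gm by force
    have gcase: "g i = m \<or> g i \<le> m'" if "i \<in> S" for i
      unfolding m'_def using fin that by (auto intro!: Max_ge)
    have decomp: "g i = g' i + (if i \<in> T then m - m' else 0)" if "i \<in> S" for i
      using gcase[OF that] m'm by (auto simp: g'_def T_def)
    have "g' ` S - {0} \<subseteq> g ` S - {0} - {m}"
      using m'_in m'm gcase by (auto simp: g'_def min_def)
    moreover have "m \<in> g ` S - {0}" using m_in m_pos by simp
    then have "g ` S - {0} - {m} \<subset> g ` S - {0}" by blast
    ultimately have "card (g' ` S - {0}) < card (g ` S - {0})"
      using fin by (intro psubset_card_mono) auto
    moreover have "0 \<le> g' i" if "i \<in> S" for i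
      using less.prems(1)[OF that] m'0 by (simp add: g'_def)
    moreover have "(\<Sum>i\<in>S. if g' i > t then d i else 0) \<le> \<kappa> * cut S W {i. g' i > t}" if "0 \<le> t" for t
    proof (cases "t < m'")
      case True
      then have "g' i > t \<longleftrightarrow> g i > t" for i by (auto simp: g'_def)
      then show ?thesis using less.prems(2)[OF that] by simp
    next
      case False
      then have "\<not> g' i > t" for i by (auto simp: g'_def)
      then show ?thesis by (simp add: cut_def)
    qed
    ultimately have IH: "2 * (\<Sum>i\<in>S. d i * g' i) \<le> \<kappa> * (\<Sum>i\<in>S. \<Sum>j\<in>S. W i j * \<bar>g' i - g' j\<bar>)"
      by (rule less.hyps)
    have dT: "(\<Sum>i\<in>S. d i * g i) = (\<Sum>i\<in>S. d i * g' i) + (m - m') * (\<Sum>i\<in>S. if g i > m' then d i else 0)"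
      unfolding sum_distrib_left sum.distrib[symmetric]
      by (intro sum.cong refl) (simp add: decomp T_def algebra_simps split: if_splits)
    have split: "\<bar>g i - g j\<bar> = \<bar>g' i - g' j\<bar> + (if i \<in> T \<and> j \<notin> T then m - m' else 0)
       + (if j \<in> T \<and> i \<notin> T then m - m' else 0)" if "i \<in> S" "j \<in> S" for i j
      using gcase[OF that(1)] gcase[OF that(2)] m'm by (auto simp: g'_def T_def)
    have "(\<Sum>i\<in>S. \<Sum>j\<in>S. W i j * \<bar>g i - g j\<bar>) =
      (\<Sum>i\<in>S. \<Sum>j\<in>S. W i j * \<bar>g' i - g' j\<bar>) + (m - m') * cut S W T
       + (m - m') * (\<Sum>i\<in>S. \<Sum>j\<in>S. if j \<in> T \<and> i \<notin> T then W i j else 0)"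
      unfolding cut_def sum_distrib_left sum.distrib[symmetric]
      by (intro sum.cong refl) (simp add: split algebra_simps)
    also have "(\<Sum>i\<in>S. \<Sum>j\<in>S. if j \<in> T \<and> i \<notin> T then W i j else 0) = cut S W T"
      unfolding cut_def by (subst sum.swap) (intro sum.cong refl, simp add: sym)
    finally have E: "(\<Sum>i\<in>S. \<Sum>j\<in>S. W i j * \<bar>g i - g j\<bar>) =
      (\<Sum>i\<in>S. \<Sum>j\<in>S. W i j * \<bar>g' i - g' j\<bar>) + 2 * ((m - m') * cut S W T)" by simp
    have "(m - m') * (\<Sum>i\<in>S. if g i > m' then d i else 0) \<le> (m - m') * (\<kappa> * cut S W T)"
      unfolding T_def using less.prems(2)[OF m'0] m'm by (intro mult_left_mono) auto
    with IH show ?thesis unfolding dT E by (simp add: algebra_simps)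
  qed
qed

context wgraph
begin

text \<open>The coarea bound is applied to the square of \<open>f\<close>, whose level sets are
  level sets of \<open>f\<close>, and Cauchy-Schwarz splits the differences of squares. In the
  notation below, F \<le> 3 G and G^2 \<le> 4 E F, hence F \<le> 36 E.\<close>

lemma cheeger_half:
  assumes f0: "\<And>i. i \<in> S \<Longrightarrow> 0 \<le> f i"
    and level: "\<And>t. 0 \<le> t \<Longrightarrow> (\<Sum>i\<in>S. if f i > t then d i else 0) \<le> 6 * cut S W {i. f i > t}"
  shows "(\<Sum>i\<in>S. d i * (f i)\<^sup>2) \<le> 36 * (\<Sum>i\<in>S. \<Sum>j\<in>S. W i j * (f i - f j)\<^sup>2)"
proof -
  let ?F = "\<Sum>i\<in>S. d i * (f i)\<^sup>2"
  let ?E = "\<Sum>i\<in>S. \<Sum>j\<in>S. W i j * (f i - f j)\<^sup>2"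
  let ?G = "\<Sum>i\<in>S. \<Sum>j\<in>S. W i j * \<bar>(f i)\<^sup>2 - (f j)\<^sup>2\<bar>"
  have F0: "0 \<le> ?F" using d_pos by (intro sum_nonneg) (simp add: less_imp_le)
  have E0: "0 \<le> ?E" by (intro sum_nonneg) (simp add: W_nonneg)
  have "2 * ?F \<le> 6 * ?G"
  proof (rule coarea)
    fix t :: real assume t: "0 \<le> t"
    have eq: "(f i)\<^sup>2 > t \<longleftrightarrow> f i > sqrt t" if "i \<in> S" for i
      using f0[OF that] t by (metis real_less_lsqrt real_sqrt_less_iff real_sqrt_unique)
    have "(\<Sum>i\<in>S. if (f i)\<^sup>2 > t then d i else 0) = (\<Sum>i\<in>S. if f i > sqrt t then d i else 0)"
      by (intro sum.cong refl) (simp add: eq)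
    also have "\<dots> \<le> 6 * cut S W {i. f i > sqrt t}" using t by (intro level) simp
    also have "cut S W {i. f i > sqrt t} = cut S W {i. (f i)\<^sup>2 > t}"
      unfolding cut_def by (intro sum.cong refl) (simp add: eq)
    finally show "(\<Sum>i\<in>S. if (f i)\<^sup>2 > t then d i else 0) \<le> 6 * cut S W {i. (f i)\<^sup>2 > t}" .
  qed (auto simp: fin W_sym)
  then have FG: "?F \<le> 3 * ?G" by simp
  have "(\<Sum>p\<in>S \<times> S. W (fst p) (snd p) * \<bar>f (fst p) - f (snd p)\<bar> * (f (fst p) + f (snd p)))\<^sup>2
     \<le> (\<Sum>p\<in>S \<times> S. W (fst p) (snd p) * \<bar>f (fst p) - f (snd p)\<bar>\<^sup>2) *
       (\<Sum>p\<in>S \<times> S. W (fst p) (snd p) * (f (fst p) + f (snd p))\<^sup>2)"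
    by (intro weighted_Cauchy_Schwarz) (auto simp: W_nonneg)
  moreover have "\<bar>f i - f j\<bar> * (f i + f j) = \<bar>(f i)\<^sup>2 - (f j)\<^sup>2\<bar>" if "i \<in> S" "j \<in> S" for i j
    using f0[OF that(1)] f0[OF that(2)]
    by (simp add: square_diff_square_factored power2_eq_square abs_mult mult.commute)
  then have "(\<Sum>p\<in>S \<times> S. W (fst p) (snd p) * \<bar>f (fst p) - f (snd p)\<bar> * (f (fst p) + f (snd p))) = ?G"
    unfolding sum.cartesian_product by (intro sum.cong refl) (auto simp: mult.assoc)
  ultimately have CS: "?G\<^sup>2 \<le> ?E * (\<Sum>i\<in>S. \<Sum>j\<in>S. W i j * (f i + f j)\<^sup>2)"
    by (simp add: sum.cartesian_product case_prod_beta)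
  have "(\<Sum>i\<in>S. \<Sum>j\<in>S. W i j * (f i + f j)\<^sup>2) = 4 * ip f (ap f)"
    by (simp add: ip_ap power2_eq_square mult.assoc)
  also have "\<dots> \<le> 4 * ?F"
    using E0 ip_minus_ap[of f] by (simp add: ip_def power2_eq_square mult.assoc)
  finally have "?G\<^sup>2 \<le> ?E * (4 * ?F)" using CS E0 by (meson mult_left_mono order_trans)
  moreover have "?F\<^sup>2 \<le> (3 * ?G)\<^sup>2" using FG F0 by (intro power_mono)
  ultimately have "?F * ?F \<le> (36 * ?E) * ?F" by (simp add: power2_eq_square mult_ac)
  then have "?F \<le> 36 * ?E" if "0 < ?F" using that by (rule mult_right_le_imp_le)
  then show ?thesis using F0 E0 by (cases "0 < ?F") linarith+
qed

text \<open>Take the smallest value of \<open>f\<close> with at most half of the mass strictly above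
  it. The next smaller value violates this condition, which bounds the mass strictly below.\<close>

lemma ex_median:
  fixes f k :: "'i \<Rightarrow> real"
  assumes "S \<noteq> {}" and k0: "\<And>i. i \<in> S \<Longrightarrow> 0 \<le> k i"
  shows "\<exists>m. 2 * (\<Sum>i\<in>S. if f i > m then k i else 0) \<le> sum k S \<and>
             2 * (\<Sum>i\<in>S. if f i < m then k i else 0) \<le> sum k S"
proof -
  define up where "up m = (\<Sum>i\<in>S. if f i > m then k i else 0)" for m
  define M where "M = {m \<in> f ` S. 2 * up m \<le> sum k S}"
  have finM: "finite M" unfolding M_def using fin by simp
  have "Max (f ` S) \<in> f ` S" using fin \<open>S \<noteq> {}\<close> by (intro Max_in) auto
  moreover have "up (Max (f ` S)) = 0"
  proof -
    have "\<not> f i > Max (f ` S)" if "i \<in> S" for i using fin that by (simp add: not_less)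
    then show ?thesis unfolding up_def by (intro sum.neutral) auto
  qed
  ultimately have "Max (f ` S) \<in> M" unfolding M_def using k0 by (auto intro: sum_nonneg)
  then have minM: "Min M \<in> M" using finM by (intro Min_in) auto
  define m where "m = Min M"
  have m1: "2 * up m \<le> sum k S" using minM by (simp add: M_def m_def)
  have "2 * (\<Sum>i\<in>S. if f i < m then k i else 0) \<le> sum k S"
  proof (cases "\<exists>i\<in>S. f i < m")
    case False
    then have "(\<Sum>i\<in>S. if f i < m then k i else 0) = 0" by (intro sum.neutral) auto
    then show ?thesis using k0 by (simp add: sum_nonneg)
  next
    case True
    define q where "q = Max {x \<in> f ` S. x < m}"
    have q: "q \<in> {x \<in> f ` S. x < m}" unfolding q_def using fin True by (intro Max_in) auto
    have "q \<notin> M"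
    proof
      assume "q \<in> M"
      then have "m \<le> q" unfolding m_def using finM by simp
      with q show False by simp
    qed
    then have up_q: "2 * up q > sum k S" using q by (auto simp: M_def)
    have iff: "f i > q \<longleftrightarrow> \<not> f i < m" if "i \<in> S" for i
    proof
      assume "f i > q"
      show "\<not> f i < m"
      proof
        assume "f i < m"
        then have "f i \<le> q" unfolding q_def using fin that by (intro Max_ge) auto
        with \<open>f i > q\<close> show False by simp
      qed
    qed (use q in auto)
    have "up q + (\<Sum>i\<in>S. if f i < m then k i else 0) = sum k S"
      unfolding up_def sum.distrib[symmetric] by (intro sum.cong refl) (simp add: iff)
    with up_q show ?thesis by simp
  qed
  with m1 show ?thesis unfolding up_def by blast
qed

text \<open>After subtracting a median with respect to \<open>k\<close>, the positive and the
  negative part of \<open>f\<close> each live on at most half of the \<open>k\<close>-mass, where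
  \<open>expand\<close> applies. As \<open>f\<close> is orthogonal to the constants, the shift only
  increases its norm. The gap 1/144 is the constant 36 combined with the factor 1/4 of the Dirichlet
  form.\<close>

lemma cheeger:
  fixes k :: "'i \<Rightarrow> real"
  assumes "S \<noteq> {}" and k0: "\<And>i. i \<in> S \<Longrightarrow> 0 \<le> k i"
    and expand: "\<And>T. T \<subseteq> S \<Longrightarrow> 2 * sum k T \<le> sum k S \<Longrightarrow> sum d T \<le> 6 * cut S W T"
    and f: "ip (\<lambda>_. 1) f = 0"
  shows "ip f (ap f) \<le> 143 / 144 * ip f f"
proof -
  obtain m where m: "2 * (\<Sum>i\<in>S. if f i > m then k i else 0) \<le> sum k S"
      "2 * (\<Sum>i\<in>S. if f i < m then k i else 0) \<le> sum k S"
    using ex_median[OF assms(1), of k f] k0 by blast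
  have half: "(\<Sum>i\<in>S. d i * (h i)\<^sup>2) \<le> 36 * (\<Sum>i\<in>S. \<Sum>j\<in>S. W i j * (h i - h j)\<^sup>2)"
    if h: "\<And>i. i \<in> S \<Longrightarrow> 0 \<le> h i" and "2 * (\<Sum>i\<in>S. if h i > 0 then k i else 0) \<le> sum k S" for h
  proof (rule cheeger_half[OF h])
    fix t :: real assume "0 \<le> t"
    let ?T = "{i \<in> S. h i > t}"
    have "sum k ?T = (\<Sum>i\<in>S. if h i > t then k i else 0)"
      using fin by (simp add: sum.inter_filter)
    also have "\<dots> \<le> (\<Sum>i\<in>S. if h i > 0 then k i else 0)"
      using \<open>0 \<le> t\<close> k0 by (intro sum_mono) auto
    finally have "sum d ?T \<le> 6 * cut S W ?T" using that(2) by (intro expand) auto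
    moreover have "sum d ?T = (\<Sum>i\<in>S. if h i > t then d i else 0)"
      using fin by (simp add: sum.inter_filter)
    moreover have "cut S W ?T = cut S W {i. h i > t}"
      unfolding cut_def by (intro sum.cong refl) auto
    ultimately show "(\<Sum>i\<in>S. if h i > t then d i else 0) \<le> 6 * cut S W {i. h i > t}" by simp
  qed auto
  define p where "p i = max (f i - m) 0" for i
  define q where "q i = max (m - f i) 0" for i
  have "(\<Sum>i\<in>S. d i * (p i)\<^sup>2) \<le> 36 * (\<Sum>i\<in>S. \<Sum>j\<in>S. W i j * (p i - p j)\<^sup>2)"
    using m(1) by (intro half) (auto simp: p_def less_max_iff_disj)
  moreover have "(\<Sum>i\<in>S. d i * (q i)\<^sup>2) \<le> 36 * (\<Sum>i\<in>S. \<Sum>j\<in>S. W i j * (q i - q j)\<^sup>2)"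
    using m(2) by (intro half) (auto simp: q_def less_max_iff_disj)
  ultimately have "(\<Sum>i\<in>S. d i * ((p i)\<^sup>2 + (q i)\<^sup>2)) \<le>
      36 * (\<Sum>i\<in>S. \<Sum>j\<in>S. W i j * ((p i - p j)\<^sup>2 + (q i - q j)\<^sup>2))"
    by (simp add: distrib_left sum.distrib)
  also have "\<dots> \<le> 36 * (\<Sum>i\<in>S. \<Sum>j\<in>S. W i j * (f i - f j)\<^sup>2)"
  proof -
    have "(p i - p j)\<^sup>2 + (q i - q j)\<^sup>2 \<le> (f i - f j)\<^sup>2" for i j
    proof -
      \<comment> \<open>\<open>p\<close> grows and \<open>q\<close> shrinks with \<open>f\<close>,
        so both differences have the same sign and their squares add up to at most the square of
        their sum.\<close>
      have "0 \<le> (p i - p j) * (q j - q i)" 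
        by (cases "f i \<le> f j") (auto simp: p_def q_def intro!: mult_nonneg_nonneg mult_nonpos_nonpos)
      moreover have "f i - f j = (p i - p j) + (q j - q i)" by (auto simp: p_def q_def)
      ultimately show ?thesis
        by (simp only: power2_sum power2_commute[of "q i" "q j"])
    qed
    then show ?thesis by (intro mult_left_mono sum_mono) (auto simp: W_nonneg)
  qed
  also have "\<dots> = 144 * (ip f f - ip f (ap f))" by (simp add: ip_minus_ap)
  finally have 1: "(\<Sum>i\<in>S. d i * ((p i)\<^sup>2 + (q i)\<^sup>2)) \<le> 144 * (ip f f - ip f (ap f))" .
  have "ip f f + m\<^sup>2 * sum d S = (\<Sum>i\<in>S. d i * ((p i)\<^sup>2 + (q i)\<^sup>2)) + 2 * m * ip (\<lambda>_. 1) f"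
    unfolding ip_def sum_distrib_left sum.distrib[symmetric]
    by (intro sum.cong refl) (auto simp: p_def q_def max_def power2_eq_square algebra_simps)
  moreover have "0 \<le> m\<^sup>2 * sum d S" using d_pos by (intro mult_nonneg_nonneg sum_nonneg) (auto simp: less_imp_le)
  ultimately have "ip f f \<le> (\<Sum>i\<in>S. d i * ((p i)\<^sup>2 + (q i)\<^sup>2))" using f by simp
  with 1 show ?thesis by simp
qed

lemma Gam_expander:
  fixes k :: "'i \<Rightarrow> real"
  assumes "\<And>i. i \<in> S \<Longrightarrow> 0 \<le> k i"
    and "\<And>T. T \<subseteq> S \<Longrightarrow> 2 * sum k T \<le> sum k S \<Longrightarrow> sum d T \<le> 6 * cut S W T"
    and W_le: "\<And>i j. i \<in> S \<Longrightarrow> j \<in> S \<Longrightarrow> W i j \<le> 16 * d i * d j / sum d S"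
    and ij: "i \<in> S" "j \<in> S"
  shows "d i * d j / (4 * sum d S) < Gam t0 i j"
proof -
  have ne: "S \<noteq> {}" using ij by auto
  have vpos: "0 < sum d S" using fin ne d_pos by (intro sum_pos) auto
  \<comment> \<open>The 594 factors are grouped to keep the arithmetic small: 0.51^6 is below 1/50,
    and 1 - 16/50 exceeds the required 1/4, which also gives strictness.\<close>
  have "2 * t0 = 99 * 6" by (simp add: t0_def)
  then have "(143 / 144 :: real) ^ (2 * t0) = ((143 / 144) ^ 99) ^ 6"
    by (simp only: power_mult)
  also have "\<dots> \<le> (51 / 100) ^ 6"
    by (intro power_mono) (simp_all add: power_divide)
  also have "\<dots> \<le> 1 / 50" by (simp add: power_divide)
  finally have num: "(143 / 144 :: real) ^ (2 * t0) \<le> 1 / 50" .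
  have "d i * d j / (4 * sum d S) < (1 - 16 * (143 / 144) ^ (2 * t0)) * d i * d j / sum d S"
  proof -
    have "1 / 4 * (d i * d j / sum d S) < (1 - 16 * (143 / 144) ^ (2 * t0)) * (d i * d j / sum d S)"
      using num vpos d_pos ij by (intro mult_strict_right_mono) (auto intro!: divide_pos_pos)
    then show ?thesis by (simp add: mult.assoc)
  qed
  also have "\<dots> \<le> Gam t0 i j"
    using cheeger[OF ne assms(1,2)] by (intro Gam_lower[OF _ _ refl W_le ij]) auto
  finally show ?thesis .
qed

end

section \<open>Clusterings and their costs\<close>

definition dsum :: "('a \<Rightarrow> 'a \<Rightarrow> real) \<Rightarrow> 'a set \<Rightarrow> 'a set \<Rightarrow> real" where
  "dsum F A B = (\<Sum>a\<in>A. \<Sum>b\<in>B. F a b)"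

lemma dsum_empty [simp]: "dsum F {} B = 0" "dsum F A {} = 0"
  by (simp_all add: dsum_def)

lemma dsum_cong:
  "(\<And>a b. a \<in> A \<Longrightarrow> b \<in> B \<Longrightarrow> F a b = G a b) \<Longrightarrow> dsum F A B = dsum G A B"
  unfolding dsum_def by (intro sum.cong refl) auto

lemma dsum_mono:
  "(\<And>a b. a \<in> A \<Longrightarrow> b \<in> B \<Longrightarrow> F a b \<le> G a b) \<Longrightarrow> dsum F A B \<le> dsum G A B"
  unfolding dsum_def by (intro sum_mono) auto

lemma dsum_nonneg:
  "(\<And>a b. a \<in> A \<Longrightarrow> b \<in> B \<Longrightarrow> 0 \<le> F a b) \<Longrightarrow> 0 \<le> dsum F A B"
  unfolding dsum_def by (intro sum_nonneg) auto

lemma dsum_add: "dsum (\<lambda>a b. F a b + G a b) A B = dsum F A B + dsum G A B"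
  by (simp add: dsum_def sum.distrib)

lemma dsum_diff: "dsum (\<lambda>a b. F a b - G a b) A B = dsum F A B - dsum G A B"
  by (simp add: dsum_def sum_subtractf)

lemma dsum_cmult: "dsum (\<lambda>a b. c * F a b) A B = c * dsum F A B"
  by (simp add: dsum_def sum_distrib_left)

lemma dsum_commute:
  "(\<And>a b. a \<in> A \<Longrightarrow> b \<in> B \<Longrightarrow> F a b = F b a) \<Longrightarrow> dsum F A B = dsum F B A"
  unfolding dsum_def by (subst sum.swap, intro sum.cong refl) auto

lemma dsum_Un_left:
  "finite A \<Longrightarrow> finite A' \<Longrightarrow> A \<inter> A' = {} \<Longrightarrow> dsum F (A \<union> A') B = dsum F A B + dsum F A' B"
  by (simp add: dsum_def sum.union_disjoint)

lemma dsum_Un_right: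
  "finite B \<Longrightarrow> finite B' \<Longrightarrow> B \<inter> B' = {} \<Longrightarrow> dsum F A (B \<union> B') = dsum F A B + dsum F A B'"
  by (simp add: dsum_def sum.union_disjoint sum.distrib)

lemma dsum_mono_sets:
  assumes "finite A'" "finite B'" "A \<subseteq> A'" "B \<subseteq> B'" "\<And>a b. a \<in> A' \<Longrightarrow> b \<in> B' \<Longrightarrow> 0 \<le> F a b"
  shows "dsum F A B \<le> dsum F A' B'"
proof -
  have "dsum F A B \<le> (\<Sum>a\<in>A. \<Sum>b\<in>B'. F a b)"
    unfolding dsum_def using assms by (intro sum_mono sum_mono2) auto
  also have "\<dots> \<le> dsum F A' B'"
    unfolding dsum_def using assms by (intro sum_mono2 sum_nonneg) auto
  finally show ?thesis .
qed

lemma dsum_if_right: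
  "finite B \<Longrightarrow> dsum (\<lambda>a b. if Q b then F a b else 0) A B = dsum F A {b \<in> B. Q b}"
  by (simp add: dsum_def sum.inter_filter)

lemma dsum_split_sym:
  assumes "finite V" "X \<subseteq> V" and sym: "\<And>u v. u \<in> V \<Longrightarrow> v \<in> V \<Longrightarrow> F u v = F v u"
  shows "dsum F V V = dsum F X X + 2 * dsum F X (V - X) + dsum F (V - X) (V - X)"
proof -
  have V: "V = X \<union> (V - X)" using assms(2) by auto
  have fin: "finite X" "finite (V - X)" using assms finite_subset by auto
  have "dsum F V V = dsum F (X \<union> (V - X)) (X \<union> (V - X))" using V by simp
  also have "\<dots> = dsum F X X + dsum F X (V - X) + (dsum F (V - X) X + dsum F (V - X) (V - X))"
    using fin by (simp add: dsum_Un_left dsum_Un_right del: Un_Diff_cancel Un_Diff_cancel2)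
  also have "dsum F (V - X) X = dsum F X (V - X)"
    using assms(2) by (intro dsum_commute sym) auto
  finally show ?thesis by simp
qed

lemma dsum_Union_right:
  assumes "finite \<A>" "\<And>A. A \<in> \<A> \<Longrightarrow> finite A" "disjoint \<A>"
  shows "dsum F K (\<Union>\<A>) = (\<Sum>L\<in>\<A>. dsum F K L)"
proof -
  have "dsum F K (\<Union>\<A>) = (\<Sum>a\<in>K. \<Sum>L\<in>\<A>. \<Sum>b\<in>L. F a b)"
    unfolding dsum_def using assms
    by (intro sum.cong refl) (subst sum.Union_disjoint, auto simp: disjoint_def)
  then show ?thesis unfolding dsum_def by (subst sum.swap)
qed

lemma dsum_Union_left:
  assumes "finite \<A>" "\<And>A. A \<in> \<A> \<Longrightarrow> finite A" "disjoint \<A>"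
  shows "dsum F (\<Union>\<A>) L = (\<Sum>K\<in>\<A>. dsum F K L)"
  unfolding dsum_def using assms by (subst sum.Union_disjoint) (auto simp: disjoint_def)

section \<open>Instances, costs and the averaged triangle inequality\<close>

locale cc =
  fixes I :: "'a cc"
  assumes inst: "cc_instance I"
begin

abbreviation "V \<equiv> verts I"
abbreviation "w \<equiv> wt I"

definition wp :: "'a \<Rightarrow> 'a \<Rightarrow> real" where
  "wp u v = (if {u, v} \<in> pos_pairs I then w u v else 0)"

text \<open>As a difference, this vanishes on the diagonal and is the weight exactly on the negative
  pairs.\<close>

definition wn :: "'a \<Rightarrow> 'a \<Rightarrow> real" where
  "wn u v = w u v - wp u v"

lemma finV: "finite V" using inst by (simp add: cc_instance_def)
lemma w_sym: "u \<in> V \<Longrightarrow> v \<in> V \<Longrightarrow> w u v = w v u" using inst by (simp add: cc_instance_def)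
lemma w_nonneg: "u \<in> V \<Longrightarrow> v \<in> V \<Longrightarrow> 0 \<le> w u v" using inst by (simp add: cc_instance_def)
lemma w_self: "u \<in> V \<Longrightarrow> w u u = 0" using inst by (simp add: cc_instance_def)
lemma w_tri: "u \<in> V \<Longrightarrow> v \<in> V \<Longrightarrow> a \<in> V \<Longrightarrow> w u v \<le> w u a + w a v"
  using inst unfolding cc_instance_def by blast
lemma pairs: "pos_pairs I \<union> neg_pairs I = {{u, v} | u v. u \<in> V \<and> v \<in> V \<and> u \<noteq> v}"
  "pos_pairs I \<inter> neg_pairs I = {}"
  using inst by (simp_all add: cc_instance_def)

lemma wp_sym: "u \<in> V \<Longrightarrow> v \<in> V \<Longrightarrow> wp u v = wp v u"
  by (simp add: wp_def w_sym insert_commute)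
lemma wp_nonneg: "u \<in> V \<Longrightarrow> v \<in> V \<Longrightarrow> 0 \<le> wp u v" by (simp add: wp_def w_nonneg)
lemma wp_le: "u \<in> V \<Longrightarrow> v \<in> V \<Longrightarrow> wp u v \<le> w u v" by (simp add: wp_def w_nonneg)
lemma wn_sym: "u \<in> V \<Longrightarrow> v \<in> V \<Longrightarrow> wn u v = wn v u"
  by (simp add: wn_def wp_sym w_sym)
lemma wn_nonneg: "u \<in> V \<Longrightarrow> v \<in> V \<Longrightarrow> 0 \<le> wn u v" by (simp add: wn_def wp_le)
lemma wp_self: "u \<in> V \<Longrightarrow> wp u u = 0" by (simp add: wp_def w_self)
lemma wn_self: "u \<in> V \<Longrightarrow> wn u u = 0" by (simp add: wn_def wp_self w_self)

lemma wt_sets_eq: "wt_sets I = dsum w" by (intro ext) (simp add: wt_sets_def dsum_def)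
lemma wt_pos_eq: "wt_pos I = dsum wp" by (intro ext) (simp add: wt_pos_def dsum_def wp_def)

lemma dsum_w_split: "dsum w A B = dsum wp A B + dsum wn A B"
  by (simp add: dsum_add[symmetric] wn_def)

lemma dw_sym: "A \<subseteq> V \<Longrightarrow> B \<subseteq> V \<Longrightarrow> dsum w A B = dsum w B A"
  by (intro dsum_commute w_sym) auto
lemma dw_nonneg: "A \<subseteq> V \<Longrightarrow> B \<subseteq> V \<Longrightarrow> 0 \<le> dsum w A B"
  by (intro dsum_nonneg w_nonneg) auto
lemma dwp_nonneg: "A \<subseteq> V \<Longrightarrow> B \<subseteq> V \<Longrightarrow> 0 \<le> dsum wp A B"
  by (intro dsum_nonneg wp_nonneg) auto
lemma dwn_nonneg: "A \<subseteq> V \<Longrightarrow> B \<subseteq> V \<Longrightarrow> 0 \<le> dsum wn A B"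
  by (intro dsum_nonneg wn_nonneg) auto
lemma dw_mono: "A' \<subseteq> V \<Longrightarrow> B' \<subseteq> V \<Longrightarrow> A \<subseteq> A' \<Longrightarrow> B \<subseteq> B' \<Longrightarrow> dsum w A B \<le> dsum w A' B'"
  by (intro dsum_mono_sets w_nonneg) (auto intro: finite_subset[OF _ finV])
lemma dwp_mono: "A' \<subseteq> V \<Longrightarrow> B' \<subseteq> V \<Longrightarrow> A \<subseteq> A' \<Longrightarrow> B \<subseteq> B' \<Longrightarrow> dsum wp A B \<le> dsum wp A' B'"
  by (intro dsum_mono_sets wp_nonneg) (auto intro: finite_subset[OF _ finV])
lemma dwn_mono: "A' \<subseteq> V \<Longrightarrow> B' \<subseteq> V \<Longrightarrow> A \<subseteq> A' \<Longrightarrow> B \<subseteq> B' \<Longrightarrow> dsum wn A B \<le> dsum wn A' B'"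
  by (intro dsum_mono_sets wn_nonneg) (auto intro: finite_subset[OF _ finV])

text \<open>The triangle inequality through \<open>x\<close>, summed over all \<open>x\<close> in
  \<open>X\<close>. All later uses of the triangle inequality go through this averaged form, which
  is why cardinalities of sets keep appearing.\<close>

lemma tri_sets:
  assumes "A \<subseteq> V" "B \<subseteq> V" "X \<subseteq> V"
  shows "real (card X) * dsum w A B \<le> real (card B) * dsum w A X + real (card A) * dsum w X B"
proof -
  have "real (card X) * dsum w A B = (\<Sum>x\<in>X. dsum w A B)" by simp
  also have "\<dots> \<le> (\<Sum>x\<in>X. dsum (\<lambda>a b. w a x + w x b) A B)"
    using assms by (intro sum_mono dsum_mono w_tri) auto
  also have "\<dots> = (\<Sum>x\<in>X. \<Sum>a\<in>A. real (card B) * w a x) + (\<Sum>x\<in>X. real (card A) * (\<Sum>b\<in>B. w x b))"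
    by (simp add: dsum_def sum.distrib)
  also have "(\<Sum>x\<in>X. \<Sum>a\<in>A. real (card B) * w a x) = real (card B) * dsum w A X"
    unfolding dsum_def sum_distrib_left by (rule sum.swap)
  also have "(\<Sum>x\<in>X. real (card A) * (\<Sum>b\<in>B. w x b)) = real (card A) * dsum w X B"
    unfolding dsum_def sum_distrib_left ..
  finally show ?thesis .
qed

text \<open>If \<open>A\<close> has no more elements than \<open>X\<close>, the weight inside
  \<open>A\<close> is at most twice the weight from \<open>A\<close> to \<open>X\<close>. Read with
  the weights known, it bounds cardinalities instead.\<close>

lemma tri_diag:
  assumes "A \<subseteq> V" "X \<subseteq> V"
  shows "real (card X) * dsum w A A \<le> 2 * real (card A) * dsum w A X"
  using tri_sets[OF assms(1,1,2)] dw_sym[OF assms] by simp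

lemma finite_part: "finite {\<C>. partition_on V \<C>}"
  by (rule finite_subset[of _ "Pow (Pow V)"]) (auto simp: partition_on_def finV)

lemma wt_pairs_ordered:
  assumes F: "F \<subseteq> pos_pairs I \<union> neg_pairs I"
  shows "2 * wt_pairs I F = dsum (\<lambda>u v. if {u, v} \<in> F then w u v else 0) V V"
proof -
  define X where "X = {p \<in> V \<times> V. {fst p, snd p} \<in> F}"
  have finX: "finite X" unfolding X_def using finV by simp
  have finF: "finite F" using F pairs finV by (auto intro!: finite_subset[of F "Pow V"])
  have "(\<Sum>e\<in>F. 2 * pair_wt I e) = (\<Sum>e\<in>F. \<Sum>p\<in>{p \<in> X. {fst p, snd p} = e}. w (fst p) (snd p))"
  proof (intro sum.cong refl)
    fix e assume "e \<in> F"
    then obtain a b where e: "e = {a, b}" "a \<in> V" "b \<in> V" "a \<noteq> b" using F pairs by auto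
    then have "{p \<in> X. {fst p, snd p} = e} = {(a, b), (b, a)}"
      using \<open>e \<in> F\<close> by (auto simp: X_def doubleton_eq_iff insert_commute)
    moreover have "pair_wt I e = w a b" using e pair_wt_eq[OF inst] by simp
    ultimately show "2 * pair_wt I e = (\<Sum>p\<in>{p \<in> X. {fst p, snd p} = e}. w (fst p) (snd p))"
      using e w_sym[of a b] by simp
  qed
  also have "\<dots> = (\<Sum>p\<in>X. w (fst p) (snd p))"
    by (rule sum.group[OF finX finF]) (auto simp: X_def)
  also have "\<dots> = (\<Sum>p\<in>V \<times> V. if {fst p, snd p} \<in> F then w (fst p) (snd p) else 0)"
    unfolding X_def using finV by (intro sum.inter_filter) simp
  also have "\<dots> = dsum (\<lambda>u v. if {u, v} \<in> F then w u v else 0) V V"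
    by (simp add: dsum_def sum.cartesian_product case_prod_beta)
  finally show ?thesis by (simp add: wt_pairs_def sum_distrib_left)
qed

lemma obj_ordered:
  "2 * obj I \<C> = dsum (\<lambda>u v. if same_part \<C> {u, v} then wn u v else wp u v) V V"
proof -
  have "2 * obj I \<C> = dsum (\<lambda>u v. (if {u, v} \<in> {e \<in> pos_pairs I. \<not> same_part \<C> e} then w u v else 0) +
       (if {u, v} \<in> {e \<in> neg_pairs I. same_part \<C> e} then w u v else 0)) V V"
    unfolding obj_def distrib_left dsum_add by (intro arg_cong2[of _ _ _ _ "(+)"] wt_pairs_ordered) auto
  also have "\<dots> = dsum (\<lambda>u v. if same_part \<C> {u, v} then wn u v else wp u v) V V"
  proof (rule dsum_cong)
    fix u v assume uv: "u \<in> V" "v \<in> V"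
    show "(if {u, v} \<in> {e \<in> pos_pairs I. \<not> same_part \<C> e} then w u v else 0) +
       (if {u, v} \<in> {e \<in> neg_pairs I. same_part \<C> e} then w u v else 0) =
       (if same_part \<C> {u, v} then wn u v else wp u v)"
    proof (cases "u = v")
      case True
      with uv show ?thesis by (simp add: wn_self wp_self w_self)
    next
      case False
      with uv have "{u, v} \<in> pos_pairs I \<union> neg_pairs I" unfolding pairs by blast
      with pairs(2) show ?thesis by (auto simp: wn_def wp_def)
    qed
  qed
  finally show ?thesis .
qed

lemma obj_nonneg: "0 \<le> obj I \<C>"
proof -
  have "0 \<le> 2 * obj I \<C>" unfolding obj_ordered
    by (intro dsum_nonneg) (auto simp: wn_nonneg wp_nonneg)
  then show ?thesis by simp
qed

lemma OPT_le: "partition_on V \<C> \<Longrightarrow> OPT I \<le> obj I \<C>"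
  unfolding OPT_def using finite_part by (intro Min_le) auto

lemma OPT_attained: "\<exists>\<C>. partition_on V \<C> \<and> obj I \<C> = OPT I"
proof -
  have "\<exists>\<C>. partition_on V \<C>"
    using finite_part by (cases "V = {}") (auto intro: partition_on_space simp: partition_on_empty)
  then have "OPT I \<in> obj I ` {\<C>. partition_on V \<C>}"
    unfolding OPT_def using finite_part by (intro Min_in) auto
  then show ?thesis by auto
qed

lemma OPT_nonneg: "0 \<le> OPT I"
  using OPT_attained obj_nonneg by metis

text \<open>Clusterings are handled as labellings: moving vertices is a function update and cannot
  create empty or overlapping parts.\<close>

definition part :: "('a \<Rightarrow> nat) \<Rightarrow> 'a set set" where
  "part c = (\<lambda>u. {v \<in> V. c v = c u}) ` V"

definition cost :: "('a \<Rightarrow> nat) \<Rightarrow> real" where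
  "cost c = dsum (\<lambda>u v. if c u = c v then wn u v else wp u v) V V"

lemma partition_part: "partition_on V (part c)"
  by (rule partition_onI) (auto simp: part_def disjnt_def)

lemma same_part_part: "u \<in> V \<Longrightarrow> v \<in> V \<Longrightarrow> same_part (part c) {u, v} \<longleftrightarrow> c u = c v"
  by (auto simp: same_part_def part_def)

lemma obj_part: "2 * obj I (part c) = cost c"
  unfolding obj_ordered cost_def by (intro dsum_cong) (simp add: same_part_part)

lemma ex_label:
  assumes "partition_on V \<C>"
  shows "\<exists>c. part c = \<C>"
proof -
  have "finite \<C>" using assms finV finite_elements by blast
  then obtain g :: "'a set \<Rightarrow> nat" where g: "inj_on g \<C>"
    using finite_imp_inj_to_nat_seg by blast
  define c where "c u = g (THE C. C \<in> \<C> \<and> u \<in> C)" for u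
  have c: "c u = g C" if "C \<in> \<C>" "u \<in> C" for u C
  proof -
    have "(THE C. C \<in> \<C> \<and> u \<in> C) = C"
      using assms that by (intro the_equality) (auto simp: partition_on_def disjoint_def)
    then show ?thesis by (simp add: c_def)
  qed
  have cls: "{v \<in> V. c v = c u} = C" if C: "C \<in> \<C>" "u \<in> C" for u C
  proof
    show "C \<subseteq> {v \<in> V. c v = c u}" using C c assms by (auto simp: partition_on_def)
    show "{v \<in> V. c v = c u} \<subseteq> C"
    proof
      fix v assume v: "v \<in> {v \<in> V. c v = c u}"
      then obtain C' where C': "C' \<in> \<C>" "v \<in> C'" using assms by (auto simp: partition_on_def)
      then have "g C' = g C" using v C c by auto
      then have "C' = C" using g C C' by (auto dest: inj_onD)
      with C' show "v \<in> C" by simp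
    qed
  qed
  have "part c = \<C>"
  proof (intro set_eqI iffI)
    fix C assume "C \<in> part c"
    then obtain u where u: "u \<in> V" "C = {v \<in> V. c v = c u}" by (auto simp: part_def)
    then obtain C' where "C' \<in> \<C>" "u \<in> C'" using assms by (auto simp: partition_on_def)
    then show "C \<in> \<C>" using cls u by simp
  next
    fix C assume C: "C \<in> \<C>"
    have "C \<noteq> {}" "C \<subseteq> V" using C assms by (auto simp: partition_on_def)
    then obtain u where "u \<in> C" "u \<in> V" by blast
    then show "C \<in> part c" using cls[OF C] by (force simp: part_def)
  qed
  then show ?thesis by blast
qed

text \<open>Pairs outside \<open>X\<close> keep their status. A pair inside \<open>X\<close> becomes
  joined, so it changes only if \<open>c\<close> separated it; pairs leaving \<open>X\<close> occur
  in both orders.\<close>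

lemma recolor_cost:
  assumes X: "X \<subseteq> V"
  shows "cost (\<lambda>u. if u \<in> X then l else c u) = cost c
     + dsum (\<lambda>u v. if c u = c v then 0 else wn u v - wp u v) X X
     + 2 * dsum (\<lambda>u v. (if c v = l then wn u v else wp u v) - (if c u = c v then wn u v else wp u v)) X (V - X)"
proof -
  define c' where "c' = (\<lambda>u. if u \<in> X then l else c u)"
  let ?F = "\<lambda>u v. (if c' u = c' v then wn u v else wp u v) - (if c u = c v then wn u v else wp u v)"
  have "cost c' - cost c = dsum ?F V V" by (simp add: cost_def dsum_diff)
  also have "\<dots> = dsum ?F X X + 2 * dsum ?F X (V - X) + dsum ?F (V - X) (V - X)"
    using finV X by (intro dsum_split_sym) (auto simp: wn_sym wp_sym)
  also have "dsum ?F (V - X) (V - X) = 0"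
    unfolding dsum_def by (intro sum.neutral ballI) (auto simp: c'_def)
  also have "dsum ?F X X = dsum (\<lambda>u v. if c u = c v then 0 else wn u v - wp u v) X X"
    by (intro dsum_cong) (auto simp: c'_def)
  also have "dsum ?F X (V - X) = dsum (\<lambda>u v. (if c v = l then wn u v else wp u v) - (if c u = c v then wn u v else wp u v)) X (V - X)"
    by (intro dsum_cong) (auto simp: c'_def)
  finally show ?thesis by (simp add: c'_def)
qed

end

section \<open>An optimal clustering that respects the atoms\<close>

locale cc_atoms = cc I for I :: "'a cc" +
  fixes \<beta> :: real and \<C>\<^sub>0 :: "'a set set"
  assumes beta_pos: "0 < \<beta>" and beta_le: "\<beta> \<le> 1 / 20" and C0_part: "partition_on V \<C>\<^sub>0"
begin

abbreviation "\<K> \<equiv> atoms \<beta> I \<C>\<^sub>0"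

text \<open>Both cases of the definition have the shape treated in \<open>p\<close>, one with
  \<open>M = C\<close>, where no remainder is left, the other with the marked vertices.\<close>

lemma partition_cluster_atoms: "C \<noteq> {} \<Longrightarrow> partition_on C (cluster_atoms \<beta> I C)"
proof -
  assume "C \<noteq> {}"
  have p: "partition_on C ((\<lambda>u. {u}) ` M \<union> ({C - M} - {{}}))" if "M \<subseteq> C" for M
  proof (rule partition_onI)
    have "\<Union> ((\<lambda>u. {u}) ` M \<union> ({C - M} - {{}})) = M \<union> (C - M)"
      by (cases "C - M = {}") auto
    then show "\<Union> ((\<lambda>u. {u}) ` M \<union> ({C - M} - {{}})) = C" using that by blast
    show "disjnt p q" if "p \<in> (\<lambda>u. {u}) ` M \<union> ({C - M} - {{}})"
      "q \<in> (\<lambda>u. {u}) ` M \<union> ({C - M} - {{}})" "p \<noteq> q" for p q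
      using that unfolding disjnt_def by (elim UnE imageE DiffE singletonE) auto
  qed auto
  have "marked \<beta> I C \<subseteq> C" by (auto simp: marked_def)
  from p[OF subset_refl] p[OF this] show ?thesis
    by (simp add: cluster_atoms_def Setcompr_eq_image)
qed

lemma partition_atoms: "partition_on V \<K>"
proof (rule partition_onI)
  have ne: "C \<noteq> {}" if "C \<in> \<C>\<^sub>0" for C using C0_part that by (auto simp: partition_on_def)
  have ca: "partition_on C (cluster_atoms \<beta> I C)" if "C \<in> \<C>\<^sub>0" for C
    using partition_cluster_atoms ne[OF that] by blast
  have "\<Union>(cluster_atoms \<beta> I C) = C" "{} \<notin> cluster_atoms \<beta> I C" if "C \<in> \<C>\<^sub>0" for C
    using ca[OF that] by (auto simp: partition_on_def)
  note ca' = this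
  have "\<Union>\<K> = (\<Union>C\<in>\<C>\<^sub>0. \<Union>(cluster_atoms \<beta> I C))" by (auto simp: atoms_def)
  also have "\<dots> = \<Union>\<C>\<^sub>0" using ca'(1) by simp
  finally show "\<Union>\<K> = V" using C0_part by (simp add: partition_on_def)
  show "{} \<notin> \<K>"
    using ca'(2) by (auto simp: atoms_def)
  fix p q assume pq: "p \<in> \<K>" "q \<in> \<K>" "p \<noteq> q"
  then obtain C D where CD: "C \<in> \<C>\<^sub>0" "p \<in> cluster_atoms \<beta> I C" "D \<in> \<C>\<^sub>0" "q \<in> cluster_atoms \<beta> I D"
    unfolding atoms_def by blast
  show "disjnt p q"
  proof (cases "C = D")
    case True
    with CD pq ca[of C] show ?thesis by (auto simp: partition_on_def disjoint_def disjnt_def)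
  next
    case False
    then have "C \<inter> D = {}" using CD C0_part by (auto simp: partition_on_def disjoint_def)
    moreover have "p \<subseteq> C" "q \<subseteq> D" using CD ca by (auto simp: partition_on_def)
    ultimately show ?thesis by (auto simp: disjnt_def)
  qed
qed

lemma atom_subset: "K \<in> \<K> \<Longrightarrow> K \<subseteq> V" using partition_atoms by (auto simp: partition_on_def)
lemma atom_nonempty: "K \<in> \<K> \<Longrightarrow> K \<noteq> {}" using partition_atoms by (auto simp: partition_on_def)
lemma atom_disjoint: "K \<in> \<K> \<Longrightarrow> L \<in> \<K> \<Longrightarrow> K \<noteq> L \<Longrightarrow> K \<inter> L = {}"
  using partition_atoms by (auto simp: partition_on_def disjoint_def)
lemma disjoint_atoms: "disjoint \<K>" using partition_atoms by (auto simp: partition_on_def)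
lemma Union_atoms: "\<Union>\<K> = V" using partition_atoms by (auto simp: partition_on_def)
lemma finite_atoms: "finite \<K>" using partition_atoms finV finite_elements by blast
lemma finite_atom: "K \<in> \<K> \<Longrightarrow> finite K" using atom_subset finV finite_subset by blast

text \<open>Inside \<open>C\<close> the symmetric difference selects the vertices not joined
  positively to \<open>u\<close>, outside \<open>C\<close> the positive ones: the deviation is what
  \<open>u\<close> pays in the cluster \<open>C\<close>.\<close>

lemma deviation_eq:
  assumes "C \<subseteq> V" "u \<in> C"
  shows "deviation I C u = (\<Sum>v\<in>C. wn u v) + (\<Sum>v\<in>V - C. wp u v)"
proof -
  let ?N = "pos_nbrs I u"
  have finC: "finite C" using assms finV finite_subset by blast
  have u: "u \<in> V" using assms by auto
  have finN: "finite ?N" using finV by (simp add: pos_nbrs_def)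
  have N: "v \<in> ?N \<longleftrightarrow> {u, v} \<in> pos_pairs I" if "v \<in> V" for v
  proof -
    have "{u, u} \<notin> pos_pairs I"
    proof
      assume "{u, u} \<in> pos_pairs I"
      then have "{u} \<in> {{u, v} | u v. u \<in> V \<and> v \<in> V \<and> u \<noteq> v}" using pairs(1) by auto
      then show False by (auto simp: singleton_insert_inj_eq)
    qed
    with that show ?thesis by (auto simp: pos_nbrs_def)
  qed
  have "deviation I C u = (\<Sum>v\<in>(?N - C) \<union> (C - ?N). w u v)"
    by (simp add: deviation_def wt_sets_eq dsum_def)
  also have "\<dots> = (\<Sum>v\<in>?N - C. w u v) + (\<Sum>v\<in>C - ?N. w u v)"
    using finN finC by (intro sum.union_disjoint) auto
  also have "(\<Sum>v\<in>?N - C. w u v) = (\<Sum>v\<in>V - C. wp u v)"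
    using finV N by (intro sum.mono_neutral_cong_left) (auto simp: wp_def pos_nbrs_def)
  also have "(\<Sum>v\<in>C - ?N. w u v) = (\<Sum>v\<in>C. wn u v)"
    using finC N assms by (intro sum.mono_neutral_cong_left) (auto simp: wn_def wp_def)
  finally show ?thesis by simp
qed

text \<open>A non-singleton atom is \<open>K = C - M\<close> with \<open>M\<close> the marked
  vertices. Marking and the test in the definition give \<beta>/2 w(M, C) \<le> \<beta>^2/20 w(C,
  C), hence the factor \<beta>/10 \<le> 1/200; unmarked vertices give \<beta>/2 \<le> 1/40. Then
  100/99 comes from w(C, C) \<le> w(K, K) + 2 w(M, C), and 3/100 is 1/200 + 1/40.\<close>

lemma big_atom:
  assumes K: "K \<in> \<K>" and nonsingle: "\<not> (\<exists>u. K = {u})"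
  shows "\<exists>C. K \<subseteq> C \<and> C \<subseteq> V \<and> dsum w (C - K) C \<le> dsum w C C / 200 \<and>
    (\<forall>S\<subseteq>K. dsum wn S C + dsum wp S (V - C) \<le> dsum w S C / 40) \<and>
    dsum w C C \<le> 100 / 99 * dsum w K K \<and> dsum wp K (V - K) \<le> 3 / 100 * dsum w C C"
proof -
  obtain C where C: "C \<in> \<C>\<^sub>0" "K \<in> cluster_atoms \<beta> I C" using K unfolding atoms_def by blast
  have CV: "C \<subseteq> V" using C C0_part by (auto simp: partition_on_def)
  have finC: "finite C" using CV finV finite_subset by blast
  let ?M = "marked \<beta> I C" and ?Z = "dsum w C C"
  have small: "(\<Sum>u\<in>?M. deviation I C u) \<le> \<beta>\<^sup>2 / 20 * ?Z" and KM: "K = C - ?M"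
    using C(2) nonsingle by (auto simp: cluster_atoms_def wt_sets_eq not_less split: if_splits)
  have MC: "?M \<subseteq> C" by (auto simp: marked_def)
  have Meq: "C - K = ?M" using KM MC by auto
  have KC: "K \<subseteq> C" using KM by auto
  have finM: "finite ?M" using MC finC finite_subset by blast
  have Z0: "0 \<le> ?Z" using CV by (intro dw_nonneg)
  have row: "wt_sets I {u} C = (\<Sum>v\<in>C. w u v)" for u by (simp add: wt_sets_eq dsum_def)
  have "\<beta> / 2 * dsum w ?M C = (\<Sum>u\<in>?M. \<beta> / 2 * wt_sets I {u} C)"
    by (simp add: row dsum_def sum_distrib_left)
  also have "\<dots> \<le> (\<Sum>u\<in>?M. deviation I C u)"
    by (intro sum_mono) (simp add: marked_def)
  finally have "\<beta> * (dsum w ?M C / 2) \<le> \<beta> * (\<beta> / 20 * ?Z)"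
    using small by (simp add: power2_eq_square)
  then have "dsum w ?M C / 2 \<le> \<beta> / 20 * ?Z" using beta_pos by simp
  also have "\<dots> \<le> (1 / 20) / 20 * ?Z"
    using beta_le Z0 by (intro mult_right_mono divide_right_mono) auto
  finally have 1: "dsum w (C - K) C \<le> ?Z / 200" unfolding Meq by simp
  have 2: "dsum wn S C + dsum wp S (V - C) \<le> dsum w S C / 40" if S: "S \<subseteq> K" for S
  proof -
    have "dsum wn S C + dsum wp S (V - C) = (\<Sum>u\<in>S. deviation I C u)"
      using S KC CV unfolding dsum_def sum.distrib[symmetric]
      by (intro sum.cong refl) (subst deviation_eq, auto)
    also have "\<dots> \<le> (\<Sum>u\<in>S. (\<Sum>v\<in>C. w u v) / 40)"
    proof (intro sum_mono)
      fix u assume "u \<in> S"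
      then have u: "u \<in> C" "u \<notin> ?M" using S KM by auto
      then have "deviation I C u \<le> \<beta> / 2 * (\<Sum>v\<in>C. w u v)" by (simp add: marked_def row)
      also have "\<dots> \<le> (1 / 20) / 2 * (\<Sum>v\<in>C. w u v)"
        using beta_le u CV by (intro mult_right_mono divide_right_mono sum_nonneg w_nonneg) auto
      finally show "deviation I C u \<le> (\<Sum>v\<in>C. w u v) / 40" by simp
    qed
    also have "\<dots> = dsum w S C / 40" by (simp add: dsum_def sum_divide_distrib)
    finally show ?thesis .
  qed
  have "?Z = dsum w K K + 2 * dsum w K (C - K) + dsum w (C - K) (C - K)"
    using finC KC CV w_sym by (intro dsum_split_sym) blast+
  moreover have "dsum w (C - K) C = dsum w (C - K) K + dsum w (C - K) (C - K)"
    using dsum_Un_right[of K "C - K" w "C - K"] finC KC finite_subset by (auto simp: Un_absorb1)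
  moreover have "dsum w (C - K) K = dsum w K (C - K)" using KC CV by (intro dw_sym) auto
  moreover have "0 \<le> dsum w (C - K) (C - K)" using CV by (intro dw_nonneg) auto
  ultimately have 3: "?Z \<le> 100 / 99 * dsum w K K" using 1 by simp
  have "V - K = (C - K) \<union> (V - C)" using KC CV by auto
  then have "dsum wp K (V - K) = dsum wp K (C - K) + dsum wp K (V - C)"
    using finC finV by (subst dsum_Un_right[symmetric]) auto
  also have "dsum wp K (C - K) \<le> dsum w K (C - K)"
    using KC CV by (intro dsum_mono wp_le) auto
  also have "dsum w K (C - K) \<le> dsum w (C - K) C"
    using KC CV dw_sym[of K "C - K"] dw_mono[of "C - K" C "C - K" K] by fastforce
  also have "dsum wp K (V - C) \<le> dsum w K C / 40"
    using 2[of K] dwn_nonneg[of K C] KC CV by fastforce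
  also have "dsum w K C \<le> ?Z" using KC CV by (intro dw_mono) auto
  finally have "dsum wp K (V - K) \<le> 3 / 100 * ?Z" using 1 by simp
  with KC CV 1 2 3 show ?thesis by blast
qed

text \<open>If every class had at most half of \<open>K\<close>, the triangle inequality would bound
  the weight inside each class by twice the weight leaving it; summed over the classes,
  \<open>dsum w K K - b\<close> would be at most \<open>2 * b\<close>.\<close>

lemma ex_big_class:
  assumes K: "K \<subseteq> V" "K \<noteq> {}" and b: "b = dsum (\<lambda>u v. if c u = c v then 0 else w u v) K K"
    and small: "3 * b < dsum w K K"
  shows "\<exists>u0\<in>K. card K < 2 * card {u \<in> K. c u = c u0}"
proof (rule ccontr)
  assume "\<not> ?thesis"
  then have half: "2 * card {u \<in> K. c u = c u0} \<le> card K" if "u0 \<in> K" for u0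
    using that by (auto simp: not_less)
  have finK: "finite K" using K finV finite_subset by blast
  let ?cl = "\<lambda>l. {u \<in> K. c u = l}"
  have group: "dsum F K K = (\<Sum>l\<in>c ` K. dsum F (?cl l) K)" for F
    unfolding dsum_def by (rule sum.image_gen[OF finK])
  have "dsum w K K - b = dsum (\<lambda>u v. if c u = c v then w u v else 0) K K"
    unfolding b dsum_diff[symmetric] by (intro dsum_cong) auto
  also have "\<dots> = (\<Sum>l\<in>c ` K. dsum w (?cl l) (?cl l))"
    unfolding group
  proof (intro sum.cong refl)
    fix l
    have "dsum (\<lambda>u v. if c u = c v then w u v else 0) (?cl l) K
        = dsum (\<lambda>u v. if c v = l then w u v else 0) (?cl l) K"
      by (intro dsum_cong) auto
    then show "dsum (\<lambda>u v. if c u = c v then w u v else 0) (?cl l) K = dsum w (?cl l) (?cl l)"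
      using finK by (simp add: dsum_if_right)
  qed
  also have "\<dots> \<le> (\<Sum>l\<in>c ` K. 2 * dsum w (?cl l) (K - ?cl l))"
  proof (intro sum_mono)
    fix l assume "l \<in> c ` K"
    then obtain u0 where u0: "u0 \<in> K" "l = c u0" by auto
    let ?A = "?cl l"
    have A: "?A \<subseteq> K" "finite ?A" using finK by auto
    have cA: "0 < card ?A" using u0 A(2) by (auto simp: card_gt_0_iff)
    have "card ?A \<le> card (K - ?A)" using half[OF u0(1)] A u0 by (simp add: card_Diff_subset)
    moreover have AV: "?A \<subseteq> V" "K - ?A \<subseteq> V" using K by auto
    ultimately have "real (card ?A) * dsum w ?A ?A \<le> real (card (K - ?A)) * dsum w ?A ?A"
      by (intro mult_right_mono dw_nonneg) auto
    also have "\<dots> \<le> real (card ?A) * (2 * dsum w ?A (K - ?A))"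
      using tri_diag[OF AV] by simp
    finally show "dsum w ?A ?A \<le> 2 * dsum w ?A (K - ?A)" using cA by simp
  qed
  also have "\<dots> = 2 * b"
  proof -
    have "b = (\<Sum>l\<in>c ` K. dsum w (?cl l) (K - ?cl l))"
      unfolding b group
    proof (intro sum.cong refl)
      fix l
      have "dsum (\<lambda>u v. if c u = c v then 0 else w u v) (?cl l) K
          = dsum (\<lambda>u v. if c v \<noteq> l then w u v else 0) (?cl l) K"
        by (intro dsum_cong) auto
      also have "\<dots> = dsum w (?cl l) {v \<in> K. c v \<noteq> l}" using finK by (rule dsum_if_right)
      also have "{v \<in> K. c v \<noteq> l} = K - ?cl l" by auto
      finally show "dsum (\<lambda>u v. if c u = c v then 0 else w u v) (?cl l) K = dsum w (?cl l) (K - ?cl l)" .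
    qed
    then show ?thesis by (simp add: sum_distrib_left)
  qed
  finally show False using small by simp
qed

text \<open>If \<open>c\<close> splits much weight inside \<open>K\<close>, then making \<open>K\<close> a cluster of its own does not cost
  more, as almost all pairs inside \<open>K\<close> are positive and few positive pairs leave \<open>K\<close>. Otherwise
  one cluster contains a large part \<open>K1\<close> of \<open>K\<close>, and the rest \<open>S\<close> can be moved there: by the
  triangle inequality its distance to the other vertices of that cluster is dominated by \<open>w(S, K1)\<close>.\<close>

lemma repair_atom:
  assumes K: "K \<in> \<K>" and opt: "\<And>c'. cost c \<le> cost c'"
  shows "\<exists>c'. cost c' \<le> cost c \<and> (\<forall>u\<in>K. \<forall>v\<in>K. c' u = c' v) \<and>
     (\<forall>u\<in>V - K. \<forall>v\<in>V - K. c u = c v \<longrightarrow> c' u = c' v)"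
proof (cases "\<exists>u. K = {u}")
  case True
  then show ?thesis by (intro exI[of _ c]) auto
next
  case False
  obtain C where C: "K \<subseteq> C" "C \<subseteq> V"
    and C1: "dsum w (C - K) C \<le> dsum w C C / 200"
    and C2: "\<And>S. S \<subseteq> K \<Longrightarrow> dsum wn S C + dsum wp S (V - C) \<le> dsum w S C / 40"
    and C3: "dsum w C C \<le> 100 / 99 * dsum w K K"
    and C4: "dsum wp K (V - K) \<le> 3 / 100 * dsum w C C"
    using big_atom[OF K False] by blast
  have KV: "K \<subseteq> V" using C by auto
  have fin: "finite K" "finite C"
    using finite_subset[OF KV finV] finite_subset[OF C(2) finV] by simp_all
  define Y where "Y = dsum w K K"
  define Z where "Z = dsum w C C"
  define h where "h = (\<lambda>u v. if c u = c v then 0 else w u v)"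
  define b where "b = dsum h K K"
  have ZY: "Z \<le> 100 / 99 * Y" using C3 by (simp add: Z_def Y_def)
  have hK: "0 \<le> b" unfolding b_def h_def using KV by (intro dsum_nonneg) (auto intro: w_nonneg)
  have Z0: "0 \<le> Z" unfolding Z_def using C by (intro dw_nonneg)
  obtain l where l: "l \<notin> c ` V" using ex_new_if_finite[OF infinite_UNIV_nat finite_imageI[OF finV]] by blast
  show ?thesis
  \<comment> \<open>Isolating \<open>K\<close> saves \<open>b\<close> and otherwise costs at most 2
    Z/40 + 2 (3 Z/100) = 11 Z/100 \<le> Y/9, which fixes the threshold.\<close>
  proof (cases "Y / 9 \<le> b")
    case True
    let ?c' = "\<lambda>u. if u \<in> K then l else c u"
    have "dsum (\<lambda>u v. if c u = c v then 0 else wn u v - wp u v) K K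
        \<le> dsum (\<lambda>u v. 2 * wn u v - h u v) K K"
      using KV by (intro dsum_mono) (auto simp: h_def wn_def wp_le subset_iff)
    also have "\<dots> = 2 * dsum wn K K - b" by (simp add: dsum_diff dsum_cmult b_def)
    finally have 1: "dsum (\<lambda>u v. if c u = c v then 0 else wn u v - wp u v) K K \<le> 2 * dsum wn K K - b" .
    have 2: "dsum (\<lambda>u v. (if c v = l then wn u v else wp u v) - (if c u = c v then wn u v else wp u v)) K (V - K)
        \<le> dsum wp K (V - K)"
      using l KV by (intro dsum_mono) (auto simp: wn_nonneg wp_nonneg subset_iff)
    have "dsum wn K K \<le> dsum wn K C" using C by (intro dwn_mono) auto
    also have "\<dots> \<le> dsum w K C / 40" using C2[of K] dwp_nonneg[of K "V - C"] KV by auto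
    also have "dsum w K C \<le> Z" unfolding Z_def using C by (intro dw_mono) auto
    finally have "dsum wn K K \<le> Z / 40" by simp
    then have "cost ?c' \<le> cost c"
      using recolor_cost[OF KV, of l c] 1 2 C4 ZY Z0 True unfolding Z_def[symmetric] by simp
    then show ?thesis by (intro exI[of _ ?c']) auto
  next
    case False
    then have bY: "b < Y / 9" by simp
    then have Ypos: "0 < Y" using hK by simp
    have "3 * b < dsum w K K" using bY Ypos unfolding Y_def[symmetric] by simp
    then obtain u0 where u0: "u0 \<in> K" "card K < 2 * card {u \<in> K. c u = c u0}"
      using ex_big_class[OF KV atom_nonempty[OF K], of b c] by (auto simp: b_def h_def)
    \<comment> \<open>\<open>K1\<close> is the majority class, \<open>S\<close> will be moved to it,
      \<open>D\<close> is the rest of its cluster outside \<open>K\<close>, and \<open>M\<close> is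
      what \<open>K\<close> lacks of \<open>C\<close>. The weight \<open>s\<close> between
      \<open>S\<close> and \<open>K1\<close> is the gain of the move; everything else must be small
      compared with it.\<close>
    define K1 where "K1 = {u \<in> K. c u = c u0}"
    define S where "S = K - K1"
    define D where "D = {v \<in> V - K. c v = c u0}"
    define M where "M = C - K"
    define s where "s = dsum w S K1"
    define k1 where "k1 = real (card K1)"
    have sub: "K1 \<subseteq> V" "S \<subseteq> V" "D \<subseteq> V" "M \<subseteq> V" "K1 \<subseteq> K" "S \<subseteq> K"
      using KV C by (auto simp: K1_def S_def D_def M_def)
    have KS: "K - S = K1" by (auto simp: S_def K1_def)
    have k1: "0 < k1" using u0 by (auto simp: k1_def K1_def)
    have "card S = card K - card K1"
      unfolding S_def using sub fin by (intro card_Diff_subset) (auto intro: finite_subset)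
    then have Sk1: "real (card S) \<le> k1" using u0 by (simp add: k1_def K1_def)
    have s0: "0 \<le> s" unfolding s_def using sub by (intro dw_nonneg)
    have "2 * s \<le> b"
    proof -
      have "b = dsum h S S + 2 * dsum h S (K - S) + dsum h (K - S) (K - S)"
        unfolding b_def using fin sub KV by (intro dsum_split_sym) (auto simp: h_def w_sym subset_iff)
      moreover have "0 \<le> dsum h S S" "0 \<le> dsum h (K - S) (K - S)"
        using KV sub by (auto simp: h_def subset_iff intro!: dsum_nonneg w_nonneg)
      moreover have "dsum h S (K - S) = s"
        unfolding KS s_def by (intro dsum_cong) (auto simp: h_def S_def K1_def)
      ultimately show ?thesis by simp
    qed
    then have sY: "s \<le> Y / 18" using bY by simp
    have "k1 * dsum w S S \<le> 2 * real (card S) * s"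
      unfolding s_def k1_def using sub by (intro tri_diag)
    also have "\<dots> \<le> k1 * (2 * s)" using Sk1 s0 by (simp add: mult_right_mono)
    finally have SS: "dsum w S S \<le> 2 * s" using k1 by simp
    define Y1 where "Y1 = dsum w K1 K1"
    have "Y = dsum w S S + 2 * dsum w S (K - S) + dsum w (K - S) (K - S)"
      unfolding Y_def using fin sub KV by (intro dsum_split_sym) (auto intro: w_sym)
    then have "Y \<le> Y1 + 4 * s" using SS by (simp add: KS s_def Y1_def)
    then have YY1: "Y \<le> 9 / 7 * Y1" using sY by simp
    then have Y1pos: "0 < Y1" using Ypos by simp
    have "real (card S) * Y1 \<le> 2 * k1 * s"
      using tri_diag[OF sub(1,2)] dw_sym[OF sub(1,2)] by (simp add: Y1_def k1_def s_def)
    then have SY: "real (card S) * Y \<le> 18 / 7 * (k1 * s)"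
      using mult_left_mono[OF YY1, of "real (card S)"] by simp
    have wpK: "dsum wp K (V - K) \<le> Y / 32" using C4 ZY Ypos by (simp add: Z_def)
    \<comment> \<open>The use of optimality: isolating \<open>K1\<close> by the fresh label
      \<open>l\<close> gains nothing, so at least half of the weight from \<open>K1\<close> to
      \<open>D\<close> is positive, and little positive weight leaves \<open>K\<close>.\<close>
    have K1D: "dsum w K1 D \<le> Y / 16"
    proof -
      let ?c' = "\<lambda>u. if u \<in> K1 then l else c u"
      have "0 \<le> dsum (\<lambda>u v. if c u = c v then 0 else wn u v - wp u v) K1 K1
        + 2 * dsum (\<lambda>u v. (if c v = l then wn u v else wp u v) - (if c u = c v then wn u v else wp u v)) K1 (V - K1)"
        using opt[of ?c'] recolor_cost[OF sub(1), of l c] by simp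
      also have "dsum (\<lambda>u v. if c u = c v then 0 else wn u v - wp u v) K1 K1 = dsum (\<lambda>_ _. 0) K1 K1"
        by (intro dsum_cong) (auto simp: K1_def)
      also have "dsum (\<lambda>u v. (if c v = l then wn u v else wp u v) - (if c u = c v then wn u v else wp u v)) K1 (V - K1)
         = dsum (\<lambda>u v. if c v = c u0 then wp u v - wn u v else 0) K1 (V - K1)"
        using l by (intro dsum_cong) (auto simp: K1_def)
      also have "\<dots> = dsum (\<lambda>u v. wp u v - wn u v) K1 D"
        using finV by (subst dsum_if_right) (auto simp: D_def K1_def intro!: arg_cong[of _ _ "dsum _ _"])
      finally have "dsum wn K1 D \<le> dsum wp K1 D" by (simp add: dsum_diff dsum_def)
      moreover have "dsum wp K1 D \<le> dsum wp K (V - K)"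
        using KV sub by (intro dwp_mono) (auto simp: D_def)
      ultimately show ?thesis using wpK dsum_w_split[of K1 D] by simp
    qed
    have Dk: "real (card D) \<le> k1 * (9 / 56)"
    proof -
      have "real (card D) * Y1 \<le> 2 * k1 * dsum w K1 D"
        unfolding k1_def Y1_def using sub by (intro tri_diag)
      also have "\<dots> \<le> 2 * k1 * (9 / 112 * Y1)" using K1D YY1 k1 by (intro mult_left_mono) auto
      finally have "real (card D) * Y1 \<le> (k1 * (9 / 56)) * Y1" by (simp add: mult_ac)
      then show ?thesis using Y1pos by (simp only: mult_le_cancel_right_pos)
    qed
    \<comment> \<open>Going from \<open>S\<close> to \<open>D\<close> through \<open>K1\<close>,
      both terms are at most 9/56 of \<open>k1 * s\<close>, and 9/28 is below 1/3.\<close>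
    have SD: "dsum w S D \<le> s / 3"
    proof -
      have "k1 * dsum w S D \<le> real (card D) * s + real (card S) * dsum w K1 D"
        unfolding k1_def s_def using sub by (intro tri_sets)
      also have "\<dots> \<le> (k1 * (9 / 56)) * s + real (card S) * (Y / 16)"
        using Dk s0 K1D by (intro add_mono mult_right_mono mult_left_mono) auto
      also have "\<dots> \<le> (k1 * (9 / 56)) * s + 18 / 7 * (k1 * s) / 16" using SY by (simp add: field_simps)
      also have "\<dots> \<le> k1 * (s / 3)" using k1 s0 by (simp add: field_simps)
      finally show ?thesis using k1 by simp
    qed
    have K1M: "dsum w K1 M \<le> Y / 198"
    proof -
      have "dsum w K1 M = dsum w M K1" using sub by (intro dw_sym)
      also have "\<dots> \<le> dsum w M C" using sub C by (intro dw_mono) auto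
      also have "\<dots> \<le> Z / 200" using C1 by (simp add: M_def Z_def)
      finally show ?thesis using ZY by simp
    qed
    have Mk: "real (card M) \<le> k1 * (1 / 77)"
    proof -
      have "real (card M) * Y1 \<le> 2 * k1 * dsum w K1 M"
        unfolding k1_def Y1_def using sub by (intro tri_diag)
      also have "\<dots> \<le> 2 * k1 * (1 / 154 * Y1)" using K1M YY1 k1 by (intro mult_left_mono) auto
      finally have "real (card M) * Y1 \<le> (k1 * (1 / 77)) * Y1" by (simp add: mult_ac)
      then show ?thesis using Y1pos by (simp only: mult_le_cancel_right_pos)
    qed
    have SM: "dsum w S M \<le> s / 30"
    proof -
      have "k1 * dsum w S M \<le> real (card M) * s + real (card S) * dsum w K1 M"
        unfolding k1_def s_def using sub by (intro tri_sets)
      also have "\<dots> \<le> (k1 * (1 / 77)) * s + real (card S) * (Y / 198)"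
        using Mk s0 K1M by (intro add_mono mult_right_mono mult_left_mono) auto
      also have "\<dots> \<le> (k1 * (1 / 77)) * s + 18 / 7 * (k1 * s) / 198" using SY by (simp add: field_simps)
      also have "\<dots> \<le> k1 * (s / 30)" using k1 s0 by (simp add: field_simps)
      finally show ?thesis using k1 by simp
    qed
    have Ceq: "C = S \<union> (K1 \<union> M)" using C by (auto simp: S_def K1_def M_def)
    have fins: "finite S" "finite K1" "finite M" using fin sub by (auto simp: M_def intro: finite_subset)
    have disj: "S \<inter> (K1 \<union> M) = {}" "K1 \<inter> M = {}" by (auto simp: S_def K1_def M_def)
    have splitC: "dsum F S C = dsum F S S + (dsum F S K1 + dsum F S M)" for F
      unfolding Ceq using fins disj by (simp add: dsum_Un_right)
    have SC: "dsum w S C \<le> 3 * s + s / 30" using SS SM by (simp add: splitC s_def)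
    let ?c' = "\<lambda>u. if u \<in> S then c u0 else c u"
    have 1: "dsum (\<lambda>u v. if c u = c v then 0 else wn u v - wp u v) S S \<le> dsum wn S S"
      using sub by (intro dsum_mono) (auto simp: wn_nonneg wp_nonneg subset_iff)
    let ?G = "\<lambda>u v. (if c v = c u0 then wn u v else wp u v) - (if c u = c v then wn u v else wp u v)"
    have VS: "V - S = K1 \<union> (V - K)" using KV by (auto simp: S_def K1_def)
    have "dsum ?G S (V - S) = dsum ?G S K1 + dsum ?G S (V - K)"
      unfolding VS using fins finV by (intro dsum_Un_right) (auto simp: K1_def)
    also have "dsum ?G S K1 = dsum (\<lambda>u v. 2 * wn u v - w u v) S K1"
      by (intro dsum_cong) (auto simp: S_def K1_def wn_def)
    also have "\<dots> = 2 * dsum wn S K1 - s" by (simp add: dsum_diff dsum_cmult s_def)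
    also have "dsum ?G S (V - K) \<le> dsum (\<lambda>u v. (if c v = c u0 then w u v else 0) + wp u v) S (V - K)"
    proof (intro dsum_mono)
      fix u v assume "u \<in> S" "v \<in> V - K"
      then have "u \<in> V" "v \<in> V" using sub by auto
      then have "0 \<le> wp u v" "0 \<le> w u v" "wp u v \<le> w u v" by (simp_all add: wp_nonneg w_nonneg wp_le)
      then show "?G u v \<le> (if c v = c u0 then w u v else 0) + wp u v" by (simp add: wn_def)
    qed
    also have "\<dots> = dsum w S D + dsum wp S (V - K)"
      using finV by (simp add: dsum_add dsum_if_right D_def)
    also have "V - K = M \<union> (V - C)" using C by (auto simp: M_def)
    also have "dsum wp S (M \<union> (V - C)) = dsum wp S M + dsum wp S (V - C)"
      using fins finV by (intro dsum_Un_right) (auto simp: M_def)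
    also have "dsum wp S M \<le> dsum w S M" using sub by (intro dsum_mono wp_le) auto
    finally have 2: "dsum ?G S (V - S) \<le> 2 * dsum wn S K1 - s + (dsum w S D + (dsum w S M + dsum wp S (V - C)))"
      by simp
    have "dsum wn S S + dsum wn S K1 \<le> dsum wn S C"
      unfolding splitC using sub dwn_nonneg[of S M] by simp
    moreover have "0 \<le> dsum wn S S" "0 \<le> dsum wp S (V - C)" using sub by (auto intro: dwn_nonneg dwp_nonneg)
    \<comment> \<open>The change is at most \<open>s\<close> times 4 (3 + 1/30)/40 + 2 (1/3 + 1/30)
      - 2, a negative number.\<close>
    ultimately have "cost ?c' \<le> cost c"
      using recolor_cost[OF sub(2), of "c u0" c] 1 2 SD SM SC C2[OF sub(6)] s0 by simp
    moreover have "\<forall>u\<in>K. \<forall>v\<in>K. ?c' u = ?c' v" by (auto simp: S_def K1_def)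
    moreover have "\<forall>u\<in>V - K. \<forall>v\<in>V - K. c u = c v \<longrightarrow> ?c' u = ?c' v" by (auto simp: S_def)
    ultimately show ?thesis by blast
  qed
qed

text \<open>Take an optimal labelling that keeps the largest number of atoms intact. Repairing a
  further atom separates no two vertices outside it that were together, so no intact atom is lost,
  contradicting maximality.\<close>

lemma ex_respecting_optimum:
  "\<exists>\<C>. partition_on V \<C> \<and> atom_respecting \<K> \<C> \<and> obj I \<C> = OPT I"
proof -
  define good where "good c = {K \<in> \<K>. \<forall>u\<in>K. \<forall>v\<in>K. c u = c v}" for c :: "'a \<Rightarrow> nat"
  have OPT_cost: "2 * OPT I \<le> cost c" for c
    using OPT_le[OF partition_part] obj_part[of c] by (metis mult_left_mono zero_le_numeral)
  obtain \<C> where \<C>: "partition_on V \<C>" "obj I \<C> = OPT I" using OPT_attained by blast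
  obtain c0 where "part c0 = \<C>" using ex_label[OF \<C>(1)] by blast
  then have "cost c0 = 2 * OPT I" using obj_part[of c0] \<C>(2) by simp
  moreover have "\<forall>c. cost c = 2 * OPT I \<longrightarrow> card (good c) \<le> card \<K>"
    using finite_atoms by (simp add: good_def card_mono)
  ultimately obtain c where c: "cost c = 2 * OPT I"
    and max: "\<And>c'. cost c' = 2 * OPT I \<Longrightarrow> card (good c') \<le> card (good c)"
    using ex_has_greatest_nat[of "\<lambda>c. cost c = 2 * OPT I" c0 "\<lambda>c. card (good c)" "Suc (card \<K>)"] by (auto simp: less_Suc_eq_le)
  have "good c = \<K>"
  proof (rule ccontr)
    assume "good c \<noteq> \<K>"
    moreover have "good c \<subseteq> \<K>" by (auto simp: good_def)
    ultimately obtain K where K: "K \<in> \<K>" "K \<notin> good c" by blast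
    have "cost c \<le> cost c'" for c' using OPT_cost[of c'] c by simp
    from repair_atom[OF K(1) this]
    obtain c' where c': "cost c' \<le> cost c" "\<forall>u\<in>K. \<forall>v\<in>K. c' u = c' v"
        "\<forall>u\<in>V - K. \<forall>v\<in>V - K. c u = c v \<longrightarrow> c' u = c' v"
      by blast
    have "insert K (good c) \<subseteq> good c'"
    proof
      fix L assume L: "L \<in> insert K (good c)"
      show "L \<in> good c'"
      proof (cases "L = K")
        case True
        then show ?thesis using K(1) c'(2) unfolding good_def by blast
      next
        case False
        then have "L \<in> \<K>" "\<forall>u\<in>L. \<forall>v\<in>L. c u = c v" using L unfolding good_def by blast+
        moreover have "L \<subseteq> V - K"
          using atom_disjoint[OF \<open>L \<in> \<K>\<close> K(1) False] atom_subset[OF \<open>L \<in> \<K>\<close>] by auto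
        ultimately show ?thesis using c'(3) unfolding good_def by blast
      qed
    qed
    moreover have "finite (good c')" using finite_atoms by (simp add: good_def)
    ultimately have "card (insert K (good c)) \<le> card (good c')" by (rule card_mono[rotated])
    moreover have "finite (good c)" using finite_atoms by (simp add: good_def)
    ultimately have "card (good c) < card (good c')" using K(2) by simp
    moreover have "cost c' = 2 * OPT I" using c'(1) c OPT_cost[of c'] by simp
    ultimately show False using max[of c'] by simp
  qed
  have "atom_respecting \<K> (part c)"
    unfolding atom_respecting_def
  proof
    fix K assume K: "K \<in> \<K>"
    then obtain u where u: "u \<in> K" using atom_nonempty by auto
    have "K \<in> good c" using K \<open>good c = \<K>\<close> by simp
    then have "K \<subseteq> {v \<in> V. c v = c u}" using u atom_subset[OF K] unfolding good_def by blast
    moreover have "{v \<in> V. c v = c u} \<in> part c" using u atom_subset[OF K] by (auto simp: part_def)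
    ultimately show "\<exists>C\<in>part c. K \<subseteq> C" by blast
  qed
  moreover have "obj I (part c) = OPT I" using c obj_part[of c] by simp
  ultimately show ?thesis using partition_part by blast
qed

end

section \<open>Stable clusterings\<close>

text \<open>All matrices are nonnegative, so restricting the walk to \<open>S'\<close> only drops
  paths. The outer degrees cancel the denominators of the first step \<open>P\<close>, which
  therefore loses nothing; each of the \<open>2 * t\<close> lazy steps loses a factor \<tau>, and so
  does the division by the degree in the middle.\<close>

lemma Gam_compare:
  assumes "wgraph S W d" "wgraph S' W d'" and sub: "S' \<subseteq> S"
    and tau: "0 < \<tau>" "\<tau> \<le> 1" and d': "\<And>i. i \<in> S' \<Longrightarrow> \<tau> * d i \<le> d' i"
    and "i \<in> S'" "j \<in> S'"
  shows "\<tau> ^ (2 * t + 1) * wgraph.Gam S' W d' t i j \<le> wgraph.Gam S W d t i j"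
proof -
  interpret G: wgraph S W d by fact
  interpret H: wgraph S' W d' by fact
  have inS: "i \<in> S" if "i \<in> S'" for i using that sub by auto
  have A: "\<tau> * H.A i j \<le> G.A i j" if ij: "i \<in> S'" "j \<in> S'" for i j
  proof -
    have "\<tau> * H.P i j \<le> G.P i j"
    proof -
      have "W i j * (\<tau> * d i) \<le> W i j * d' i"
        using d' ij H.W_nonneg by (intro mult_left_mono) auto
      then show ?thesis
        using G.d_pos[OF inS] H.d_pos ij by (simp add: H.P_def G.P_def field_simps)
    qed
    moreover have "\<tau> * mtx_diag (\<lambda>_. 1) i j \<le> mtx_diag (\<lambda>_. 1) i j"
      using tau by (simp add: mtx_diag_def)
    ultimately show ?thesis by (simp add: G.A_def H.A_def distrib_left)
  qed
  have pow: "\<tau> ^ t * mtx_pow S' H.A t i j \<le> mtx_pow S G.A t i j" if "i \<in> S'" "j \<in> S'" for i j t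
    using that
  proof (induction t arbitrary: i j)
    case 0 show ?case by simp
  next
    case (Suc t)
    have "\<tau> ^ Suc t * mtx_pow S' H.A (Suc t) i j
        = (\<Sum>k\<in>S'. (\<tau> * H.A i k) * (\<tau> ^ t * mtx_pow S' H.A t k j))"
      by (simp add: mtx_mult_def sum_distrib_left mult_ac)
    also have "\<dots> \<le> (\<Sum>k\<in>S'. G.A i k * mtx_pow S G.A t k j)"
      using Suc tau by (intro sum_mono mult_mono A)
        (auto intro!: mult_nonneg_nonneg H.pow_nonneg G.A_nonneg inS)
    also have "\<dots> \<le> mtx_pow S G.A (Suc t) i j"
      unfolding mtx_pow.simps mtx_mult_def using Suc.prems sub G.fin
      by (intro sum_mono2) (auto intro!: mult_nonneg_nonneg G.pow_nonneg G.A_nonneg)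
    finally show ?case .
  qed
  have Q: "\<tau> ^ t * (d' i * H.Q t i m) \<le> d i * G.Q t i m" if im: "i \<in> S'" "m \<in> S'" for i m
  proof -
    have "\<tau> ^ t * (d' i * H.Q t i m) = (\<Sum>k\<in>S'. W i k * (\<tau> ^ t * mtx_pow S' H.A t k m))"
      using H.d_pos[OF im(1)] by (simp add: H.Q_def H.P_def mtx_mult_def sum_distrib_left mult_ac)
    also have "\<dots> \<le> (\<Sum>k\<in>S'. W i k * mtx_pow S G.A t k m)"
      using im by (intro sum_mono mult_left_mono pow H.W_nonneg)
    also have "\<dots> \<le> (\<Sum>k\<in>S. W i k * mtx_pow S G.A t k m)"
      using im sub G.fin by (intro sum_mono2) (auto intro!: mult_nonneg_nonneg G.pow_nonneg G.W_nonneg)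
    also have "\<dots> = d i * G.Q t i m"
      using G.d_pos[OF inS[OF im(1)]] by (simp add: G.Q_def G.P_def mtx_mult_def sum_distrib_left mult_ac)
    finally show ?thesis .
  qed
  have e: "\<tau> ^ (2 * t + 1) = \<tau> ^ t * \<tau> ^ t * \<tau>" by (simp add: mult_2 power_add)
  have "\<tau> ^ (2 * t + 1) * H.Gam t i j
      = (\<Sum>m\<in>S'. (\<tau> ^ t * (d' i * H.Q t i m)) * (\<tau> ^ t * (d' j * H.Q t j m)) * (\<tau> / d' m))"
    unfolding e by (simp add: H.Gam_def sum_distrib_left mult_ac)
  also have "\<dots> \<le> (\<Sum>m\<in>S'. (d i * G.Q t i m) * (d j * G.Q t j m) * (1 / d m))"
  proof (rule sum_mono)
    fix m assume m: "m \<in> S'"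
    have 1: "\<tau> / d' m \<le> 1 / d m"
      using d'[OF m] H.d_pos[OF m] G.d_pos[OF inS[OF m]] by (simp add: field_simps)
    have 2: "0 \<le> d i * G.Q t i m" "0 \<le> d j * G.Q t j m"
      using m inS \<open>i \<in> S'\<close> \<open>j \<in> S'\<close> by (auto intro!: mult_nonneg_nonneg G.Q_nonneg less_imp_le[OF G.d_pos])
    have 3: "0 \<le> \<tau> ^ t * (d' j * H.Q t j m)"
      using m tau \<open>j \<in> S'\<close> by (auto intro!: mult_nonneg_nonneg H.Q_nonneg less_imp_le[OF H.d_pos])
    have 4: "0 \<le> \<tau> / d' m" using tau H.d_pos[OF m] by simp
    have "(\<tau> ^ t * (d' i * H.Q t i m)) * (\<tau> ^ t * (d' j * H.Q t j m)) \<le> (d i * G.Q t i m) * (d j * G.Q t j m)"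
      using Q[OF \<open>i \<in> S'\<close> m] Q[OF \<open>j \<in> S'\<close> m] 2(1) 3 by (rule mult_mono)
    then show "(\<tau> ^ t * (d' i * H.Q t i m)) * (\<tau> ^ t * (d' j * H.Q t j m)) * (\<tau> / d' m)
        \<le> (d i * G.Q t i m) * (d j * G.Q t j m) * (1 / d m)"
      using 1 mult_nonneg_nonneg[OF 2] 4 by (rule mult_mono)
  qed
  also have "\<dots> \<le> (\<Sum>m\<in>S. (d i * G.Q t i m) * (d j * G.Q t j m) * (1 / d m))"
    using sub G.fin inS \<open>i \<in> S'\<close> \<open>j \<in> S'\<close> 
    by (intro sum_mono2)
      (auto intro!: mult_nonneg_nonneg divide_nonneg_nonneg G.Q_nonneg less_imp_le[OF G.d_pos])
  also have "\<dots> = G.Gam t i j" by (simp add: G.Gam_def sum_distrib_left mult_ac)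
  finally show ?thesis .
qed

lemma (in wgraph) Gam_sym: "Gam t i j = Gam t j i"
  by (simp add: Gam_def mult_ac)

context cc
begin

lemma obj_split:
  assumes part: "partition_on V \<C>" and C: "C \<in> \<C>" and X: "X \<subseteq> C"
  shows "obj I (\<C> - {C} \<union> {X, C - X}) = obj I \<C> + dsum wp X (C - X) - dsum wn X (C - X)"
proof -
  let ?\<C>' = "\<C> - {C} \<union> {X, C - X}"
  let ?x = "\<lambda>u v. (u \<in> X \<and> v \<in> C - X) \<or> (v \<in> X \<and> u \<in> C - X)"
  have CV: "C \<subseteq> V" using part C by (auto simp: partition_on_def)
  have dj: "D \<inter> C = {}" if "D \<in> \<C>" "D \<noteq> C" for D
    using part C that by (auto simp: partition_on_def disjoint_def)
  have same: "same_part ?\<C>' {u, v} \<longleftrightarrow> same_part \<C> {u, v} \<and> \<not> ?x u v" for u v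
  proof (cases "u \<in> C \<or> v \<in> C")
    case True
    have "same_part \<C> {u, v} \<longleftrightarrow> u \<in> C \<and> v \<in> C"
      using True C dj unfolding same_part_def by blast
    moreover have "same_part ?\<C>' {u, v} \<longleftrightarrow> (u \<in> X \<and> v \<in> X) \<or> (u \<in> C - X \<and> v \<in> C - X)"
      using True X dj unfolding same_part_def by blast
    ultimately show ?thesis using X by blast
  next
    case False
    then show ?thesis using X unfolding same_part_def by blast
  qed
  define \<delta> where "\<delta> u v = (if ?x u v then wp u v - wn u v else 0)" for u v
  have "2 * obj I ?\<C>' - 2 * obj I \<C> = dsum \<delta> V V"
    unfolding obj_ordered dsum_diff[symmetric] same
  proof (rule dsum_cong)
    fix u v
    have "same_part \<C> {u, v}" if "?x u v" using that C X by (auto simp: same_part_def)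
    then show "(if same_part \<C> {u, v} \<and> \<not> ?x u v then wn u v else wp u v) -
         (if same_part \<C> {u, v} then wn u v else wp u v) = \<delta> u v"
      unfolding \<delta>_def by (cases "?x u v") auto
  qed
  also have "\<dots> = dsum \<delta> X X + 2 * dsum \<delta> X (V - X) + dsum \<delta> (V - X) (V - X)"
    using finV X CV by (intro dsum_split_sym) (auto simp: \<delta>_def wp_sym wn_sym)
  also have "dsum \<delta> X X = dsum (\<lambda>_ _. 0) X X" by (intro dsum_cong) (auto simp: \<delta>_def)
  also have "dsum \<delta> (V - X) (V - X) = dsum (\<lambda>_ _. 0) (V - X) (V - X)" by (intro dsum_cong) (auto simp: \<delta>_def)
  also have "dsum \<delta> X (V - X) = dsum (\<lambda>u v. if v \<in> C then wp u v - wn u v else 0) X (V - X)"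
    by (intro dsum_cong) (auto simp: \<delta>_def)
  also have "\<dots> = dsum (\<lambda>u v. wp u v - wn u v) X {v \<in> V - X. v \<in> C}"
    using finV by (intro dsum_if_right) auto
  also have "{v \<in> V - X. v \<in> C} = C - X" using CV by auto
  finally show ?thesis by (simp add: dsum_diff dsum_def[of "\<lambda>_ _. 0"])
qed

lemma partition_split:
  assumes part: "partition_on V \<C>" and C: "C \<in> \<C>" and X: "X \<subseteq> C" "X \<noteq> {}" "X \<noteq> C"
  shows "partition_on V (\<C> - {C} \<union> {X, C - X})" "card (\<C> - {C} \<union> {X, C - X}) = Suc (card \<C>)"
proof -
  have dj: "D \<inter> C = {}" if "D \<in> \<C>" "D \<noteq> C" for D
    using part C that by (auto simp: partition_on_def disjoint_def)
  have ne: "{} \<notin> \<C>" "\<Union>\<C> = V" using part by (auto simp: partition_on_def)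
  have U: "\<Union>(\<C> - {C} \<union> {X, C - X}) = \<Union>\<C>" using C X by auto
  show "partition_on V (\<C> - {C} \<union> {X, C - X})"
  proof (rule partition_onI)
    show "\<Union>(\<C> - {C} \<union> {X, C - X}) = V" using U ne by simp
    show "{} \<notin> \<C> - {C} \<union> {X, C - X}" using ne X by auto
    show "disjnt p q" if pq: "p \<in> \<C> - {C} \<union> {X, C - X}" "q \<in> \<C> - {C} \<union> {X, C - X}" "p \<noteq> q" for p q
    proof -
      have 1: "disjnt D X" "disjnt D (C - X)" "disjnt X D" "disjnt (C - X) D" if "D \<in> \<C> - {C}" for D
        using dj[of D] that X by (auto simp: disjnt_def)
      have 2: "disjnt p q" if "p \<in> \<C> - {C}" "q \<in> \<C> - {C}"
        using part that pq(3) by (auto simp: partition_on_def disjoint_def disjnt_def)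
      have 3: "disjnt X (C - X)" "disjnt (C - X) X" by (auto simp: disjnt_def)
      from pq(1,2) show ?thesis
      proof (elim UnE insertE emptyE)
      qed (use 1 2 3 pq(3) in simp_all)
    qed
  qed
  have "X \<notin> \<C>" "C - X \<notin> \<C>" using dj[of X] dj[of "C - X"] X by auto
  moreover have "X \<noteq> C - X" using X by auto
  moreover have "finite \<C>" using part finV finite_elements by blast
  ultimately have "card (insert X (insert (C - X) (\<C> - {C}))) = Suc (Suc (card (\<C> - {C})))"
    by simp
  moreover have "Suc (card (\<C> - {C})) = card \<C>"
    using C \<open>finite \<C>\<close> by (rule card_Suc_Diff1[rotated])
  moreover have "insert X (insert (C - X) (\<C> - {C})) = \<C> - {C} \<union> {X, C - X}" by blast
  ultimately show "card (\<C> - {C} \<union> {X, C - X}) = Suc (card \<C>)" by metis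
qed

end

section \<open>The weighted graph of atoms\<close>

context cc_atoms
begin

definition Wat :: "'a set \<Rightarrow> 'a set \<Rightarrow> real" where
  "Wat K L = (if K = L then 0 else dsum wp K L)"

lemma Wat_sym: "K \<in> \<K> \<Longrightarrow> L \<in> \<K> \<Longrightarrow> Wat K L = Wat L K"
  using atom_subset by (auto simp: Wat_def intro!: dsum_commute wp_sym)

lemma Wat_nonneg: "K \<in> \<K> \<Longrightarrow> L \<in> \<K> \<Longrightarrow> 0 \<le> Wat K L"
  using atom_subset by (auto simp: Wat_def intro!: dwp_nonneg)

lemma sum_Wat:
  assumes "\<A> \<subseteq> \<K>" "K \<in> \<A>"
  shows "(\<Sum>L\<in>\<A>. Wat K L) = dsum wp K (\<Union>\<A> - K)"
proof -
  have fin: "finite \<A>" using assms finite_atoms finite_subset by blast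
  have "(\<Sum>L\<in>\<A>. Wat K L) = (\<Sum>L\<in>\<A> - {K}. dsum wp K L)"
    using fin by (intro sum.mono_neutral_cong_right) (auto simp: Wat_def)
  also have "\<dots> = dsum wp K (\<Union>(\<A> - {K}))"
    using fin assms disjoint_atoms finite_atom
    by (intro dsum_Union_right[symmetric]) (auto simp: disjoint_def)
  also have "\<Union>(\<A> - {K}) = \<Union>\<A> - K"
  proof -
    have "L \<inter> K = {}" if "L \<in> \<A> - {K}" for L using assms that atom_disjoint[of L K] by auto
    then show ?thesis by blast
  qed
  finally show ?thesis .
qed

abbreviation "dg \<equiv> atom_deg I \<K>"

lemma dg_Wat: "K \<in> \<K> \<Longrightarrow> dg K = (\<Sum>L\<in>\<K>. Wat K L)"
  unfolding atom_deg_def wt_pos_eq using finite_atoms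
  by (intro sum.mono_neutral_cong_left) (auto simp: Wat_def)

lemma dg_eq: "K \<in> \<K> \<Longrightarrow> dg K = dsum wp K (V - K)"
  using sum_Wat[of \<K> K] by (simp add: dg_Wat Union_atoms)

lemma dg_nonneg: "K \<in> \<K> \<Longrightarrow> 0 \<le> dg K"
  by (simp add: dg_Wat sum_nonneg Wat_nonneg)

lemma sum_atoms: "(\<Sum>K\<in>\<K>. \<Sum>L\<in>\<K>. dsum F K L) = dsum F V V"
  using dsum_Union_right[OF finite_atoms finite_atom disjoint_atoms, of F, symmetric]
    dsum_Union_left[OF finite_atoms finite_atom disjoint_atoms, of F V, symmetric]
  by (simp add: Union_atoms)

text \<open>The degrees add up to the positive weight cut by the atoms, counted from both
  ends.\<close>

lemma sum_dg_le: "(\<Sum>K\<in>\<K>. dg K) \<le> 2 * obj I \<K>"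
proof -
  have "(\<Sum>K\<in>\<K>. dg K) = (\<Sum>K\<in>\<K>. \<Sum>L\<in>\<K>. Wat K L)" by (simp add: dg_Wat)
  also have "\<dots> \<le> (\<Sum>K\<in>\<K>. \<Sum>L\<in>\<K>. dsum (\<lambda>u v. if same_part \<K> {u, v} then wn u v else wp u v) K L)"
  proof (intro sum_mono)
    fix K L assume KL: "K \<in> \<K>" "L \<in> \<K>"
    show "Wat K L \<le> dsum (\<lambda>u v. if same_part \<K> {u, v} then wn u v else wp u v) K L"
    proof (cases "K = L")
      case True
      then show ?thesis using atom_subset[OF KL(1)]
        by (auto simp: Wat_def subset_iff intro!: dsum_nonneg wn_nonneg wp_nonneg)
    next
      case False
      have "\<not> same_part \<K> {u, v}" if "u \<in> K" "v \<in> L" for u v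
      proof
        assume "same_part \<K> {u, v}"
        then obtain M where "M \<in> \<K>" "u \<in> M" "v \<in> M" by (auto simp: same_part_def)
        then show False using KL that False atom_disjoint[of K M] atom_disjoint[of L M] by auto
      qed
      then have "dsum (\<lambda>u v. if same_part \<K> {u, v} then wn u v else wp u v) K L = dsum wp K L"
        by (intro dsum_cong) auto
      with False show ?thesis by (simp add: Wat_def)
    qed
  qed
  also have "\<dots> = 2 * obj I \<K>" unfolding sum_atoms obj_ordered ..
  finally show ?thesis .
qed

abbreviation "\<K>\<^sub>p \<equiv> pos_atoms I \<K>"

lemma pos_atoms_sub: "\<K>\<^sub>p \<subseteq> \<K>" by (auto simp: pos_atoms_def)

text \<open>Dropping atoms of degree 0 leaves the other degrees unchanged, as the weight to such an
  atom is at most its degree.\<close>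

lemma wgraph_pos: "wgraph \<K>\<^sub>p Wat dg"
proof
  show "finite \<K>\<^sub>p" using finite_subset[OF pos_atoms_sub finite_atoms] .
  show "Wat K L = Wat L K" if "K \<in> \<K>\<^sub>p" "L \<in> \<K>\<^sub>p" for K L using that pos_atoms_sub Wat_sym by blast
  show "0 \<le> Wat K L" if "K \<in> \<K>\<^sub>p" "L \<in> \<K>\<^sub>p" for K L using that pos_atoms_sub Wat_nonneg by blast
  show "0 < dg K" if "K \<in> \<K>\<^sub>p" for K using that by (simp add: pos_atoms_def)
  show "dg K = (\<Sum>L\<in>\<K>\<^sub>p. Wat K L)" if K: "K \<in> \<K>\<^sub>p" for K
  proof -
    have K': "K \<in> \<K>" using K pos_atoms_sub by blast
    have "Wat K L = 0" if L: "L \<in> \<K> - \<K>\<^sub>p" for L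
    proof -
      have L': "L \<in> \<K>" "dg L = 0" using L dg_nonneg[of L] by (auto simp: pos_atoms_def)
      have "Wat L K \<le> dg L"
        unfolding dg_Wat[OF L'(1)] using K' L'(1) finite_atoms
        by (intro member_le_sum) (auto intro: Wat_nonneg)
      then show ?thesis using L' Wat_nonneg[of L K] Wat_sym[of K L] K' by simp
    qed
    then show ?thesis unfolding dg_Wat[OF K']
      using finite_atoms pos_atoms_sub by (intro sum.mono_neutral_right) auto
  qed
qed

sublocale G: wgraph "\<K>\<^sub>p" Wat dg by (rule wgraph_pos)

lemma Gamma_eq: "Gamma_mat I \<K> K L = (if K \<in> \<K>\<^sub>p \<and> L \<in> \<K>\<^sub>p then G.Gam t0 K L else 0)"
proof -
  have "walk I \<K> = G.P"
    by (intro ext) (simp add: walk_def G.P_def Wat_def wt_pos_eq)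
  moreover from this have "lazy_walk I \<K> = G.A"
    by (intro ext) (simp add: lazy_walk_def G.A_def)
  ultimately have "Qmat I \<K> = G.Q t0" by (simp add: Qmat_def G.Q_def)
  then show ?thesis by (simp add: Gamma_mat_def Let_def G.Gam_mtx)
qed

lemma Gamma_nonneg: "0 \<le> Gamma_mat I \<K> K L"
  by (simp add: Gamma_eq G.Gam_nonneg)

lemma Gamma_sym: "Gamma_mat I \<K> K L = Gamma_mat I \<K> L K"
  by (simp add: Gamma_eq G.Gam_sym[of t0 K L])

lemma Gamma_total: "(\<Sum>K\<in>\<K>. \<Sum>L\<in>\<K>. Gamma_mat I \<K> K L) \<le> 2 * obj I \<K>"
proof -
  have "(\<Sum>K\<in>\<K>. \<Sum>L\<in>\<K>. Gamma_mat I \<K> K L) = (\<Sum>K\<in>\<K>\<^sub>p. \<Sum>L\<in>\<K>\<^sub>p. G.Gam t0 K L)"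
    using finite_atoms pos_atoms_sub
    by (intro sum.mono_neutral_cong_right sum.neutral) (auto simp: Gamma_eq intro!: sum.neutral)
  also have "\<dots> = (\<Sum>K\<in>\<K>\<^sub>p. dg K)" by (rule G.Gam_total)
  also have "\<dots> \<le> (\<Sum>K\<in>\<K>. dg K)"
    using finite_atoms pos_atoms_sub by (intro sum_mono2) (auto intro: dg_nonneg)
  also have "\<dots> \<le> 2 * obj I \<K>" by (rule sum_dg_le)
  finally show ?thesis .
qed

text \<open>An unordered pair may satisfy the definition in either order. Symmetry of the weights
  and of \<Gamma> makes the order irrelevant, and disjointness of the atoms makes \<open>K\<close>
  and \<open>L\<close> unique.\<close>

lemma admissible_iff:
  assumes "K \<in> \<K>" "L \<in> \<K>" "u \<in> K" "v \<in> L"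
  shows "{u, v} \<in> admissible \<alpha> \<epsilon> I \<K> \<longleftrightarrow>
    K \<noteq> L \<and> dsum w K L < 64 * (\<epsilon> / (2 * \<alpha>)) powi (- (2 * int t0 + 1)) * Gamma_mat I \<K> K L"
    (is "_ \<longleftrightarrow> K \<noteq> L \<and> ?adm K L")
proof
  assume "{u, v} \<in> admissible \<alpha> \<epsilon> I \<K>"
  then obtain u' v' K' L' where *: "{u, v} = {u', v'}" "K' \<in> \<K>" "L' \<in> \<K>" "K' \<noteq> L'" "u' \<in> K'" "v' \<in> L'" "?adm K' L'"
    unfolding admissible_def Let_def wt_sets_eq by blast
  have uniq: "A = B" if "A \<in> \<K>" "B \<in> \<K>" "x \<in> A" "x \<in> B" for A B x
    using that atom_disjoint by blast
  from *(1) have "(u = u' \<and> v = v') \<or> (u = v' \<and> v = u')" by (auto simp: doubleton_eq_iff)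
  then show "K \<noteq> L \<and> ?adm K L"
  proof
    assume "u = u' \<and> v = v'"
    then have "K = K'" "L = L'" using assms * uniq by metis+
    with * show ?thesis by simp
  next
    assume "u = v' \<and> v = u'"
    then have "K = L'" "L = K'" using assms * uniq by metis+
    with * show ?thesis
      using Gamma_sym[of K L] dw_sym[OF atom_subset atom_subset, of K L] assms by simp
  qed
next
  assume "K \<noteq> L \<and> ?adm K L"
  then show "{u, v} \<in> admissible \<alpha> \<epsilon> I \<K>"
    unfolding admissible_def Let_def wt_sets_eq using assms by blast
qed

lemma powi_eq:
  fixes \<tau> :: real
  shows "\<tau> powi (- (2 * int t0 + 1)) = inverse (\<tau> ^ (2 * t0 + 1))"
proof -
  have "2 * int t0 + 1 = int (2 * t0 + 1)" by simp
  then show ?thesis by (simp only: power_int_minus power_int_of_nat)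
qed

text \<open>Each admissible block weighs less than \<open>B\<close> times its entry of \<Gamma>, and
  these entries sum to at most twice the cost of the atoms. Ordered pairs of atoms count every
  vertex pair twice, which cancels that factor 2.\<close>

lemma weight_admissible:
  assumes "0 < \<alpha>" "0 < \<epsilon>"
  shows "wt_pairs I (admissible \<alpha> \<epsilon> I \<K>) \<le> 64 * (2 * \<alpha> / \<epsilon>) ^ (2 * t0 + 1) * obj I \<K>"
proof -
  define B where "B = 64 * (\<epsilon> / (2 * \<alpha>)) powi (- (2 * int t0 + 1))"
  have B: "B = 64 * (2 * \<alpha> / \<epsilon>) ^ (2 * t0 + 1)"
    using assms unfolding B_def powi_eq power_inverse[symmetric] by simp
  have B0: "0 \<le> B" unfolding B using assms by simp
  let ?E = "admissible \<alpha> \<epsilon> I \<K>"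
  have E: "?E \<subseteq> pos_pairs I \<union> neg_pairs I"
  proof
    fix e assume "e \<in> ?E"
    then obtain u v K L where "e = {u, v}" "K \<in> \<K>" "L \<in> \<K>" "K \<noteq> L" "u \<in> K" "v \<in> L"
      unfolding admissible_def Let_def by blast
    moreover from this have "u \<noteq> v" "u \<in> V" "v \<in> V"
      using atom_disjoint[of K L] atom_subset[of K] atom_subset[of L] by auto
    ultimately show "e \<in> pos_pairs I \<union> neg_pairs I" unfolding pairs by blast
  qed
  have "2 * wt_pairs I ?E = (\<Sum>K\<in>\<K>. \<Sum>L\<in>\<K>. dsum (\<lambda>u v. if {u, v} \<in> ?E then w u v else 0) K L)"
    unfolding sum_atoms by (rule wt_pairs_ordered[OF E])
  also have "\<dots> \<le> (\<Sum>K\<in>\<K>. \<Sum>L\<in>\<K>. B * Gamma_mat I \<K> K L)"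
  proof (intro sum_mono)
    fix K L assume KL: "K \<in> \<K>" "L \<in> \<K>"
    show "dsum (\<lambda>u v. if {u, v} \<in> ?E then w u v else 0) K L \<le> B * Gamma_mat I \<K> K L"
    proof (cases "K \<noteq> L \<and> dsum w K L < B * Gamma_mat I \<K> K L")
      case True
      have "dsum (\<lambda>u v. if {u, v} \<in> ?E then w u v else 0) K L = dsum w K L"
        using True admissible_iff[OF KL] unfolding B_def by (intro dsum_cong) simp
      with True show ?thesis by simp
    next
      case False
      have "dsum (\<lambda>u v. if {u, v} \<in> ?E then w u v else 0) K L = dsum (\<lambda>_ _. 0) K L"
        using False admissible_iff[OF KL] unfolding B_def by (intro dsum_cong) auto
      also have "\<dots> = 0" by (simp add: dsum_def)
      finally show ?thesis using B0 Gamma_nonneg by simp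
    qed
  qed
  also have "\<dots> = B * (\<Sum>K\<in>\<K>. \<Sum>L\<in>\<K>. Gamma_mat I \<K> K L)" by (simp add: sum_distrib_left)
  also have "\<dots> \<le> B * (2 * obj I \<K>)" using Gamma_total B0 by (rule mult_left_mono)
  finally show ?thesis unfolding B by simp
qed

text \<open>The clustering minimises the cost plus \<open>\<tau> d(K)\<close> for every atom \<open>K\<close> that is not a cluster of its
  own; among the minimisers it has the most clusters, which makes the first inequality strict.\<close>

lemma ex_split_stable:
  assumes tau: "0 < \<tau>"
  obtains \<C> where "partition_on V \<C>" "atom_respecting \<K> \<C>"
    "obj I \<C> \<le> OPT I + \<tau> * (\<Sum>K\<in>\<K>. dg K)"
    "\<And>C X. C \<in> \<C> \<Longrightarrow> X \<subseteq> C \<Longrightarrow> X \<noteq> {} \<Longrightarrow> X \<noteq> C \<Longrightarrow> (\<And>K. K \<in> \<K> \<Longrightarrow> K \<subseteq> X \<or> K \<inter> X = {})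
       \<Longrightarrow> dsum wn X (C - X) < dsum wp X (C - X)"
    "\<And>C K. C \<in> \<C> \<Longrightarrow> K \<in> \<K> \<Longrightarrow> K \<subseteq> C \<Longrightarrow> K \<noteq> C \<Longrightarrow> \<tau> * dg K \<le> dsum wp K (C - K)"
proof -
  define R where "R = {\<C>. partition_on V \<C> \<and> atom_respecting \<K> \<C>}"
  define \<Phi> where "\<Phi> \<C> = obj I \<C> + \<tau> * (\<Sum>K\<in>\<K> - \<C>. dg K)" for \<C>
  have finR: "finite R" unfolding R_def by (rule finite_subset[OF _ finite_part]) auto
  obtain \<C>' where C': "partition_on V \<C>'" "atom_respecting \<K> \<C>'" "obj I \<C>' = OPT I"
    using ex_respecting_optimum by blast
  then have "\<C>' \<in> R" by (simp add: R_def)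
  define R' where "R' = {\<C> \<in> R. \<Phi> \<C> = Min (\<Phi> ` R)}"
  have "Min (\<Phi> ` R) \<in> \<Phi> ` R" using finR \<open>\<C>' \<in> R\<close> by (intro Min_in) auto
  then have R': "finite R'" "R' \<noteq> {}" using finR by (auto simp: R'_def)
  have "Max (card ` R') \<in> card ` R'" using R' by (intro Max_in) auto
  then obtain \<C> where \<C>: "\<C> \<in> R'" "card \<C> = Max (card ` R')" by auto
  have min: "\<Phi> \<C> \<le> \<Phi> \<D>" if "\<D> \<in> R" for \<D>
    using \<C>(1) that finR by (simp add: R'_def)
  have max: "card \<D> \<le> card \<C>" if "\<D> \<in> R" "\<Phi> \<D> \<le> \<Phi> \<C>" for \<D>
  proof -
    have "\<Phi> \<D> = \<Phi> \<C>" using min[OF that(1)] that(2) by simp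
    then have "\<D> \<in> R'" using that \<C>(1) by (simp add: R'_def)
    then show ?thesis unfolding \<C>(2) using R' by simp
  qed
  have part: "partition_on V \<C>" and resp: "atom_respecting \<K> \<C>"
    using \<C>(1) by (auto simp: R'_def R_def)
  have "obj I \<C> \<le> \<Phi> \<C>"
    unfolding \<Phi>_def using tau by (auto intro!: mult_nonneg_nonneg sum_nonneg dg_nonneg)
  also have "\<dots> \<le> \<Phi> \<C>'" using \<open>\<C>' \<in> R\<close> by (rule min)
  also have "\<dots> \<le> OPT I + \<tau> * (\<Sum>K\<in>\<K>. dg K)"
    unfolding \<Phi>_def C'(3) using tau finite_atoms
    by (intro add_left_mono mult_left_mono sum_mono2) (auto intro: dg_nonneg)
  finally have cost: "obj I \<C> \<le> OPT I + \<tau> * (\<Sum>K\<in>\<K>. dg K)" .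
  have split: "\<C> - {C} \<union> {X, C - X} \<in> R"
    if C: "C \<in> \<C>" and X: "X \<subseteq> C" "X \<noteq> {}" "X \<noteq> C"
      and at: "\<And>K. K \<in> \<K> \<Longrightarrow> K \<subseteq> X \<or> K \<inter> X = {}" for C X
  proof -
    have "\<exists>D\<in>\<C> - {C} \<union> {X, C - X}. K \<subseteq> D" if K: "K \<in> \<K>" for K
    proof -
      obtain D where D: "D \<in> \<C>" "K \<subseteq> D" using resp K by (auto simp: atom_respecting_def)
      show ?thesis
      proof (cases "D = C")
        case True
        then show ?thesis using at[OF K] D by (cases "K \<subseteq> X") auto
      next
        case False
        then show ?thesis using D by auto
      qed
    qed
    then show ?thesis using partition_split[OF part C X] by (simp add: R_def atom_respecting_def)
  qed
  \<comment> \<open>A cluster with such a proper part is not an atom, so splitting it makes no atom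
    newly pay the penalty.\<close>
  have atom_not: "C \<notin> \<K>"
    if X: "X \<subseteq> C" "X \<noteq> {}" "X \<noteq> C" and at: "\<And>K. K \<in> \<K> \<Longrightarrow> K \<subseteq> X \<or> K \<inter> X = {}" for C X
    using at[of C] X by auto
  have c1: "dsum wn X (C - X) < dsum wp X (C - X)"
    if C: "C \<in> \<C>" and X: "X \<subseteq> C" "X \<noteq> {}" "X \<noteq> C"
      and at: "\<And>K. K \<in> \<K> \<Longrightarrow> K \<subseteq> X \<or> K \<inter> X = {}" for C X
  proof (rule ccontr)
    assume neg: "\<not> ?thesis"
    let ?D = "\<C> - {C} \<union> {X, C - X}"
    have "C \<notin> \<K>" using X at by (rule atom_not)
    then have "(\<Sum>K\<in>\<K> - ?D. dg K) \<le> (\<Sum>K\<in>\<K> - \<C>. dg K)"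
      using finite_atoms by (intro sum_mono2) (auto intro: dg_nonneg)
    then have "\<tau> * (\<Sum>K\<in>\<K> - ?D. dg K) \<le> \<tau> * (\<Sum>K\<in>\<K> - \<C>. dg K)"
      using tau by (intro mult_left_mono) auto
    then have "\<Phi> ?D \<le> \<Phi> \<C>" using obj_split[OF part C X(1)] neg by (simp add: \<Phi>_def)
    \<comment> \<open>A cut without strict gain would yield another minimiser with one more
      cluster.\<close>
    then have "card ?D \<le> card \<C>" using split[OF C X at] by (intro max)
    then show False using partition_split(2)[OF part C X] by simp
  qed
  have c2: "\<tau> * dg K \<le> dsum wp K (C - K)"
    if C: "C \<in> \<C>" and K: "K \<in> \<K>" "K \<subseteq> C" "K \<noteq> C" for C K
  proof -
    have X: "K \<subseteq> C" "K \<noteq> {}" "K \<noteq> C" using K atom_nonempty by auto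
    have at: "L \<subseteq> K \<or> L \<inter> K = {}" if "L \<in> \<K>" for L using atom_disjoint[OF that K(1)] by auto
    let ?D = "\<C> - {C} \<union> {K, C - K}"
    have "C \<notin> \<K>" using X at by (rule atom_not)
    moreover have "K \<notin> \<C>"
    proof
      assume "K \<in> \<C>"
      then have "K \<inter> C = {}" using part C K(3) unfolding partition_on_def disjoint_def by blast
      then show False using X by auto
    qed
    ultimately have "(\<Sum>L\<in>\<K> - ?D. dg L) + dg K \<le> (\<Sum>L\<in>\<K> - \<C>. dg L)"
    proof -
      assume *: "C \<notin> \<K>" "K \<notin> \<C>"
      \<comment> \<open>After the split \<open>K\<close> is a cluster of its own, so its penalty is
        saved.\<close>
      have "(\<Sum>L\<in>insert K (\<K> - ?D). dg L) \<le> (\<Sum>L\<in>\<K> - \<C>. dg L)"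
        using finite_atoms * K by (intro sum_mono2) (auto intro: dg_nonneg)
      then show ?thesis using finite_atoms by simp
    qed
    then have "\<tau> * ((\<Sum>L\<in>\<K> - ?D. dg L) + dg K) \<le> \<tau> * (\<Sum>L\<in>\<K> - \<C>. dg L)"
      using tau by (intro mult_left_mono) auto
    moreover have "\<Phi> \<C> \<le> \<Phi> ?D" using split[OF C X at] by (rule min)
    moreover have "0 \<le> dsum wn K (C - K)"
      using part C K atom_subset[OF K(1)] by (intro dwn_nonneg) (auto simp: partition_on_def)
    ultimately show ?thesis using obj_split[OF part C K(2)] by (simp add: \<Phi>_def distrib_left)
  qed
  show thesis by (rule that[OF part resp cost]) (use c1 c2 in blast)+
qed

end

section \<open>Expansion inside the clusters of a stable clustering\<close>

context cc_atoms
begin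

text \<open>At most 3/99 of w(K, K) leaves \<open>K\<close> positively, so by \<open>stable\<close>
  the whole weight from \<open>K\<close> to \<open>C - K\<close> is below 1/16 of w(K, K); averaging
  over \<open>K\<close> turns this into a bound on cardinalities. The assumption \<open>pos\<close>
  rules out w(K, K) = 0.\<close>

lemma big_atom_dominates:
  assumes K: "K \<in> \<K>" "\<not> (\<exists>u. K = {u})" and C: "K \<subseteq> C" "C \<subseteq> V"
    and pos: "0 < dsum wp K (C - K)" and stable: "dsum w K (C - K) \<le> 2 * dsum wp K (C - K)"
  shows "card (C - K) \<le> card K"
proof -
  obtain D where D: "dsum w D D \<le> 100 / 99 * dsum w K K" "dsum wp K (V - K) \<le> 3 / 100 * dsum w D D"
    using big_atom[OF K] by blast
  let ?Y = "dsum w K K"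
  have le: "dsum wp K (C - K) \<le> dsum wp K (V - K)" using C by (intro dwp_mono) auto
  have Y: "0 < ?Y" and Y': "dsum w K (C - K) \<le> ?Y / 16"
    using D le pos stable by simp_all
  have "real (card (C - K)) * ?Y \<le> 2 * real (card K) * dsum w K (C - K)"
    using C by (intro tri_diag) auto
  also have "\<dots> \<le> 2 * real (card K) * (?Y / 16)" using Y' by (intro mult_left_mono) auto
  also have "\<dots> \<le> real (card K) * ?Y" using Y by simp
  finally show ?thesis using Y by simp
qed

text \<open>In a cluster with at least two atoms, an atom is a single vertex or contains at least half of
  the vertices. This is what makes the weight between two atoms at most \<open>16 dC K dC L / vol\<close>.\<close>

lemma stable_cluster_admissible:
  assumes tau: "0 < \<tau>" "\<tau> \<le> 1" and C: "C \<subseteq> V" "\<Union>{M \<in> \<K>. M \<subseteq> C} = C"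
    and split: "\<And>X. X \<subseteq> C \<Longrightarrow> X \<noteq> {} \<Longrightarrow> X \<noteq> C \<Longrightarrow> (\<And>K. K \<in> \<K> \<Longrightarrow> K \<subseteq> X \<or> K \<inter> X = {})
       \<Longrightarrow> dsum wn X (C - X) < dsum wp X (C - X)"
    and eject: "\<And>K. K \<in> \<K> \<Longrightarrow> K \<subseteq> C \<Longrightarrow> K \<noteq> C \<Longrightarrow> \<tau> * dg K \<le> dsum wp K (C - K)"
    and KL: "K \<in> \<K>" "L \<in> \<K>" "K \<subseteq> C" "L \<subseteq> C" "K \<noteq> L"
  shows "dsum w K L < 64 * inverse (\<tau> ^ (2 * t0 + 1)) * Gamma_mat I \<K> K L"
proof -
  define S where "S = {M \<in> \<K>. M \<subseteq> C}"
  define dC where "dC M = (\<Sum>N\<in>S. Wat M N)" for M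
  have S\<K>: "S \<subseteq> \<K>" by (auto simp: S_def)
  have US: "\<Union>S = C" using C by (simp add: S_def)
  have finS: "finite S" using S\<K> finite_atoms finite_subset by blast
  have finC: "finite C" using C finV finite_subset by blast
  have KS: "K \<in> S" "L \<in> S" using KL by (auto simp: S_def)
  have MC: "M \<subseteq> C" "M \<subseteq> V" "M \<noteq> {}" "finite M" if "M \<in> S" for M
    using that C atom_nonempty finite_atom by (auto simp: S_def)
  have disj: "M \<inter> N = {}" if "M \<in> S" "N \<in> S" "M \<noteq> N" for M N
    using that S\<K> atom_disjoint by blast
  have MneC: "M \<noteq> C" if "M \<in> S" for M
    using disj[OF that KS(1)] disj[OF that KS(2)] KL MC(3)[OF KS(1)] MC(3)[OF KS(2)] by blast
  have dC: "dC M = dsum wp M (C - M)" if "M \<in> S" for M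
    using sum_Wat[OF S\<K> that] by (simp add: dC_def US)
  have st: "dsum wn M (C - M) < dsum wp M (C - M)" if M: "M \<in> S" for M
  proof (rule split)
    show "N \<subseteq> M \<or> N \<inter> M = {}" if "N \<in> \<K>" for N
      using atom_disjoint[OF that] M S\<K> by blast
  qed (use MC[OF M] MneC[OF M] in auto)
  have w_dC: "dsum w M (C - M) \<le> 2 * dC M" if M: "M \<in> S" for M
    using st[OF M] dsum_w_split[of M "C - M"] by (simp add: dC[OF M])
  have dC_pos: "0 < dC M" if M: "M \<in> S" for M
    using st[OF M] dwn_nonneg[of M "C - M"] MC[OF M] C(1) by (fastforce simp: dC[OF M])
  interpret H: wgraph S Wat dC
  proof
    show "finite S" by (rule finS)
    show "Wat M N = Wat N M" if "M \<in> S" "N \<in> S" for M N using that S\<K> Wat_sym by blast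
    show "0 \<le> Wat M N" if "M \<in> S" "N \<in> S" for M N using that S\<K> Wat_nonneg by blast
    show "dC M = (\<Sum>N\<in>S. Wat M N)" for M by (simp add: dC_def)
  qed (rule dC_pos)
  define vol where "vol = sum dC S"
  have vol_pos: "0 < vol" unfolding vol_def using finS KS dC_pos by (intro sum_pos) auto
  have sub: "finite T" "\<And>M. M \<in> T \<Longrightarrow> finite M" "disjoint T" if "T \<subseteq> S" for T
    using that finite_subset[OF that finS] MC(4) disj unfolding disjoint_def by blast+
  have UL: "(\<Sum>M\<in>T. dsum F M B) = dsum F (\<Union>T) B" if "T \<subseteq> S" for T F B
    using sub[OF that] by (rule dsum_Union_left[symmetric])
  have UR: "(\<Sum>M\<in>T. dsum F A M) = dsum F A (\<Union>T)" if "T \<subseteq> S" for T F A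
    using sub[OF that] by (rule dsum_Union_right[symmetric])
  have dC_le: "dC M \<le> dsum w M C" if M: "M \<in> S" for M
  proof -
    have "dC M \<le> dsum w M (C - M)"
      unfolding dC[OF M] using MC[OF M] C(1) by (intro dsum_mono wp_le) auto
    also have "\<dots> \<le> dsum w M C" using MC[OF M] C(1) by (intro dw_mono) auto
    finally show ?thesis .
  qed
  define n where "n = real (card C)"
  have n_pos: "0 < n" using MC[OF KS(1)] finC by (auto simp: n_def card_gt_0_iff)
  have single: "dsum w {u} C \<le> 2 * dC {u}" "vol \<le> 4 * n * dC {u}" if u: "{u} \<in> S" for u
  proof -
    have uV: "u \<in> V" "u \<in> C" using MC[OF u] by auto
    have "dsum w {u} C = dsum w {u} (C - {u})"
      using uV finC by (simp add: dsum_def sum.remove[of C u] w_self)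
    then show 1: "dsum w {u} C \<le> 2 * dC {u}" using w_dC[OF u] by simp
    have "vol \<le> (\<Sum>M\<in>S. dsum w M C)" unfolding vol_def by (intro sum_mono dC_le)
    also have "\<dots> = dsum w C C" using UL[of S] US by simp
    also have "\<dots> \<le> n * dsum w C {u} + n * dsum w {u} C"
      using tri_sets[OF C(1) C(1), of "{u}"] uV by (simp add: n_def)
    also have "dsum w C {u} = dsum w {u} C" using C uV by (intro dw_sym) auto
    also have "n * dsum w {u} C + n * dsum w {u} C \<le> n * (2 * dC {u}) + n * (2 * dC {u})"
      using 1 n_pos by (intro add_mono mult_left_mono) auto
    finally show "vol \<le> 4 * n * dC {u}" by simp
  qed
  \<comment> \<open>\<open>M\<close> has at least as many vertices as \<open>C - M\<close>, hence
    the weight inside \<open>C - M\<close> is at most 2 w(C - M, M) \<le> \<open>4 * dC M\<close>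
    and vol is at most \<open>6 * dC M\<close>. With w(M, N) \<le> \<open>2 * dC N\<close> this
    gives the constant 12, below 16.\<close>
  have big: "dsum w M N * vol \<le> 16 * dC M * dC N"
    if M: "M \<in> S" "\<not> (\<exists>u. M = {u})" and N: "N \<in> S" "N \<noteq> M" for M N
  proof -
    let ?R = "C - M"
    have RV: "?R \<subseteq> V" using C by auto
    have "card ?R \<le> card M"
      using M S\<K> MC[OF M(1)] C dC_pos[OF M(1)] w_dC[OF M(1)] dC[OF M(1)]
      by (intro big_atom_dominates) auto
    then have "real (card M) * dsum w ?R ?R \<le> real (card M) * (2 * dsum w ?R M)"
      using tri_diag[OF RV MC(2)[OF M(1)]] dw_nonneg[OF RV MC(2)[OF M(1)]]
        mult_right_mono[of "real (card ?R)" "real (card M)" "2 * dsum w ?R M"] by simp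
    then have RR: "dsum w ?R ?R \<le> 4 * dC M"
      using MC[OF M(1)] dw_sym[OF RV MC(2)[OF M(1)]] w_dC[OF M(1)] by (simp add: card_gt_0_iff)
    have RM: "dsum wp ?R M = dC M"
      unfolding dC[OF M(1)] using RV MC[OF M(1)] by (intro dsum_commute wp_sym) auto
    have "\<Union>(S - {M}) = ?R" using US disj[OF _ M(1)] by blast
    have "vol = dC M + sum dC (S - {M})"
      unfolding vol_def using finS M by (intro sum.remove)
    also have "sum dC (S - {M}) \<le> (\<Sum>N\<in>S - {M}. dsum wp N M + dsum w N ?R)"
    proof (rule sum_mono)
      fix N assume N: "N \<in> S - {M}"
      then have N': "N \<in> S" "N \<inter> M = {}" using disj M by auto
      have "C - N = M \<union> (?R - N)" using N' MC[OF M(1)] by auto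
      then have "dC N = dsum wp N M + dsum wp N (?R - N)"
        unfolding dC[OF N'(1)] using finC MC[OF M(1)] by (subst dsum_Un_right[symmetric]) auto
      also have "dsum wp N (?R - N) \<le> dsum w N (?R - N)"
        using MC[OF N'(1)] RV by (intro dsum_mono wp_le) auto
      also have "dsum w N (?R - N) \<le> dsum w N ?R"
        using MC[OF N'(1)] RV by (intro dw_mono) auto
      finally show "dC N \<le> dsum wp N M + dsum w N ?R" by simp
    qed
    also have "\<dots> = dC M + dsum w ?R ?R"
      using UL[of "S - {M}"] \<open>\<Union>(S - {M}) = ?R\<close> by (simp add: sum.distrib RM)
    finally have vol6: "vol \<le> 6 * dC M" using RR by simp
    have "M \<subseteq> C - N" using disj[OF N(1) M(1) N(2)] MC[OF M(1)] by auto
    then have "dsum w N M \<le> dsum w N (C - N)" using MC[OF N(1)] C by (intro dw_mono) auto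
    then have "dsum w M N \<le> 2 * dC N"
      using w_dC[OF N(1)] dw_sym[OF MC(2)[OF M(1)] MC(2)[OF N(1)]] by simp
    then have "dsum w M N * vol \<le> (2 * dC N) * (6 * dC M)"
      using vol6 vol_pos dC_pos[OF N(1)] by (intro mult_mono) auto
    also have "\<dots> \<le> 16 * dC M * dC N" using dC_pos[OF M(1)] dC_pos[OF N(1)] by simp
    finally show ?thesis .
  qed
  have w_le: "dsum w M N * vol \<le> 16 * dC M * dC N" if MN: "M \<in> S" "N \<in> S" "M \<noteq> N" for M N
  proof (cases "\<exists>u. M = {u}")
    case False
    with MN show ?thesis by (intro big) auto
  next
    case True
    then obtain u where u: "M = {u}" by blast
    show ?thesis
    proof (cases "\<exists>v. N = {v}")
      case False
      with MN have "dsum w N M * vol \<le> 16 * dC N * dC M" by (intro big) auto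
      then show ?thesis using dw_sym[OF MC(2)[OF MN(1)] MC(2)[OF MN(2)]] by (simp add: mult_ac)
    next
      case True
      then obtain v where v: "N = {v}" by blast
      \<comment> \<open>Two single vertices are compared through all midpoints in \<open>C\<close>.
        Each of the two terms contributes 2 * 4, which is the origin of the constant 16.\<close>
      have "n * dsum w M N \<le> dsum w M C + dsum w C N"
        using tri_sets[OF MC(2)[OF MN(1)] MC(2)[OF MN(2)] C(1)] by (simp add: u v n_def)
      also have "dsum w C N = dsum w N C" using C MC(2)[OF MN(2)] by (intro dw_sym)
      also have "dsum w M C + dsum w N C \<le> 2 * dC M + 2 * dC N"
        using single(1) MN u v by (intro add_mono) auto
      finally have "n * dsum w M N * vol \<le> (2 * dC M + 2 * dC N) * vol"
        using vol_pos by (intro mult_right_mono) auto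
      also have "\<dots> = 2 * dC M * vol + 2 * dC N * vol" by (simp add: distrib_right)
      also have "\<dots> \<le> 2 * dC M * (4 * n * dC N) + 2 * dC N * (4 * n * dC M)"
        using single(2) MN u v dC_pos[OF MN(1)] dC_pos[OF MN(2)]
        by (intro add_mono mult_left_mono) auto
      finally have "n * (dsum w M N * vol) \<le> n * (16 * dC M * dC N)" by (simp add: mult_ac)
      then show ?thesis using n_pos by (simp only: mult_le_cancel_left_pos)
    qed
  qed
  have W_le: "Wat M N \<le> 16 * dC M * dC N / sum dC S" if MN: "M \<in> S" "N \<in> S" for M N
  proof (cases "M = N")
    case True
    then show ?thesis using dC_pos[OF MN(1)] vol_pos by (simp add: Wat_def vol_def[symmetric])
  next
    case False
    have "Wat M N \<le> dsum w M N"
      using False MC[OF MN(1)] MC[OF MN(2)] by (auto simp: Wat_def intro!: dsum_mono wp_le)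
    also have "\<dots> \<le> 16 * dC M * dC N / vol"
      using w_le[OF MN False] vol_pos by (simp add: pos_le_divide_eq)
    finally show ?thesis by (simp add: vol_def)
  qed
  \<comment> \<open>The union \<open>X\<close> has at most half of the vertices, so w(X, X) \<le> 2
    w(X, C - X). The degrees thus sum to at most 3 w(X, C - X), and stability of the cut bounds this
    by six times its positive weight.\<close>
  have expand: "sum dC T \<le> 6 * cut S Wat T"
    if T: "T \<subseteq> S" "2 * (\<Sum>M\<in>T. real (card M)) \<le> (\<Sum>M\<in>S. real (card M))" for T
  proof (cases "T = {}")
    case True
    then show ?thesis by (simp add: cut_def)
  next
    case False
    define X where "X = \<Union>T"
    have finT: "finite T" using T finS finite_subset by blast
    have cardU: "(\<Sum>M\<in>T'. real (card M)) = real (card (\<Union>T'))" if "T' \<subseteq> S" for T'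
    proof -
      have "pairwise disjnt T'" using sub(3)[OF that] unfolding disjoint_def pairwise_def disjnt_def .
      then show ?thesis using sub(2)[OF that] by (simp add: card_Union_disjoint)
    qed
    have XC: "X \<subseteq> C" using T US by (auto simp: X_def)
    have X0: "X \<noteq> {}" using False T MC(3) unfolding X_def by blast
    have "2 * card X \<le> card C" using T cardU[OF T(1)] cardU[of S] US by (simp add: X_def)
    moreover have "0 < card X" using X0 XC finC finite_subset by (auto simp: card_gt_0_iff)
    ultimately have XneC: "X \<noteq> C" and half: "card X \<le> card (C - X)"
      using card_Diff_subset[OF finite_subset[OF XC finC] XC] by auto
    have XV: "X \<subseteq> V" "C - X \<subseteq> V" using XC C by auto
    have UD: "\<Union>(S - T) = C - X"
      using US T disj unfolding X_def by blast
    have cutX: "cut S Wat T = dsum wp X (C - X)"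
    proof -
      have "cut S Wat T = (\<Sum>M\<in>T. \<Sum>N\<in>S - T. Wat M N)"
        unfolding cut_def using finS T
        by (intro sum.mono_neutral_cong_right ballI sum.neutral) auto
      also have "\<dots> = (\<Sum>M\<in>T. \<Sum>N\<in>S - T. dsum wp M N)"
        by (intro sum.cong refl) (auto simp: Wat_def)
      also have "\<dots> = (\<Sum>M\<in>T. dsum wp M (C - X))" using UR[of "S - T"] UD by simp
      also have "\<dots> = dsum wp X (C - X)" using UL[OF T(1)] by (simp add: X_def)
      finally show ?thesis .
    qed
    have at: "N \<subseteq> X \<or> N \<inter> X = {}" if "N \<in> \<K>" for N
    proof (cases "N \<in> T")
      case False
      then have "N \<inter> M = {}" if "M \<in> T" for M
        using that \<open>N \<in> \<K>\<close> T S\<K> atom_disjoint[of N M] by blast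
      then show ?thesis by (auto simp: X_def)
    qed (auto simp: X_def)
    have "dsum wn X (C - X) < dsum wp X (C - X)" using XC X0 XneC at by (rule split)
    then have wX: "dsum w X (C - X) \<le> 2 * dsum wp X (C - X)"
      using dsum_w_split[of X "C - X"] by simp
    have "real (card X) * dsum w X X \<le> real (card (C - X)) * dsum w X X"
      using half dw_nonneg[OF XV(1) XV(1)] by (intro mult_right_mono) auto
    also have "\<dots> \<le> real (card X) * (2 * dsum w X (C - X))" using tri_diag[OF XV] by simp
    finally have XX: "dsum w X X \<le> 2 * dsum w X (C - X)" using \<open>0 < card X\<close> by simp
    have "sum dC T \<le> (\<Sum>M\<in>T. dsum w M C)" using T by (intro sum_mono dC_le) auto
    also have "\<dots> = dsum w X C" using UL[OF T(1)] by (simp add: X_def)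
    also have "\<dots> = dsum w X X + dsum w X (C - X)"
      using dsum_Un_right[of X "C - X" w X] finite_subset[OF XC finC] finC XC by (simp add: Un_absorb1)
    also have "\<dots> \<le> 6 * dsum wp X (C - X)" using XX wX by simp
    finally show ?thesis by (simp add: cutX)
  qed
  have "dC K * dC L / (4 * sum dC S) < H.Gam t0 K L"
    using expand W_le KS by (intro H.Gam_expander[of "\<lambda>M. real (card M)"]) auto
  \<comment> \<open>The factor 64 in the definition of admissibility is 16 * 4.\<close>
  moreover have "dsum w K L \<le> 64 * (dC K * dC L / (4 * sum dC S))"
    using w_le[OF KS KL(5)] vol_pos by (simp add: pos_le_divide_eq vol_def[symmetric])
  ultimately have 1: "dsum w K L < 64 * H.Gam t0 K L" by simp
  have dC_dg: "\<tau> * dg M \<le> dC M" "dC M \<le> dg M" if M: "M \<in> S" for M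
  proof -
    show "\<tau> * dg M \<le> dC M" unfolding dC[OF M]
      using M MneC[OF M] by (intro eject) (auto simp: S_def)
    have "M \<in> \<K>" using M S\<K> by auto
    then show "dC M \<le> dg M" unfolding dC[OF M] using MC[OF M] C
      by (subst dg_eq) (auto intro: dwp_mono)
  qed
  have Sp: "S \<subseteq> \<K>\<^sub>p" using S\<K> dC_pos dC_dg(2) by (fastforce simp: pos_atoms_def)
  have "\<tau> ^ (2 * t0 + 1) * H.Gam t0 K L \<le> G.Gam t0 K L"
    using wgraph_pos H.wgraph_axioms Sp tau dC_dg(1) KS by (rule Gam_compare)
  moreover have "Gamma_mat I \<K> K L = G.Gam t0 K L" using KS Sp by (auto simp: Gamma_eq)
  ultimately have "H.Gam t0 K L \<le> inverse (\<tau> ^ (2 * t0 + 1)) * Gamma_mat I \<K> K L"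
    using tau by (simp add: field_simps)
  then show ?thesis using 1 by simp
qed

lemma atom_structure:
  assumes alpha: "1 \<le> \<alpha>" and eps: "0 < \<epsilon>" "\<epsilon> \<le> 1" and bound: "obj I \<K> \<le> \<alpha> * OPT I"
  shows "\<exists>\<C>\<^sub>1. partition_on V \<C>\<^sub>1 \<and> atom_respecting \<K> \<C>\<^sub>1 \<and> obj I \<C>\<^sub>1 \<le> (1 + \<epsilon>) * OPT I \<and>
    (\<forall>K\<in>\<K>. \<forall>L\<in>\<K>. K \<noteq> L \<and> (\<exists>C\<in>\<C>\<^sub>1. K \<subseteq> C \<and> L \<subseteq> C) \<longrightarrow>
       (\<forall>u\<in>K. \<forall>v\<in>L. {u, v} \<in> admissible \<alpha> \<epsilon> I \<K>))"
    and "wt_pairs I (admissible \<alpha> \<epsilon> I \<K>) \<le> 128 * \<alpha> * (2 * \<alpha> / \<epsilon>) ^ (2 * t0 + 1) * OPT I"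
proof -
  define \<tau> where "\<tau> = \<epsilon> / (2 * \<alpha>)"
  have tau: "0 < \<tau>" "\<tau> \<le> 1" using alpha eps by (auto simp: \<tau>_def)
  obtain \<C>\<^sub>1 where part: "partition_on V \<C>\<^sub>1" and resp: "atom_respecting \<K> \<C>\<^sub>1"
    and cost: "obj I \<C>\<^sub>1 \<le> OPT I + \<tau> * (\<Sum>K\<in>\<K>. dg K)"
    and split: "\<And>C X. C \<in> \<C>\<^sub>1 \<Longrightarrow> X \<subseteq> C \<Longrightarrow> X \<noteq> {} \<Longrightarrow> X \<noteq> C \<Longrightarrow> (\<And>K. K \<in> \<K> \<Longrightarrow> K \<subseteq> X \<or> K \<inter> X = {})
       \<Longrightarrow> dsum wn X (C - X) < dsum wp X (C - X)"
    and eject: "\<And>C K. C \<in> \<C>\<^sub>1 \<Longrightarrow> K \<in> \<K> \<Longrightarrow> K \<subseteq> C \<Longrightarrow> K \<noteq> C \<Longrightarrow> \<tau> * dg K \<le> dsum wp K (C - K)"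
    using ex_split_stable[OF tau(1)] by metis
  have "\<tau> * (\<Sum>K\<in>\<K>. dg K) \<le> \<tau> * (2 * (\<alpha> * OPT I))"
    using sum_dg_le bound tau by (intro mult_left_mono) auto
  also have "\<dots> = \<epsilon> * OPT I" using alpha by (simp add: \<tau>_def)
  finally have 1: "obj I \<C>\<^sub>1 \<le> (1 + \<epsilon>) * OPT I" using cost by (simp add: distrib_right)
  have 2: "{u, v} \<in> admissible \<alpha> \<epsilon> I \<K>"
    if KL: "K \<in> \<K>" "L \<in> \<K>" "K \<noteq> L" and C: "C \<in> \<C>\<^sub>1" "K \<subseteq> C" "L \<subseteq> C" and uv: "u \<in> K" "v \<in> L" for K L C u v
  proof -
    have CV: "C \<subseteq> V" using C part by (auto simp: partition_on_def)
    have "\<Union>{M \<in> \<K>. M \<subseteq> C} = C"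
    proof
      show "C \<subseteq> \<Union>{M \<in> \<K>. M \<subseteq> C}"
      proof
        fix x assume x: "x \<in> C"
        then obtain M where M: "M \<in> \<K>" "x \<in> M" using CV Union_atoms by blast
        then obtain D where D: "D \<in> \<C>\<^sub>1" "M \<subseteq> D" using resp by (auto simp: atom_respecting_def)
        then have "D = C" using part x M C(1) unfolding partition_on_def disjoint_def by blast
        with M D show "x \<in> \<Union>{M \<in> \<K>. M \<subseteq> C}" by blast
      qed
    qed auto
    then have "dsum w K L < 64 * inverse (\<tau> ^ (2 * t0 + 1)) * Gamma_mat I \<K> K L"
      by (intro stable_cluster_admissible[OF tau CV _ split[OF C(1)] eject[OF C(1)]] KL C) auto
    then show ?thesis
      unfolding admissible_iff[OF KL(1,2) uv] \<tau>_def[symmetric] powi_eq using KL(3) by blast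
  qed
  show "\<exists>\<C>\<^sub>1. partition_on V \<C>\<^sub>1 \<and> atom_respecting \<K> \<C>\<^sub>1 \<and> obj I \<C>\<^sub>1 \<le> (1 + \<epsilon>) * OPT I \<and>
    (\<forall>K\<in>\<K>. \<forall>L\<in>\<K>. K \<noteq> L \<and> (\<exists>C\<in>\<C>\<^sub>1. K \<subseteq> C \<and> L \<subseteq> C) \<longrightarrow>
       (\<forall>u\<in>K. \<forall>v\<in>L. {u, v} \<in> admissible \<alpha> \<epsilon> I \<K>))"
    using part resp 1 2 by blast
  have "wt_pairs I (admissible \<alpha> \<epsilon> I \<K>) \<le> 64 * (2 * \<alpha> / \<epsilon>) ^ (2 * t0 + 1) * obj I \<K>"
    using alpha eps by (intro weight_admissible) auto
  also have "\<dots> \<le> 64 * (2 * \<alpha> / \<epsilon>) ^ (2 * t0 + 1) * (\<alpha> * OPT I)"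
    using bound alpha eps by (intro mult_left_mono) auto
  also have "\<dots> \<le> 128 * (2 * \<alpha> / \<epsilon>) ^ (2 * t0 + 1) * (\<alpha> * OPT I)"
    using OPT_nonneg alpha eps by (intro mult_right_mono) auto
  finally show "wt_pairs I (admissible \<alpha> \<epsilon> I \<K>) \<le> 128 * \<alpha> * (2 * \<alpha> / \<epsilon>) ^ (2 * t0 + 1) * OPT I"
    by (simp only: mult_ac)
qed

end

lemma beta_bound: "\<beta> \<le> (2 * sqrt 7 - 5) / 6 \<Longrightarrow> \<beta> \<le> 1 / 20"
proof -
  have "sqrt 7 \<le> 265 / 100" by (rule real_le_lsqrt) (auto simp: power2_eq_square)
  then show "\<beta> \<le> (2 * sqrt 7 - 5) / 6 \<Longrightarrow> \<beta> \<le> 1 / 20" by simp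
qed

section \<open>Running times of expressions and loops\<close>

lemma nat_bits_le_iff: "nat_bits k \<le> L \<longleftrightarrow> k < 2 ^ L"
  unfolding nat_bits_def by (auto intro: floorlog_leI dest: floorlog_leD)

lemma nat_bits_less: "k < 2 ^ nat_bits k"
  using nat_bits_le_iff[of k "nat_bits k"] by simp

lemma nat_bits_le_self: "nat_bits k \<le> k"
  by (simp add: nat_bits_le_iff)

lemma nat_bits_mono: "k \<le> l \<Longrightarrow> nat_bits k \<le> nat_bits l"
  unfolding nat_bits_le_iff using nat_bits_less[of l] by simp

lemma nat_bits_add: "nat_bits (a + b) \<le> nat_bits a + nat_bits b + 1"
proof -
  let ?a = "nat_bits a" and ?b = "nat_bits b"
  have "(2::nat) ^ ?a \<le> 2 ^ (?a + ?b)" "(2::nat) ^ ?b \<le> 2 ^ (?a + ?b)"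
    by (simp_all add: power_increasing)
  with nat_bits_less[of a] nat_bits_less[of b]
  have "a + b < 2 ^ (?a + ?b) + 2 ^ (?a + ?b)" by linarith
  then have "a + b < 2 ^ (?a + ?b + 1)" by simp
  then show ?thesis unfolding nat_bits_le_iff .
qed

lemma nat_bits_mult: "nat_bits (a * b) \<le> nat_bits a + nat_bits b"
  unfolding nat_bits_le_iff power_add
  using nat_bits_less[of a] nat_bits_less[of b] by (intro mult_strict_mono) auto

lemma nat_bits_01 [simp]: "nat_bits 0 = 0" "nat_bits (Suc 0) = 1"
  by (simp_all add: nat_bits_def floorlog_def)

text \<open>Common properties of the two cost models. Long sums need a bound of their own: iterating the
  bound for one addition would let the size grow exponentially in the number of terms.\<close>

locale size_model =
  fixes sz :: "real \<Rightarrow> nat" and X :: "real set"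
  assumes of_nat_in: "real n \<in> X" and of_nat_size: "sz (real n) \<le> nat_bits n + 1"
    and add_in: "x \<in> X \<Longrightarrow> y \<in> X \<Longrightarrow> x + y \<in> X"
    and diff_in: "x \<in> X \<Longrightarrow> y \<in> X \<Longrightarrow> x - y \<in> X"
    and mult_in: "x \<in> X \<Longrightarrow> y \<in> X \<Longrightarrow> x * y \<in> X"
    and div_in: "x \<in> X \<Longrightarrow> y \<in> X \<Longrightarrow> x / y \<in> X"
    and add_size: "x \<in> X \<Longrightarrow> y \<in> X \<Longrightarrow> sz (x + y) \<le> 4 * (sz x + sz y) + 4"
    and diff_size: "x \<in> X \<Longrightarrow> y \<in> X \<Longrightarrow> sz (x - y) \<le> 4 * (sz x + sz y) + 4"
    and mult_size: "x \<in> X \<Longrightarrow> y \<in> X \<Longrightarrow> sz (x * y) \<le> 4 * (sz x + sz y) + 4"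
    and div_size: "x \<in> X \<Longrightarrow> y \<in> X \<Longrightarrow> sz (x / y) \<le> 4 * (sz x + sz y) + 4"
    and sum_size: "(\<And>k. k < m \<Longrightarrow> f k \<in> X \<and> sz (f k) \<le> b) \<Longrightarrow> sz (\<Sum>k<m. f k) \<le> (m + 1) * (2 * b + 2)"

lemma size_model_unit: "size_model (\<lambda>_. 1) UNIV"
  by unfold_locales simp_all

lemma real_bits_le:
  assumes "q \<noteq> 0" "x = of_int p / of_int q" "\<bar>p\<bar> < 2 ^ a" "\<bar>q\<bar> < 2 ^ c"
  shows "real_bits x \<le> a + c"
proof -
  have "nat_bits (nat \<bar>p\<bar>) \<le> a" "nat_bits (nat \<bar>q\<bar>) \<le> c"
    using assms(3,4) by (simp_all add: nat_bits_le_iff nat_less_iff)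
  moreover have "real_bits x \<le> nat_bits (nat \<bar>p\<bar>) + nat_bits (nat \<bar>q\<bar>)"
    unfolding real_bits_def using assms(1,2) by (intro Least_le) blast
  ultimately show ?thesis by simp
qed

text \<open>Rationality guarantees that the \<open>LEAST\<close> in \<open>real_bits\<close> is
  attained; its witness is one fraction that meets both bounds at once.\<close>

lemma real_bits_rep:
  assumes "x \<in> \<rat>" "real_bits x \<le> b"
  shows "\<exists>p q. q \<noteq> 0 \<and> x = of_int p / of_int q \<and> \<bar>p\<bar> < 2 ^ b \<and> \<bar>q\<bar> < 2 ^ b"
proof -
  let ?P = "\<lambda>k. \<exists>p q :: int. q \<noteq> 0 \<and> x = of_int p / of_int q \<and>
                     k = nat_bits (nat \<bar>p\<bar>) + nat_bits (nat \<bar>q\<bar>)"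
  obtain p q :: int where "q \<noteq> 0" "x = of_int p / of_int q"
    using assms(1) unfolding Rats_eq_int_div_int by blast
  then have "?P (nat_bits (nat \<bar>p\<bar>) + nat_bits (nat \<bar>q\<bar>))" by blast
  then have "?P (real_bits x)" unfolding real_bits_def by (rule LeastI)
  then obtain p q :: int where pq: "q \<noteq> 0" "x = of_int p / of_int q"
    "real_bits x = nat_bits (nat \<bar>p\<bar>) + nat_bits (nat \<bar>q\<bar>)" by blast
  then have "nat_bits (nat \<bar>p\<bar>) \<le> b" "nat_bits (nat \<bar>q\<bar>) \<le> b" using assms(2) by simp_all
  then have "\<bar>p\<bar> < 2 ^ b" "\<bar>q\<bar> < 2 ^ b" by (simp_all add: nat_bits_le_iff nat_less_iff)
  with pq show ?thesis by blast
qed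

lemma abs_mult_less_power:
  fixes p r :: int
  assumes "\<bar>p\<bar> < 2 ^ a" "\<bar>r\<bar> < 2 ^ b"
  shows "\<bar>p * r\<bar> < 2 ^ (a + b)"
  unfolding abs_mult power_add using assms by (intro mult_strict_mono') auto

lemma real_bits_ops:
  assumes x: "x \<in> \<rat>" and y: "y \<in> \<rat>"
  shows "real_bits (x + y) \<le> 4 * (real_bits x + real_bits y) + 4"
    and "real_bits (x - y) \<le> 4 * (real_bits x + real_bits y) + 4"
    and "real_bits (x * y) \<le> 4 * (real_bits x + real_bits y) + 4"
    and "real_bits (x / y) \<le> 4 * (real_bits x + real_bits y) + 4"
proof -
  let ?a = "real_bits x" and ?b = "real_bits y"
  obtain p q where p: "q \<noteq> 0" "x = of_int p / of_int q" "\<bar>p\<bar> < 2 ^ ?a" "\<bar>q\<bar> < 2 ^ ?a"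
    using real_bits_rep[OF x order_refl] by blast
  obtain r s where r: "s \<noteq> 0" "y = of_int r / of_int s" "\<bar>r\<bar> < 2 ^ ?b" "\<bar>s\<bar> < 2 ^ ?b"
    using real_bits_rep[OF y order_refl] by blast
  let ?c = "?a + ?b"
  have ps: "\<bar>p * s\<bar> < 2 ^ ?c" and qs: "\<bar>q * s\<bar> < 2 ^ ?c"
    and pr: "\<bar>p * r\<bar> < 2 ^ ?c" and qr: "\<bar>q * r\<bar> < 2 ^ ?c"
    using p r by (auto intro: abs_mult_less_power)
  have "real_bits (x + y) \<le> (?c + 1) + ?c"
  proof (rule real_bits_le)
    show "x + y = of_int (p * s + q * r) / of_int (q * s)"
      unfolding p(2) r(2) using p(1) r(1) by (simp add: field_simps)
  qed (use p r ps qr qs in auto)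
  then show "real_bits (x + y) \<le> 4 * (?a + ?b) + 4" by simp
  have "real_bits (x - y) \<le> (?c + 1) + ?c"
  proof (rule real_bits_le)
    show "x - y = of_int (p * s - q * r) / of_int (q * s)"
      unfolding p(2) r(2) using p(1) r(1) by (simp add: field_simps)
  qed (use p r ps qr qs in auto)
  then show "real_bits (x - y) \<le> 4 * (?a + ?b) + 4" by simp
  have "real_bits (x * y) \<le> ?c + ?c"
    by (rule real_bits_le[of "q * s" _ "p * r"]) (use p r pr qs in auto)
  then show "real_bits (x * y) \<le> 4 * (?a + ?b) + 4" by simp
  show "real_bits (x / y) \<le> 4 * (?a + ?b) + 4"
  proof (cases "r = 0")
    case True
    have "real_bits (x / y) \<le> 0 + 1" by (rule real_bits_le[of 1 _ 0]) (use True r in auto)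
    then show ?thesis by simp
  next
    case False
    have "real_bits (x / y) \<le> ?c + ?c"
      by (rule real_bits_le[of "q * r" _ "p * s"]) (use p r ps qr False in auto)
    then show ?thesis by simp
  qed
qed

text \<open>The product of all denominators serves as common denominator, without cancelling. Each
  term adds \<open>b\<close> bits to it and \<open>b + 1\<close> bits to the numerator, so the
  growth in \<open>m\<close> is linear.\<close>

lemma real_bits_sum:
  assumes "\<And>k. k < m \<Longrightarrow> x k \<in> \<rat> \<and> real_bits (x k) \<le> b"
  shows "real_bits (\<Sum>k<m. x k) \<le> (m + 1) * (2 * b + 2)"
proof -
  \<comment> \<open>The bound on \<open>q\<close> is not strict because the empty sum has
    denominator 1 = 2^0.\<close>
  have "\<exists>p q. q \<noteq> 0 \<and> (\<Sum>k<m. x k) = of_int p / of_int q \<and> \<bar>p\<bar> < 2 ^ (m * (b + 1)) \<and> \<bar>q\<bar> \<le> 2 ^ (m * b)"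
    using assms
  proof (induction m)
    case 0
    show ?case by (intro exI[of _ 0] exI[of _ 1]) simp
  next
    case (Suc m)
    then obtain p q where p: "q \<noteq> 0" "(\<Sum>k<m. x k) = of_int p / of_int q"
      "\<bar>p\<bar> < 2 ^ (m * (b + 1))" "\<bar>q\<bar> \<le> 2 ^ (m * b)" by auto
    obtain r s where r: "s \<noteq> 0" "x m = of_int r / of_int s" "\<bar>r\<bar> < 2 ^ b" "\<bar>s\<bar> < 2 ^ b"
      using Suc.prems[of m] real_bits_rep by blast
    have "\<bar>p * s\<bar> < 2 ^ (m * (b + 1) + b)" using p r by (intro abs_mult_less_power)
    moreover have "\<bar>q * r\<bar> \<le> 2 ^ (m * b) * 2 ^ b"
      unfolding abs_mult using p r by (intro mult_mono) auto
    moreover have "(2::int) ^ (m * b) * 2 ^ b \<le> 2 ^ (m * (b + 1) + b)"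
      unfolding power_add[symmetric] by (intro power_increasing) auto
    ultimately have "\<bar>p * s + q * r\<bar> < 2 ^ (m * (b + 1) + b) + 2 ^ (m * (b + 1) + b)" by linarith
    also have "\<dots> = 2 ^ (Suc m * (b + 1))" by (simp add: power_add)
    finally have 1: "\<bar>p * s + q * r\<bar> < 2 ^ (Suc m * (b + 1))" .
    have "\<bar>q * s\<bar> \<le> 2 ^ (m * b) * 2 ^ b"
      unfolding abs_mult using p r by (intro mult_mono) auto
    then have 2: "\<bar>q * s\<bar> \<le> 2 ^ (Suc m * b)" by (simp add: power_add mult.commute)
    have "(\<Sum>k<Suc m. x k) = of_int (p * s + q * r) / of_int (q * s)"
      using p r by (simp add: field_simps)
    with 1 2 p r show ?case by (intro exI[of _ "p * s + q * r"] exI[of _ "q * s"]) auto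
  qed
  then obtain p q where p: "q \<noteq> 0" "(\<Sum>k<m. x k) = of_int p / of_int q"
    "\<bar>p\<bar> < 2 ^ (m * (b + 1))" "\<bar>q\<bar> \<le> 2 ^ (m * b)" by blast
  then have "\<bar>q\<bar> < 2 ^ (m * b + 1)" by simp
  with p have "real_bits (\<Sum>k<m. x k) \<le> m * (b + 1) + (m * b + 1)" by (intro real_bits_le)
  then show ?thesis by (simp add: algebra_simps)
qed

lemma size_model_rat: "size_model real_bits \<rat>"
proof
  show "real_bits (real n) \<le> nat_bits n + 1" for n
    by (rule real_bits_le[of 1 _ "int n"]) (auto simp: nat_bits_less simp flip: of_nat_power)
  show "real_bits (\<Sum>k<m. f k) \<le> (m + 1) * (2 * b + 2)"
    if "\<And>k. k < m \<Longrightarrow> f k \<in> \<rat> \<and> real_bits (f k) \<le> b" for m f b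
    using that by (rule real_bits_sum)
qed (fact real_bits_ops | simp)+

section \<open>Cost bounds read off the syntax of expressions\<close>

fun nnames :: "nexp \<Rightarrow> string set" where
  "nnames (NConst k) = {}"
| "nnames (NRead x es) = insert x (\<Union>(set (map nnames es)))"
| "nnames (NAdd a b) = nnames a \<union> nnames b"
| "nnames (NSub a b) = nnames a \<union> nnames b"
| "nnames (NMul a b) = nnames a \<union> nnames b"

fun rnames :: "rexp \<Rightarrow> string set" where
  "rnames (ROfNat e) = nnames e"
| "rnames (RRead x es) = insert x (\<Union>(set (map nnames es)))"
| "rnames (RAdd a b) = rnames a \<union> rnames b"
| "rnames (RSub a b) = rnames a \<union> rnames b"
| "rnames (RMul a b) = rnames a \<union> rnames b"
| "rnames (RDiv a b) = rnames a \<union> rnames b"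

fun bnames :: "bexp \<Rightarrow> string set" where
  "bnames (NLess a b) = nnames a \<union> nnames b"
| "bnames (RLess a b) = rnames a \<union> rnames b"
| "bnames (BNot b) = bnames b"
| "bnames (BAnd a b) = bnames a \<union> bnames b"

text \<open>If all registers an expression mentions have size at most B, this factor times B + 1
  bounds both the size of its value and its cost. It depends on the program alone and so disappears
  into the constants of the polynomial.\<close>

fun nfac :: "nexp \<Rightarrow> nat" where
  "nfac (NConst k) = 1 + nat_bits k"
| "nfac (NRead x es) = 2 + sum_list (map nfac es)"
| "nfac (NAdd a b) = 2 * (nfac a + nfac b) + 2"
| "nfac (NSub a b) = 2 * (nfac a + nfac b) + 2"
| "nfac (NMul a b) = 2 * (nfac a + nfac b) + 2"

fun rfac :: "rexp \<Rightarrow> nat" where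
  "rfac (ROfNat e) = 2 * nfac e + 2"
| "rfac (RRead x es) = 2 + sum_list (map nfac es)"
| "rfac (RAdd a b) = 5 * (rfac a + rfac b) + 5"
| "rfac (RSub a b) = 5 * (rfac a + rfac b) + 5"
| "rfac (RMul a b) = 5 * (rfac a + rfac b) + 5"
| "rfac (RDiv a b) = 5 * (rfac a + rfac b) + 5"

fun bfac :: "bexp \<Rightarrow> nat" where
  "bfac (NLess a b) = 1 + nfac a + nfac b"
| "bfac (RLess a b) = 1 + rfac a + rfac b"
| "bfac (BNot b) = 1 + bfac b"
| "bfac (BAnd a b) = 1 + bfac a + bfac b"

text \<open>Uniform over all index lists, so that bounding an array access does not require knowing
  its address.\<close>

definition bnd :: "(real \<Rightarrow> nat) \<Rightarrow> real set \<Rightarrow> string set \<Rightarrow> nat \<Rightarrow> store \<Rightarrow> bool" where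
  "bnd sz X N B s \<longleftrightarrow> (\<forall>x\<in>N. \<forall>is. nat_bits (nreg s x is) \<le> B \<and> rreg s x is \<in> X \<and> sz (rreg s x is) \<le> B)"

lemma bnd_subset: "bnd sz X N B s \<Longrightarrow> M \<subseteq> N \<Longrightarrow> bnd sz X M B s"
  by (auto simp: bnd_def)

lemma sum_list_ncost_le:
  assumes "\<And>e. e \<in> set es \<Longrightarrow> ncost s e \<le> nfac e * (B + 1)"
  shows "sum_list (map (ncost s) es) \<le> sum_list (map nfac es) * (B + 1)"
  using assms
proof (induction es)
  case (Cons e es)
  then have "ncost s e \<le> nfac e * (B + 1)" "sum_list (map (ncost s) es) \<le> sum_list (map nfac es) * (B + 1)"
    by simp_all
  then show ?case by (simp add: algebra_simps)
qed simp

lemma nexp_bound: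
  "bnd sz X (nnames e) B s \<Longrightarrow> nat_bits (nval s e) \<le> nfac e * (B + 1) \<and> ncost s e \<le> nfac e * (B + 1)"
proof (induction e)
  case (NRead x es)
  have "ncost s e \<le> nfac e * (B + 1)" if "e \<in> set es" for e
    using NRead.IH[OF that] bnd_subset[OF NRead.prems] that by fastforce
  then have "sum_list (map (ncost s) es) \<le> sum_list (map nfac es) * (B + 1)" by (rule sum_list_ncost_le)
  moreover have "nat_bits (nval s (NRead x es)) \<le> B" using NRead.prems by (simp add: bnd_def)
  ultimately show ?case by simp
next
  case (NAdd a b)
  then have "bnd sz X (nnames a) B s" "bnd sz X (nnames b) B s" by (auto elim: bnd_subset)
  with NAdd.IH nat_bits_add[of "nval s a" "nval s b"] show ?case by (simp add: algebra_simps)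
next
  case (NSub a b)
  then have "bnd sz X (nnames a) B s" "bnd sz X (nnames b) B s" by (auto elim: bnd_subset)
  with NSub.IH nat_bits_mono[of "nval s a - nval s b" "nval s a"] show ?case by (simp add: algebra_simps)
next
  case (NMul a b)
  then have "bnd sz X (nnames a) B s" "bnd sz X (nnames b) B s" by (auto elim: bnd_subset)
  with NMul.IH nat_bits_mult[of "nval s a" "nval s b"] show ?case by (simp add: algebra_simps)
qed simp

lemma nexps_bound:
  assumes "bnd sz X (\<Union>(set (map nnames es))) B s"
  shows "sum_list (map (ncost s) es) \<le> sum_list (map nfac es) * (B + 1)"
proof (rule sum_list_ncost_le)
  fix e assume "e \<in> set es"
  then have "bnd sz X (nnames e) B s" by (intro bnd_subset[OF assms]) auto
  then show "ncost s e \<le> nfac e * (B + 1)" using nexp_bound by blast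
qed

lemma rexp_bound:
  assumes "size_model sz X"
  shows "bnd sz X (rnames e) B s \<Longrightarrow>
    rval s e \<in> X \<and> sz (rval s e) \<le> rfac e * (B + 1) \<and> rcost sz s e \<le> rfac e * (B + 1)"
proof (induction e)
  case (ROfNat e)
  then have "nat_bits (nval s e) \<le> nfac e * (B + 1)" "ncost s e \<le> nfac e * (B + 1)"
    using nexp_bound by simp_all
  moreover have "real (nval s e) \<in> X" "sz (real (nval s e)) \<le> nat_bits (nval s e) + 1"
    using size_model.of_nat_in[OF assms] size_model.of_nat_size[OF assms] by auto
  ultimately show ?case by simp
next
  case (RRead x es)
  then have "sum_list (map (ncost s) es) \<le> sum_list (map nfac es) * (B + 1)"
    by (intro nexps_bound[of sz X]) (auto elim: bnd_subset)
  moreover have "rval s (RRead x es) \<in> X" "sz (rval s (RRead x es)) \<le> B"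
    using RRead by (simp_all add: bnd_def)
  ultimately show ?case by simp
next
  case (RAdd a b)
  then have "bnd sz X (rnames a) B s" "bnd sz X (rnames b) B s" by (auto elim: bnd_subset)
  note IH = RAdd.IH(1)[OF this(1)] RAdd.IH(2)[OF this(2)]
  have "sz (rval s (RAdd a b)) \<le> 4 * (sz (rval s a) + sz (rval s b)) + 4" "rval s (RAdd a b) \<in> X"
    using IH size_model.add_size[OF assms] size_model.add_in[OF assms] by auto
  with IH show ?case by (simp add: algebra_simps)
next
  case (RSub a b)
  then have "bnd sz X (rnames a) B s" "bnd sz X (rnames b) B s" by (auto elim: bnd_subset)
  note IH = RSub.IH(1)[OF this(1)] RSub.IH(2)[OF this(2)]
  have "sz (rval s (RSub a b)) \<le> 4 * (sz (rval s a) + sz (rval s b)) + 4" "rval s (RSub a b) \<in> X"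
    using IH size_model.diff_size[OF assms] size_model.diff_in[OF assms] by auto
  with IH show ?case by (simp add: algebra_simps)
next
  case (RMul a b)
  then have "bnd sz X (rnames a) B s" "bnd sz X (rnames b) B s" by (auto elim: bnd_subset)
  note IH = RMul.IH(1)[OF this(1)] RMul.IH(2)[OF this(2)]
  have "sz (rval s (RMul a b)) \<le> 4 * (sz (rval s a) + sz (rval s b)) + 4" "rval s (RMul a b) \<in> X"
    using IH size_model.mult_size[OF assms] size_model.mult_in[OF assms] by auto
  with IH show ?case by (simp add: algebra_simps)
next
  case (RDiv a b)
  then have "bnd sz X (rnames a) B s" "bnd sz X (rnames b) B s" by (auto elim: bnd_subset)
  note IH = RDiv.IH(1)[OF this(1)] RDiv.IH(2)[OF this(2)]
  have "sz (rval s (RDiv a b)) \<le> 4 * (sz (rval s a) + sz (rval s b)) + 4" "rval s (RDiv a b) \<in> X"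
    using IH size_model.div_size[OF assms] size_model.div_in[OF assms] by auto
  with IH show ?case by (simp add: algebra_simps)
qed

lemma bexp_bound:
  assumes "size_model sz X"
  shows "bnd sz X (bnames e) B s \<Longrightarrow> bcost sz s e \<le> bfac e * (B + 1)"
proof (induction e)
  case (NLess a b)
  then have "bnd sz X (nnames a) B s" "bnd sz X (nnames b) B s" by (auto elim: bnd_subset)
  with nexp_bound[of sz X a B s] nexp_bound[of sz X b B s] show ?case by (simp add: algebra_simps)
next
  case (RLess a b)
  then have "bnd sz X (rnames a) B s" "bnd sz X (rnames b) B s" by (auto elim: bnd_subset)
  with rexp_bound[OF assms, of a B s] rexp_bound[OF assms, of b B s] show ?case by (simp add: algebra_simps)
next
  case (BAnd a b)
  then have "bnd sz X (bnames a) B s" "bnd sz X (bnames b) B s" by (auto elim: bnd_subset)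
  with BAnd.IH show ?case by (simp add: algebra_simps)
qed simp

lemma nset_simps [simp]:
  "nreg (nset x is k s) y js = (if y = x \<and> js = is then k else nreg s y js)"
  "rreg (nset x is k s) = rreg s"
  by (auto simp: nset_def)

lemma rset_simps [simp]:
  "rreg (rset x is r s) y js = (if y = x \<and> js = is then r else rreg s y js)"
  "nreg (rset x is r s) = nreg s"
  by (auto simp: rset_def)

section \<open>Dependence on registers, and counting loops\<close>

definition agree :: "string set \<Rightarrow> store \<Rightarrow> store \<Rightarrow> bool" where
  "agree N s s' \<longleftrightarrow> (\<forall>x\<in>N. \<forall>is. nreg s x is = nreg s' x is \<and> rreg s x is = rreg s' x is)"

lemma agree_subset: "agree N s s' \<Longrightarrow> M \<subseteq> N \<Longrightarrow> agree M s s'"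
  by (auto simp: agree_def)

lemma nval_agree: "agree (nnames e) s s' \<Longrightarrow> nval s e = nval s' e"
proof (induction e)
  case (NRead x es)
  have "nval s e = nval s' e" if "e \<in> set es" for e
    using NRead.IH[OF that] agree_subset[OF NRead.prems] that by fastforce
  then have "map (nval s) es = map (nval s') es" by simp
  moreover have "nreg s x is = nreg s' x is" for "is" using NRead.prems by (simp add: agree_def)
  ultimately show ?case by (simp only: nval.simps)
qed (simp_all add: agree_def)

lemma nvals_agree: "agree (\<Union>(set (map nnames es))) s s' \<Longrightarrow> map (nval s) es = map (nval s') es"
  by (simp, intro ballI nval_agree) (auto elim: agree_subset)

lemma rval_agree: "agree (rnames e) s s' \<Longrightarrow> rval s e = rval s' e"
proof (induction e)
  case (RRead x es)
  have "map (nval s) es = map (nval s') es"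
    using RRead.prems by (intro nvals_agree) (auto elim: agree_subset)
  moreover have "rreg s x is = rreg s' x is" for "is" using RRead.prems by (simp add: agree_def)
  ultimately show ?case by (simp only: rval.simps)
next
  case (ROfNat e)
  then show ?case using nval_agree[of e s s'] by simp
qed (simp_all add: agree_def)

lemma bval_agree: "agree (bnames e) s s' \<Longrightarrow> bval s e = bval s' e"
proof (induction e)
  case (NLess a b)
  then show ?case using nval_agree[of a s s'] nval_agree[of b s s'] by (simp add: agree_def)
next
  case (RLess a b)
  then show ?case using rval_agree[of a s s'] rval_agree[of b s s'] by (simp add: agree_def)
qed (simp_all add: agree_def)

definition for_loop :: "string \<Rightarrow> com \<Rightarrow> com" where
  "for_loop v c = Seq (NAssign v [] (NConst 0))
     (While (NLess (NRead v []) (NRead ''n'' [])) (Seq c (NAssign v [] (NAdd (NRead v []) (NConst 1)))))"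

text \<open>The invariant is stated for stores whose counter is already advanced, so one predicate
  serves before, between and after the rounds. The body has to restore only the counter and
  \<open>n\<close>. Counters up to \<open>n\<close> have at most \<open>n\<close> bits, which is
  crude but polynomial.\<close>

lemma exec_for_loop:
  fixes Inv :: "nat \<Rightarrow> store \<Rightarrow> bool"
  assumes v: "v \<noteq> ''n''" and n: "nreg s ''n'' [] = n" and init: "Inv 0 (nset v [] 0 s)"
    and step: "\<And>k s. k < n \<Longrightarrow> Inv k s \<Longrightarrow> nreg s v [] = k \<Longrightarrow> nreg s ''n'' [] = n \<Longrightarrow>
      \<exists>t s'. exec sz c s t s' \<and> t \<le> T \<and> nreg s' v [] = k \<and> nreg s' ''n'' [] = n \<and> Inv (Suc k) (nset v [] (Suc k) s')"
  shows "\<exists>t s'. exec sz (for_loop v c) s t s' \<and> t \<le> (n + 1) * (T + 4 * n + 20) \<and> Inv n s' \<and> nreg s' ''n'' [] = n"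
proof -
  let ?b = "NLess (NRead v []) (NRead ''n'' [])"
  let ?d = "Seq c (NAssign v [] (NAdd (NRead v []) (NConst 1)))"
  have loop: "\<exists>t s'. exec sz (While ?b ?d) s t s' \<and> t \<le> m * (T + 4 * n + 10) + 2 * n + 4 \<and> Inv n s' \<and> nreg s' ''n'' [] = n"
    if "k + m = n" "Inv k s" "nreg s v [] = k" "nreg s ''n'' [] = n" for m k s
    using that
  proof (induction m arbitrary: k s)
    case 0
    have "exec sz (While ?b ?d) s (1 + bcost sz s ?b) s" using 0 by (intro exec.WhileFalse) simp
    moreover have "1 + bcost sz s ?b \<le> 0 * (T + 4 * n + 10) + 2 * n + 4" "Inv n s"
      using 0 nat_bits_le_self[of n] by simp_all
    ultimately show ?case using 0(4) by blast
  next
    case (Suc m)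
    then have kn: "k < n" by simp
    obtain t s' where s': "exec sz c s t s'" "t \<le> T" "nreg s' v [] = k" "nreg s' ''n'' [] = n"
      "Inv (Suc k) (nset v [] (Suc k) s')"
      using step[OF kn Suc.prems(2,3,4)] by blast
    let ?s = "nset v [] (Suc k) s'"
    obtain t' s'' where s'': "exec sz (While ?b ?d) ?s t' s''" "t' \<le> m * (T + 4 * n + 10) + 2 * n + 4"
      "Inv n s''" "nreg s'' ''n'' [] = n"
      using Suc.IH[of "Suc k" ?s] Suc.prems s' v by auto
    let ?a = "NAdd (NRead v []) (NConst 1)"
    have "exec sz (NAssign v [] ?a) s' (1 + sum_list (map (ncost s') []) + ncost s' ?a)
        (nset v (map (nval s') []) (nval s' ?a) s')" by (rule exec.NAssign)
    then have "exec sz (NAssign v [] ?a) s' (1 + ncost s' ?a) ?s" using s' by simp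
    then have "exec sz ?d s (1 + t + (1 + ncost s' ?a)) ?s" using s' by (intro exec.Seq)
    then have "exec sz (While ?b ?d) s (1 + bcost sz s ?b + (1 + t + (1 + ncost s' ?a)) + t') s''"
      using s'' kn Suc.prems by (intro exec.WhileTrue) auto
    moreover have "nat_bits k \<le> n" "nat_bits (Suc k) \<le> n" "nat_bits n \<le> n"
      using nat_bits_le_self[of k] nat_bits_le_self[of "Suc k"] nat_bits_le_self[of n] kn by simp_all
    then have "1 + bcost sz s ?b + (1 + t + (1 + ncost s' ?a)) + t' \<le> Suc m * (T + 4 * n + 10) + 2 * n + 4"
      using s' s'' Suc.prems by simp
    ultimately show ?case using s'' by blast
  qed
  let ?s0 = "nset v [] 0 s"
  obtain t s' where s': "exec sz (While ?b ?d) ?s0 t s'" "t \<le> n * (T + 4 * n + 10) + 2 * n + 4"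
    "Inv n s'" "nreg s' ''n'' [] = n"
    using loop[of 0 n ?s0] init n v by auto
  have "exec sz (NAssign v [] (NConst 0)) s 2 ?s0"
    using exec.NAssign[of sz v "[]" "NConst 0" s] by (simp add: numeral_2_eq_2)
  then have "exec sz (for_loop v c) s (1 + 2 + t) s'"
    unfolding for_loop_def using s'(1) by (rule exec.Seq)
  moreover have "1 + 2 + t \<le> (n + 1) * (T + 4 * n + 20)" using s' by (simp add: algebra_simps)
  ultimately show ?thesis using s' by blast
qed

section \<open>Programs that fill arrays\<close>

text \<open>Two shapes suffice: a real matrix whose entries are sums over \<open>k\<close>, and an
  array of natural numbers defined by a case distinction.\<close>

datatype stage =
    SumS string rexp
  | NatS string "nexp list" bexp nexp nexp

abbreviation "ni \<equiv> NRead ''i'' []"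
abbreviation "nj \<equiv> NRead ''j'' []"
abbreviation "nk \<equiv> NRead ''k'' []"

fun stage_cell :: "stage \<Rightarrow> com" where
  "stage_cell (SumS A e) = Seq (RAssign ''acc'' [] (ROfNat (NConst 0)))
     (Seq (for_loop ''k'' (RAssign ''acc'' [] (RAdd (RRead ''acc'' []) e)))
       (RAssign A [ni, nj] (RRead ''acc'' [])))"
| "stage_cell (NatS A es b e1 e2) = Cond b (NAssign A es e1) (NAssign A es e2)"

definition stage_com :: "stage \<Rightarrow> com" where
  "stage_com st = for_loop ''i'' (for_loop ''j'' (stage_cell st))"

fun target :: "stage \<Rightarrow> string" where
  "target (SumS A e) = A"
| "target (NatS A es b e1 e2) = A"

fun written :: "stage \<Rightarrow> string set" where
  "written (SumS A e) = {A, ''acc''}"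
| "written (NatS A es b e1 e2) = {A}"

fun reads :: "stage \<Rightarrow> string set" where
  "reads (SumS A e) = rnames e"
| "reads (NatS A es b e1 e2) = bnames b \<union> nnames e1 \<union> nnames e2"

fun stage_fac :: "stage \<Rightarrow> nat" where
  "stage_fac (SumS A e) = 8 * rfac e + 8"
| "stage_fac (NatS A es b e1 e2) = 2 * (bfac b + nfac e1 + nfac e2) + 8"

text \<open>No loop over \<open>k\<close> surrounds a \<open>NatS\<close> cell. A one-dimensional
  target is rewritten for every \<open>j\<close>, so its value must not depend on
  \<open>j\<close>.\<close>

fun index_ok :: "stage \<Rightarrow> bool" where
  "index_ok (SumS A e) \<longleftrightarrow> True"
| "index_ok (NatS A es b e1 e2) \<longleftrightarrow> ''k'' \<notin> bnames b \<union> nnames e1 \<union> nnames e2 \<and>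
     (es = [ni, nj] \<or> es = [ni] \<and> ''j'' \<notin> bnames b \<union> nnames e1 \<union> nnames e2)"

definition wf_stage :: "stage \<Rightarrow> bool" where
  "wf_stage st \<longleftrightarrow> target st \<notin> {''i'', ''j'', ''k'', ''n'', ''acc''} \<and>
     reads st \<inter> {target st, ''acc''} = {} \<and> index_ok st"

text \<open>The store in which an entry is specified: counters fixed, everything else as before the
  stage. For \<open>NatS\<close> the value 0 of \<open>k\<close> is a dummy.\<close>

definition cell_at :: "nat \<Rightarrow> nat \<Rightarrow> nat \<Rightarrow> store \<Rightarrow> store" where
  "cell_at i j k s = nset ''i'' [] i (nset ''j'' [] j (nset ''k'' [] k s))"

fun cell_done :: "nat \<Rightarrow> stage \<Rightarrow> store \<Rightarrow> store \<Rightarrow> nat \<Rightarrow> nat \<Rightarrow> bool" where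
  "cell_done n (SumS A e) s\<^sub>0 s i j \<longleftrightarrow> rreg s A [i, j] = (\<Sum>k<n. rval (cell_at i j k s\<^sub>0) e)"
| "cell_done n (NatS A es b e1 e2) s\<^sub>0 s i j \<longleftrightarrow> nreg s A (map (nval (cell_at i j 0 s\<^sub>0)) es) =
     (if bval (cell_at i j 0 s\<^sub>0) b then nval (cell_at i j 0 s\<^sub>0) e1 else nval (cell_at i j 0 s\<^sub>0) e2)"

definition frame :: "string set \<Rightarrow> store \<Rightarrow> store \<Rightarrow> bool" where
  "frame N s\<^sub>0 s \<longleftrightarrow> (\<forall>x is. x \<notin> N \<longrightarrow> rreg s x is = rreg s\<^sub>0 x is \<and>
     (is \<noteq> [] \<or> x \<notin> {''i'', ''j'', ''k''} \<longrightarrow> nreg s x is = nreg s\<^sub>0 x is))"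

lemma frame_agree:
  assumes "frame N s\<^sub>0 s" "M \<inter> N = {}" "nreg s ''i'' [] = i" "nreg s ''j'' [] = j"
    "''k'' \<in> M \<Longrightarrow> nreg s ''k'' [] = k"
  shows "agree M s (cell_at i j k s\<^sub>0)"
  unfolding agree_def
proof (intro ballI allI)
  fix x "is" assume "x \<in> M"
  then have "x \<notin> N" using assms(2) by blast
  then show "nreg s x is = nreg (cell_at i j k s\<^sub>0) x is \<and> rreg s x is = rreg (cell_at i j k s\<^sub>0) x is"
    using assms(1,3,4,5) \<open>x \<in> M\<close> by (cases "is = []") (auto simp: frame_def cell_at_def)
qed

lemma frame_at:
  assumes "frame N s\<^sub>0 s" "M \<inter> N = {}"
  shows "agree M (cell_at i j k s) (cell_at i j k s\<^sub>0)"
  unfolding agree_def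
proof (intro ballI allI)
  fix x "is" assume "x \<in> M"
  then have "x \<notin> N" using assms(2) by blast
  then show "nreg (cell_at i j k s) x is = nreg (cell_at i j k s\<^sub>0) x is \<and> rreg (cell_at i j k s) x is = rreg (cell_at i j k s\<^sub>0) x is"
    using assms(1) by (cases "is = []") (auto simp: frame_def cell_at_def)
qed

lemma bnd_agree: "agree N s s' \<Longrightarrow> bnd sz X N B s' \<Longrightarrow> bnd sz X N B s"
  by (simp add: agree_def bnd_def)

lemma bnd_at:
  assumes "bnd sz X UNIV B s" "i \<le> B" "j \<le> B" "k \<le> B"
  shows "bnd sz X UNIV B (cell_at i j k s)"
  using assms nat_bits_le_self[of i] nat_bits_le_self[of j] nat_bits_le_self[of k]
  by (auto simp: bnd_def cell_at_def)

lemma frame_nset: "frame N s\<^sub>0 s \<Longrightarrow> v \<in> {''i'', ''j'', ''k''} \<Longrightarrow> frame N s\<^sub>0 (nset v [] l s)"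
  by (auto simp: frame_def)

lemma bnd_nset: "bnd sz X UNIV D s \<Longrightarrow> nat_bits l \<le> D \<Longrightarrow> bnd sz X UNIV D (nset v is l s)"
  by (simp add: bnd_def)

lemma bnd_rset: "bnd sz X UNIV D s \<Longrightarrow> r \<in> X \<Longrightarrow> sz r \<le> D \<Longrightarrow> bnd sz X UNIV D (rset v is r s)"
  by (simp add: bnd_def)

lemma sum_in:
  fixes m :: nat
  assumes "size_model sz X" "\<And>k. k < m \<Longrightarrow> f k \<in> X"
  shows "(\<Sum>k<m. f k) \<in> X"
  using assms(2)
proof (induction m)
  case 0
  show ?case using size_model.of_nat_in[OF assms(1), of 0] by simp
next
  case (Suc m)
  then show ?case using size_model.add_in[OF assms(1)] by simp
qed

text \<open>Partial sums are bounded by the size rule for whole sums, with at most B terms of size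
  linear in B. Sizes therefore grow from B to a multiple of B^2 only.\<close>

lemma sum_cell:
  assumes model: "size_model sz X" and wf: "wf_stage (SumS A e)"
    and s0: "nreg s\<^sub>0 ''n'' [] = n" "n \<le> B" "1 \<le> B" "bnd sz X UNIV B s\<^sub>0"
    and D: "D = stage_fac (SumS A e) * B\<^sup>2"
    and s: "frame {A, ''acc''} s\<^sub>0 s" "bnd sz X UNIV D s" "nreg s ''i'' [] = i" "nreg s ''j'' [] = j" "i < n" "j < n"
  shows "\<exists>t s'. exec sz (stage_cell (SumS A e)) s t s' \<and> t \<le> 100 * D\<^sup>2 \<and> frame {A, ''acc''} s\<^sub>0 s' \<and>
    bnd sz X UNIV D s' \<and> nreg s' ''i'' [] = i \<and> nreg s' ''j'' [] = j \<and>
    rreg s' A = (rreg s A)([i, j] := (\<Sum>k<n. rval (cell_at i j k s\<^sub>0) e))"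
proof -
  let ?c = "rfac e"
  have names: "A \<notin> {''i'', ''j'', ''k'', ''n'', ''acc''}" "rnames e \<inter> {A, ''acc''} = {}"
    using wf by (auto simp: wf_stage_def)
  have BB: "B \<le> B\<^sup>2" using s0 by (simp add: power2_eq_square)
  have D1: "?c * (B + 1) \<le> D"
  proof -
    have "?c * (B + 1) \<le> ?c * (2 * B\<^sup>2)" using s0 BB by (intro mult_left_mono) auto
    also have "\<dots> \<le> D" unfolding D by (simp add: algebra_simps)
    finally show ?thesis .
  qed
  have D2: "(n + 1) * (2 * (?c * (B + 1)) + 2) \<le> D"
  proof -
    have "(n + 1) * (2 * (?c * (B + 1)) + 2) \<le> (2 * B) * (2 * (?c * (2 * B)) + 2 * B)"
      using s0 by (intro mult_mono add_mono mult_left_mono) auto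
    also have "\<dots> = (8 * ?c + 4) * B\<^sup>2" by (simp add: power2_eq_square algebra_simps)
    also have "\<dots> \<le> D" unfolding D by (intro mult_right_mono) auto
    finally show ?thesis .
  qed
  have D3: "B \<le> D" "1 \<le> D" unfolding D using s0 BB by (auto simp: algebra_simps intro: order_trans)
  define f where "f k = rval (cell_at i j k s\<^sub>0) e" for k
  have ag: "agree (rnames e) s' (cell_at i j k s\<^sub>0)"
    if "frame {A, ''acc''} s\<^sub>0 s'" "nreg s' ''i'' [] = i" "nreg s' ''j'' [] = j" "nreg s' ''k'' [] = k" for s' k
    using that names by (intro frame_agree) auto
  have bat: "bnd sz X (rnames e) B (cell_at i j k s\<^sub>0)" if "k \<le> n" for k
    using bnd_subset[OF bnd_at[OF s0(4)], of i j k] that s s0 by auto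
  have f: "f k \<in> X" "sz (f k) \<le> ?c * (B + 1)" if "k < n" for k
    unfolding f_def using rexp_bound[OF model bat] that by auto
  have fs: "(\<Sum>k<m. f k) \<in> X" "sz (\<Sum>k<m. f k) \<le> D" if "m \<le> n" for m
  proof -
    show "(\<Sum>k<m. f k) \<in> X" using f that by (intro sum_in[OF model]) auto
    have "sz (\<Sum>k<m. f k) \<le> (m + 1) * (2 * (?c * (B + 1)) + 2)"
      using f that by (intro size_model.sum_size[OF model]) auto
    also have "\<dots> \<le> (n + 1) * (2 * (?c * (B + 1)) + 2)" using that by (intro mult_right_mono) auto
    finally show "sz (\<Sum>k<m. f k) \<le> D" using D2 by simp
  qed
  have s_n: "nreg s ''n'' [] = n" 
    using s(1)[unfolded frame_def, rule_format, of "''n''" "[]"] s0(1) names by auto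
  define s1 where "s1 = rset ''acc'' [] 0 s"
  have e1: "exec sz (RAssign ''acc'' [] (ROfNat (NConst 0))) s (3 + sz 0) s1"
    using exec.RAssign[of sz "''acc''" "[]" "ROfNat (NConst 0)" s] by (simp add: s1_def numeral_3_eq_3)
  have sz0: "sz 0 \<le> 1" using size_model.of_nat_size[OF model, of 0] by simp
  define Inv where "Inv k s' \<longleftrightarrow> frame {A, ''acc''} s\<^sub>0 s' \<and> bnd sz X UNIV D s' \<and> nreg s' ''i'' [] = i \<and>
     nreg s' ''j'' [] = j \<and> rreg s' ''acc'' [] = (\<Sum>k<k. f k) \<and> rreg s' A = rreg s A" for k s'
  let ?b = "RAssign ''acc'' [] (RAdd (RRead ''acc'' []) e)"
  obtain t s2 where s2: "exec sz (for_loop ''k'' ?b) s1 t s2" "t \<le> (n + 1) * ((3 + 3 * D) + 4 * n + 20)"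
    "Inv n s2" "nreg s2 ''n'' [] = n"
  proof -
    have "Inv 0 (nset ''k'' [] 0 s1)"
      unfolding Inv_def s1_def using s names fs[of 0]
      by (auto simp: frame_def intro!: bnd_nset bnd_rset)
    moreover have "\<exists>t s''. exec sz ?b s' t s'' \<and> t \<le> 3 + 3 * D \<and> nreg s'' ''k'' [] = k \<and> nreg s'' ''n'' [] = n \<and>
        Inv (Suc k) (nset ''k'' [] (Suc k) s'')"
      if k: "k < n" "Inv k s'" "nreg s' ''k'' [] = k" "nreg s' ''n'' [] = n" for k s'
    proof -
      have ag': "agree (rnames e) s' (cell_at i j k s\<^sub>0)" using k by (intro ag) (auto simp: Inv_def)
      have val: "rval s' e = f k" unfolding f_def using ag' by (rule rval_agree)
      have "bnd sz X (rnames e) B s'" using ag' bat[of k] k by (auto intro: bnd_agree)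
      then have cost: "rcost sz s' e \<le> D" using rexp_bound[OF model] D1 order_trans by blast
      have acc: "rreg s' ''acc'' [] = (\<Sum>k<k. f k)" using k by (simp add: Inv_def)
      have new: "rval s' (RAdd (RRead ''acc'' []) e) = (\<Sum>k<Suc k. f k)" using acc val by simp
      let ?s = "rset ''acc'' [] (\<Sum>k<Suc k. f k) s'"
      have "exec sz ?b s' (1 + rcost sz s' (RAdd (RRead ''acc'' []) e)) ?s"
        using exec.RAssign[of sz "''acc''" "[]" "RAdd (RRead ''acc'' []) e" s'] new by simp
      moreover have "1 + rcost sz s' (RAdd (RRead ''acc'' []) e) \<le> 3 + 3 * D"
        using cost fs(2)[of k] fs(2)[of "Suc k"] k acc val by simp
      moreover have "nat_bits (Suc k) \<le> D"
        using nat_bits_le_self[of "Suc k"] k(1) s0(2) D3(1) by linarith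
      then have "Inv (Suc k) (nset ''k'' [] (Suc k) ?s)"
        using k fs[of "Suc k"] names unfolding Inv_def
        by (auto simp: frame_def intro!: bnd_nset bnd_rset)
      ultimately show ?thesis using k by (intro exI[of _ "1 + rcost sz s' (RAdd (RRead ''acc'' []) e)"] exI[of _ ?s]) auto
    qed
    moreover have "nreg s1 ''n'' [] = n" by (simp add: s1_def s_n)
    ultimately show ?thesis using that exec_for_loop[of "''k''" s1 n Inv sz ?b "3 + 3 * D"] by auto
  qed
  let ?r = "\<Sum>k<n. f k"
  let ?s3 = "rset A [i, j] ?r s2"
  have i2: "nreg s2 ''i'' [] = i" "nreg s2 ''j'' [] = j" "rreg s2 ''acc'' [] = ?r" "rreg s2 A = rreg s A"
    "frame {A, ''acc''} s\<^sub>0 s2" "bnd sz X UNIV D s2"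
    using s2(3) by (auto simp: Inv_def)
  let ?t3 = "1 + (ncost s2 ni + ncost s2 nj) + (1 + sz ?r)"
  have e3: "exec sz (RAssign A [ni, nj] (RRead ''acc'' [])) s2 ?t3 ?s3"
    using exec.RAssign[of sz A "[ni, nj]" "RRead ''acc'' []" s2] i2 by (simp add: add.assoc)
  have "exec sz (stage_cell (SumS A e)) s (1 + (3 + sz 0) + (1 + t + ?t3)) ?s3"
    unfolding stage_cell.simps by (intro exec.Seq[OF e1] exec.Seq[OF s2(1) e3])
  moreover have "1 + (3 + sz 0) + (1 + t + ?t3) \<le> 100 * D\<^sup>2"
  proof -
    have "nat_bits i \<le> D" "nat_bits j \<le> D" "n \<le> D"
      using nat_bits_le_self[of i] nat_bits_le_self[of j] s(5,6) s0(2) D3 by auto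
    then have "1 + (3 + sz 0) + (1 + t + ?t3) \<le> 10 + 3 * D + t"
      using sz0 fs(2)[of n] i2 by simp
    also have "t \<le> (2 * D) * (30 * D)"
      using \<open>n \<le> D\<close> D3(2) by (intro order_trans[OF s2(2)] mult_mono) auto
    also have "10 + 3 * D + (2 * D) * (30 * D) \<le> 13 * D + 60 * D\<^sup>2" using D3(2) by (simp add: power2_eq_square)
    also have "\<dots> \<le> 13 * D\<^sup>2 + 60 * D\<^sup>2" using D3(2) by (simp add: power2_eq_square)
    finally show ?thesis by simp
  qed
  moreover have "frame {A, ''acc''} s\<^sub>0 ?s3" using i2 by (auto simp: frame_def)
  moreover have "bnd sz X UNIV D ?s3" using i2 fs[of n] by (auto intro: bnd_rset)
  moreover have "rreg ?s3 A = (rreg s A)([i, j] := ?r)" using i2 by auto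
  ultimately show ?thesis
    using i2 by (intro exI[of _ "1 + (3 + sz 0) + (1 + t + ?t3)"] exI[of _ ?s3]) (auto simp: f_def)
qed

lemma nat_cell:
  assumes model: "size_model sz X" and wf: "wf_stage (NatS A es b e1 e2)"
    and s0: "n \<le> B" "1 \<le> B" "bnd sz X UNIV B s\<^sub>0"
    and D: "D = stage_fac (NatS A es b e1 e2) * B\<^sup>2"
    and s: "frame {A} s\<^sub>0 s" "bnd sz X UNIV D s" "nreg s ''i'' [] = i" "nreg s ''j'' [] = j" "i < n" "j < n"
  shows "\<exists>t s'. exec sz (stage_cell (NatS A es b e1 e2)) s t s' \<and> t \<le> 100 * D\<^sup>2 \<and> frame {A} s\<^sub>0 s' \<and>
    bnd sz X UNIV D s' \<and> nreg s' ''i'' [] = i \<and> nreg s' ''j'' [] = j \<and>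
    nreg s' A = (nreg s A)(map (nval (cell_at i j 0 s\<^sub>0)) es :=
       (if bval (cell_at i j 0 s\<^sub>0) b then nval (cell_at i j 0 s\<^sub>0) e1 else nval (cell_at i j 0 s\<^sub>0) e2))"
proof -
  have names: "A \<notin> {''i'', ''j'', ''k'', ''n'', ''acc''}" "(bnames b \<union> nnames e1 \<union> nnames e2) \<inter> {A} = {}"
    "''k'' \<notin> bnames b \<union> nnames e1 \<union> nnames e2" and es: "es = [ni, nj] \<or> es = [ni]"
    using wf by (auto simp: wf_stage_def)
  let ?a = "cell_at i j 0 s\<^sub>0"
  have ag: "agree (bnames b \<union> nnames e1 \<union> nnames e2) s ?a"
    using s names by (intro frame_agree) auto
  note ags = agree_subset[OF ag]
  have bs: "bnd sz X (bnames b \<union> nnames e1 \<union> nnames e2) B s"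
    using bnd_agree[OF ag] bnd_subset[OF bnd_at[OF s0(3)], of i j 0] s(5,6) s0(1) by auto
  note bss = bnd_subset[OF bs]
  define e where "e = (if bval s b then e1 else e2)"
  have be: "nat_bits (nval s e) \<le> nfac e * (B + 1) \<and> ncost s e \<le> nfac e * (B + 1)"
    unfolding e_def using nexp_bound[OF bss, of e1] nexp_bound[OF bss, of e2] by auto
  have BB: "B \<le> B\<^sup>2" using s0 by (simp add: power2_eq_square)
  have "nfac e \<le> nfac e1 + nfac e2" by (simp add: e_def)
  then have "nfac e + bfac b \<le> bfac b + nfac e1 + nfac e2" "B + 1 \<le> 2 * B\<^sup>2" using BB s0 by auto
  from mult_mono[OF this] BB
  have "(nfac e + bfac b) * (B + 1) + 8 * B \<le> (bfac b + nfac e1 + nfac e2) * (2 * B\<^sup>2) + 8 * B\<^sup>2" by simp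
  also have "\<dots> = D" by (simp add: D algebra_simps)
  finally have D1: "(nfac e + bfac b) * (B + 1) + 8 * B \<le> D" .
  let ?v = "nval s e" and ?is = "map (nval s) es"
  let ?s' = "nset A ?is ?v s"
  have E: "exec sz (NAssign A es e) s (1 + sum_list (map (ncost s) es) + ncost s e) ?s'" by (rule exec.NAssign)
  have "exec sz (stage_cell (NatS A es b e1 e2)) s (1 + bcost sz s b + (1 + sum_list (map (ncost s) es) + ncost s e)) ?s'"
  proof (cases "bval s b")
    case True
    then have "e = e1" by (simp add: e_def)
    from E show ?thesis unfolding \<open>e = e1\<close> stage_cell.simps by (rule exec.CondTrue[OF True])
  next
    case False
    then have "e = e2" by (simp add: e_def)
    from E show ?thesis unfolding \<open>e = e2\<close> stage_cell.simps by (rule exec.CondFalse[OF False])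
  qed
  moreover have "1 + bcost sz s b + (1 + sum_list (map (ncost s) es) + ncost s e) \<le> 100 * D\<^sup>2"
  proof -
    have "bcost sz s b \<le> bfac b * (B + 1)" using bexp_bound[OF model bss] by auto
    moreover have "sum_list (map (ncost s) es) \<le> 2 + 2 * B"
      using es s(3-6) s0(1) nat_bits_le_self[of i] nat_bits_le_self[of j] by auto
    ultimately have "1 + bcost sz s b + (1 + sum_list (map (ncost s) es) + ncost s e) \<le> D"
      using be D1 s0(2) by (simp add: algebra_simps)
    also have "D \<le> D\<^sup>2" by (simp add: power2_eq_square)
    finally show ?thesis by simp
  qed
  moreover have "frame {A} s\<^sub>0 ?s'" using s by (auto simp: frame_def)
  moreover have "bnd sz X UNIV D ?s'" using s be D1 by (intro bnd_nset) (auto simp: algebra_simps)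
  moreover have "nreg ?s' A = (nreg s A)(map (nval ?a) es := (if bval ?a b then nval ?a e1 else nval ?a e2))"
  proof -
    have 1: "?is = map (nval ?a) es" using es s by (auto simp: cell_at_def)
    have 2: "?v = (if bval ?a b then nval ?a e1 else nval ?a e2)"
      unfolding e_def using bval_agree[OF ags, of b] nval_agree[OF ags, of e1] nval_agree[OF ags, of e2] by auto
    have "nreg ?s' A = (nreg s A)(?is := ?v)" by auto
    then show ?thesis unfolding 1 2 .
  qed
  moreover have "nreg ?s' ''i'' [] = i" "nreg ?s' ''j'' [] = j" using s names by auto
  ultimately show ?thesis by blast
qed

lemma cell:
  assumes model: "size_model sz X" and wf: "wf_stage st"
    and s0: "nreg s\<^sub>0 ''n'' [] = n" "n \<le> B" "1 \<le> B" "bnd sz X UNIV B s\<^sub>0"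
    and D: "D = stage_fac st * B\<^sup>2"
    and s: "frame (written st) s\<^sub>0 s" "bnd sz X UNIV D s" "nreg s ''i'' [] = i" "nreg s ''j'' [] = j" "i < n" "j < n"
  shows "\<exists>t s'. exec sz (stage_cell st) s t s' \<and> t \<le> 100 * D\<^sup>2 \<and> frame (written st) s\<^sub>0 s' \<and>
    bnd sz X UNIV D s' \<and> nreg s' ''i'' [] = i \<and> nreg s' ''j'' [] = j \<and>
    cell_done n st s\<^sub>0 s' i j \<and> (\<forall>i' j'. cell_done n st s\<^sub>0 s i' j' \<longrightarrow> cell_done n st s\<^sub>0 s' i' j')"
proof (cases st)
  case (SumS A e)
  obtain t s' where s': "exec sz (stage_cell (SumS A e)) s t s'" "t \<le> 100 * D\<^sup>2" "frame {A, ''acc''} s\<^sub>0 s'"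
    "bnd sz X UNIV D s'" "nreg s' ''i'' [] = i" "nreg s' ''j'' [] = j"
    "rreg s' A = (rreg s A)([i, j] := (\<Sum>k<n. rval (cell_at i j k s\<^sub>0) e))"
    using sum_cell[OF model _ s0, of A e D s i j] wf D s SumS by auto
  have "cell_done n st s\<^sub>0 s' i' j'" if "cell_done n st s\<^sub>0 s i' j' \<or> i' = i \<and> j' = j" for i' j'
    using that s'(7) SumS by (cases "i' = i \<and> j' = j") auto
  with s' SumS show ?thesis by (intro exI[of _ t] exI[of _ s']) auto
next
  case (NatS A es b e1 e2)
  define v where "v i j = (if bval (cell_at i j 0 s\<^sub>0) b then nval (cell_at i j 0 s\<^sub>0) e1 else nval (cell_at i j 0 s\<^sub>0) e2)" for i j
  define x where "x i j = map (nval (cell_at i j 0 s\<^sub>0)) es" for i j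
  obtain t s' where s': "exec sz (stage_cell (NatS A es b e1 e2)) s t s'" "t \<le> 100 * D\<^sup>2" "frame {A} s\<^sub>0 s'"
    "bnd sz X UNIV D s'" "nreg s' ''i'' [] = i" "nreg s' ''j'' [] = j"
    "nreg s' A = (nreg s A)(x i j := v i j)"
    using nat_cell[OF model _ s0(2-4), of A es b e1 e2 D s i j] wf D s NatS by (auto simp: v_def x_def)
  \<comment> \<open>Cells with the same address receive the same value, so later writes do not
    destroy finished entries.\<close>
  have coll: "v i' j' = v i j" if "x i' j' = x i j" for i' j'
  proof (cases "es = [ni, nj]")
    case True
    then show ?thesis using that by (simp add: x_def cell_at_def)
  next
    case False
    then have es: "es = [ni]" "''j'' \<notin> bnames b \<union> nnames e1 \<union> nnames e2"
      using wf NatS by (auto simp: wf_stage_def)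
    then have "i' = i" using that by (simp add: x_def cell_at_def)
    then have ag: "agree (bnames b \<union> nnames e1 \<union> nnames e2) (cell_at i' j' 0 s\<^sub>0) (cell_at i j 0 s\<^sub>0)"
      using es(2) by (auto simp: agree_def cell_at_def)
    note ags = agree_subset[OF ag]
    show ?thesis unfolding v_def
      using bval_agree[OF ags, of b] nval_agree[OF ags, of e1] nval_agree[OF ags, of e2] by auto
  qed
  have cd: "cell_done n st s\<^sub>0 r i' j' \<longleftrightarrow> nreg r A (x i' j') = v i' j'" for r i' j'
    by (simp add: NatS x_def v_def)
  have "cell_done n st s\<^sub>0 s' i' j'" if "cell_done n st s\<^sub>0 s i' j' \<or> i' = i \<and> j' = j" for i' j'
    using that coll[of i' j'] unfolding cd s'(7) by auto
  with s' NatS show ?thesis by (intro exI[of _ t] exI[of _ s']) auto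
qed

text \<open>A cell takes 100 D^2 steps, and each of the two enclosing loops multiplies this by at
  most 2 D; the overheads are absorbed using \<open>n \<le> D\<close>.\<close>

lemma stage_run:
  assumes model: "size_model sz X" and wf: "wf_stage st"
    and s0: "nreg s\<^sub>0 ''n'' [] = n" "n \<le> B" "1 \<le> B" "bnd sz X UNIV B s\<^sub>0"
    and D: "D = stage_fac st * B\<^sup>2"
  shows "\<exists>t s'. exec sz (stage_com st) s\<^sub>0 t s' \<and> t \<le> 1000 * D ^ 4 \<and> frame (written st) s\<^sub>0 s' \<and>
    bnd sz X UNIV D s' \<and> nreg s' ''n'' [] = n \<and> (\<forall>i<n. \<forall>j<n. cell_done n st s\<^sub>0 s' i j)"
proof -
  let ?W = "written st"
  have fac: "8 \<le> stage_fac st" by (cases st) auto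
  have "B \<le> B\<^sup>2" using s0 by (simp add: power2_eq_square)
  also have "\<dots> \<le> D" unfolding D using fac by simp
  finally have BD: "B \<le> D" .
  then have D1: "1 \<le> D" "n \<le> D" using s0 by auto
  have W: "''i'' \<notin> ?W" "''j'' \<notin> ?W" "''n'' \<notin> ?W" using wf by (cases st; auto simp: wf_stage_def)+
  have bits: "nat_bits k \<le> D" if "k \<le> n" for k
    using nat_bits_le_self[of k] that D1 by simp
  have cd_nset: "cell_done n st s\<^sub>0 (nset v is k s) i j = cell_done n st s\<^sub>0 s i j"
    if "v \<in> {''i'', ''j''}" for v "is" k s i j
    using that wf by (cases st) (auto simp: wf_stage_def)
  define OK where "OK s \<longleftrightarrow> frame ?W s\<^sub>0 s \<and> bnd sz X UNIV D s" for s
  have OK_nset: "OK (nset v [] k s)" if "OK s" "v \<in> {''i'', ''j''}" "k \<le> n" for v k s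
    using that bits unfolding OK_def by (auto intro: frame_nset bnd_nset)
  define Inv where "Inv i s \<longleftrightarrow> OK s \<and> (\<forall>i'<i. \<forall>j'<n. cell_done n st s\<^sub>0 s i' j')" for i s
  define Inv' where "Inv' i j s \<longleftrightarrow> Inv i s \<and> nreg s ''i'' [] = i \<and> (\<forall>j'<j. cell_done n st s\<^sub>0 s i j')" for i j s
  let ?T = "100 * D\<^sup>2"
  let ?T' = "(n + 1) * (?T + 4 * n + 20)"
  have inner: "\<exists>t s'. exec sz (for_loop ''j'' (stage_cell st)) s t s' \<and> t \<le> ?T' \<and> nreg s' ''i'' [] = i \<and>
      nreg s' ''n'' [] = n \<and> Inv (Suc i) (nset ''i'' [] (Suc i) s')"
    if i: "i < n" "Inv i s" "nreg s ''i'' [] = i" "nreg s ''n'' [] = n" for i s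
  proof -
    have "Inv' i 0 (nset ''j'' [] 0 s)"
      using i OK_nset by (simp add: Inv'_def Inv_def cd_nset)
    moreover have "\<exists>t s''. exec sz (stage_cell st) s' t s'' \<and> t \<le> ?T \<and> nreg s'' ''j'' [] = j \<and>
        nreg s'' ''n'' [] = n \<and> Inv' i (Suc j) (nset ''j'' [] (Suc j) s'')"
      if j: "j < n" "Inv' i j s'" "nreg s' ''j'' [] = j" "nreg s' ''n'' [] = n" for j s'
    proof -
      obtain t s'' where s'': "exec sz (stage_cell st) s' t s''" "t \<le> ?T" "frame ?W s\<^sub>0 s''"
        "bnd sz X UNIV D s''" "nreg s'' ''i'' [] = i" "nreg s'' ''j'' [] = j"
        "cell_done n st s\<^sub>0 s'' i j" "\<And>i' j'. cell_done n st s\<^sub>0 s' i' j' \<Longrightarrow> cell_done n st s\<^sub>0 s'' i' j'"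
        using cell[OF model wf s0 D, of s' i j] i j by (auto simp: Inv'_def Inv_def OK_def)
      have "OK s''" using s'' by (simp add: OK_def)
      then have "Inv' i (Suc j) (nset ''j'' [] (Suc j) s'')"
        using j s'' OK_nset[of s'' "''j''" "Suc j"]
        by (auto simp: Inv'_def Inv_def cd_nset less_Suc_eq)
      moreover have "nreg s'' ''n'' [] = n" using s''(3) s0(1) W by (simp add: frame_def)
      ultimately show ?thesis using s'' by blast
    qed
    ultimately obtain t s' where s': "exec sz (for_loop ''j'' (stage_cell st)) s t s'" "t \<le> ?T'"
      "Inv' i n s'" "nreg s' ''n'' [] = n"
      using exec_for_loop[of "''j''" s n "Inv' i" sz "stage_cell st" ?T] i(4) by auto
    then have "Inv (Suc i) (nset ''i'' [] (Suc i) s')"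
      using OK_nset[of s' "''i''" "Suc i"] i(1) by (auto simp: Inv'_def Inv_def cd_nset less_Suc_eq)
    with s' show ?thesis by (auto simp: Inv'_def)
  qed
  have "frame ?W s\<^sub>0 s\<^sub>0" by (simp add: frame_def)
  moreover have "bnd sz X UNIV D s\<^sub>0" using s0(4) BD by (auto simp: bnd_def intro: order_trans)
  ultimately have "Inv 0 (nset ''i'' [] 0 s\<^sub>0)" using OK_nset[of s\<^sub>0 "''i''" 0] by (simp add: Inv_def OK_def)
  then obtain t s' where s': "exec sz (stage_com st) s\<^sub>0 t s'" "t \<le> (n + 1) * (?T' + 4 * n + 20)"
      "Inv n s'" "nreg s' ''n'' [] = n"
    unfolding stage_com_def
    using exec_for_loop[of "''i''" s\<^sub>0 n Inv sz "for_loop ''j'' (stage_cell st)" ?T'] inner s0(1) by auto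
  have "?T' \<le> (2 * D) * (124 * D\<^sup>2)"
  proof (intro mult_mono)
    have "D \<le> D\<^sup>2" by (simp add: power2_eq_square)
    then show "?T + 4 * n + 20 \<le> 124 * D\<^sup>2" using D1 by linarith
  qed (use D1 in auto)
  also have "\<dots> = 248 * D ^ 3" by (simp add: power2_eq_square power3_eq_cube)
  finally have T': "?T' \<le> 248 * D ^ 3" .
  have "t \<le> (2 * D) * (272 * D ^ 3)"
  proof (rule order_trans[OF s'(2)], intro mult_mono)
    have "D * 1 \<le> D * D\<^sup>2" using D1 by (intro mult_left_mono) auto
    then have "D \<le> D ^ 3" by (simp add: power2_eq_square power3_eq_cube)
    then show "?T' + 4 * n + 20 \<le> 272 * D ^ 3" using D1 T' by linarith
  qed (use D1 in auto)
  also have "\<dots> = 544 * D ^ 4" by (simp add: power3_eq_cube power4_eq_xxxx)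
  finally have "t \<le> 1000 * D ^ 4" by simp
  with s' show ?thesis by (auto simp: Inv_def OK_def)
qed

text \<open>Entries are specified relative to the store before the stage. As nothing the stage reads
  has changed, the specification can be reevaluated in a later store, which turns an assignment into
  an equation about a single store. Entries have nonempty indices, so the freedom of
  \<open>frame\<close> at the counters does no harm.\<close>

lemma cell_done_transfer:
  assumes cd: "cell_done n st s\<^sub>0 s i j" and wf: "wf_stage st"
    and fr: "frame N s\<^sub>0 s\<^sub>0'" "reads st \<inter> N = {}"
    and same: "\<And>is. is \<noteq> [] \<Longrightarrow> rreg s' (target st) is = rreg s (target st) is \<and> nreg s' (target st) is = nreg s (target st) is"
  shows "cell_done n st s\<^sub>0' s' i j"
proof (cases st)
  case (SumS A e)
  have "rval (cell_at i j k s\<^sub>0') e = rval (cell_at i j k s\<^sub>0) e" for k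
    using frame_at[OF fr(1)] fr(2) SumS by (intro rval_agree) auto
  then show ?thesis using cd same[of "[i, j]"] SumS by simp
next
  case (NatS A es b e1 e2)
  have ag: "agree (bnames b \<union> nnames e1 \<union> nnames e2) (cell_at i j 0 s\<^sub>0') (cell_at i j 0 s\<^sub>0)"
    using frame_at[OF fr(1)] fr(2) NatS by auto
  note ags = agree_subset[OF ag]
  have eqs: "bval (cell_at i j 0 s\<^sub>0') b = bval (cell_at i j 0 s\<^sub>0) b" "nval (cell_at i j 0 s\<^sub>0') e1 = nval (cell_at i j 0 s\<^sub>0) e1"
    "nval (cell_at i j 0 s\<^sub>0') e2 = nval (cell_at i j 0 s\<^sub>0) e2"
    using bval_agree[OF ags, of b] nval_agree[OF ags, of e1] nval_agree[OF ags, of e2] by auto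
  have es: "es = [ni, nj] \<or> es = [ni]" using wf NatS by (auto simp: wf_stage_def)
  then have mp: "map (nval (cell_at i j 0 s\<^sub>0')) es = map (nval (cell_at i j 0 s\<^sub>0)) es"
    and ne: "map (nval (cell_at i j 0 s\<^sub>0)) es \<noteq> []"
    by (auto simp: cell_at_def)
  have "nreg s' A (map (nval (cell_at i j 0 s\<^sub>0)) es) = nreg s A (map (nval (cell_at i j 0 s\<^sub>0)) es)"
    using same[OF ne] NatS by simp
  with cd show ?thesis unfolding NatS cell_done.simps mp eqs by (rule trans[rotated])
qed

section \<open>Sequences of stages in single-assignment form\<close>

definition holds :: "nat \<Rightarrow> stage \<Rightarrow> store \<Rightarrow> bool" where
  "holds n st s \<longleftrightarrow> (\<forall>i<n. \<forall>j<n. cell_done n st s s i j)"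

fun prog_of :: "stage list \<Rightarrow> com" where
  "prog_of [] = Skip"
| "prog_of (st # ss) = Seq (stage_com st) (prog_of ss)"

text \<open>Whatever a stage reads or defines is not written later. The accumulator can be shared,
  since \<open>wf_stage\<close> forbids stages to read it or to have it as target.\<close>

fun ssa :: "stage list \<Rightarrow> bool" where
  "ssa [] \<longleftrightarrow> True"
| "ssa (st # ss) \<longleftrightarrow> wf_stage st \<and> insert (target st) (reads st) \<inter> \<Union>(written ` set ss) = {} \<and> ssa ss"

lemma ssa_append:
  "ssa (xs @ ys) \<longleftrightarrow> ssa xs \<and> ssa ys \<and>
     (\<forall>st\<in>set xs. insert (target st) (reads st) \<inter> \<Union>(written ` set ys) = {})"
  by (induction xs) auto

lemma frame_trans:
  "frame N s s' \<Longrightarrow> frame M s' s'' \<Longrightarrow> frame (N \<union> M) s s''"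
  by (auto simp: frame_def)

text \<open>As every array is written by one stage only and before it is read, the final store satisfies
  the defining equations of all stages simultaneously.\<close>

lemma prog_run:
  assumes "ssa ss"
  shows "\<exists>a k. \<forall>sz X n s B. size_model sz X \<longrightarrow> nreg s ''n'' [] = n \<longrightarrow> n \<le> B \<longrightarrow> 1 \<le> B \<longrightarrow>
    bnd sz X UNIV B s \<longrightarrow> (\<exists>t s'. exec sz (prog_of ss) s t s' \<and> t \<le> a * B ^ k \<and>
      frame (\<Union>(written ` set ss)) s s' \<and> (\<forall>st\<in>set ss. holds n st s'))"
  using assms
proof (induction ss)
  case Nil
  show ?case
    by (intro exI[of _ 1] exI[of _ 0] allI impI) (auto simp: frame_def intro!: exI exec.Skip[simplified])
next
  case (Cons st ss)
  from Cons.prems have "ssa ss" by simp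
  from Cons.IH[OF this] obtain a k where IH: "\<forall>sz X n s B. size_model sz X \<longrightarrow> nreg s ''n'' [] = n \<longrightarrow>
    n \<le> B \<longrightarrow> 1 \<le> B \<longrightarrow> bnd sz X UNIV B s \<longrightarrow> (\<exists>t s'. exec sz (prog_of ss) s t s' \<and> t \<le> a * B ^ k \<and>
      frame (\<Union>(written ` set ss)) s s' \<and> (\<forall>st\<in>set ss. holds n st s'))"
    by (elim exE)
  have wf: "wf_stage st" and dj: "insert (target st) (reads st) \<inter> \<Union>(written ` set ss) = {}"
    using Cons.prems by auto
  let ?K = "stage_fac st"
  have fac: "8 \<le> ?K" by (cases st) auto
  show ?case
  \<comment> \<open>One stage turns the size bound B into \<open>?K\<close> times B^2, so the
    exponent of the remaining stages doubles. The final exponent is exponential in the number of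
    stages, a constant.\<close>
  proof (rule exI[of _ "1 + 1000 * ?K ^ 4 + a * ?K ^ k"], rule exI[of _ "8 + 2 * k"], intro allI impI)
    fix sz X n s B
    assume model: "size_model sz X" and s: "nreg s ''n'' [] = n" "n \<le> B" "1 \<le> B" "bnd sz X UNIV B s"
    let ?D = "?K * B\<^sup>2"
    obtain t s1 where s1: "exec sz (stage_com st) s t s1" "t \<le> 1000 * ?D ^ 4" "frame (written st) s s1"
      "bnd sz X UNIV ?D s1" "nreg s1 ''n'' [] = n" "\<forall>i<n. \<forall>j<n. cell_done n st s s1 i j"
      using stage_run[OF model wf s refl] by blast
    have "B \<le> B\<^sup>2" using s by (simp add: power2_eq_square)
    also have "\<dots> \<le> ?D" using fac by simp
    finally have BD: "B \<le> ?D" .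
    have "n \<le> ?D" "1 \<le> ?D" using order_trans[OF s(2) BD] order_trans[OF s(3) BD] by blast+
    then obtain t' s2 where s2: "exec sz (prog_of ss) s1 t' s2" "t' \<le> a * ?D ^ k"
      "frame (\<Union>(written ` set ss)) s1 s2" "\<forall>st\<in>set ss. holds n st s2"
      using IH[rule_format, OF model s1(5) _ _ s1(4)] by blast
    have h1: "holds n st s1"
      unfolding holds_def
    proof (intro allI impI)
      fix i j assume "i < n" "j < n"
      then have "cell_done n st s s1 i j" using s1(6) by blast
      moreover have "reads st \<inter> written st = {}" using wf by (cases st) (auto simp: wf_stage_def)
      ultimately show "cell_done n st s1 s1 i j" by (rule cell_done_transfer[OF _ wf s1(3)]) simp
    qed
    have h2: "holds n st s2"
      unfolding holds_def
    proof (intro allI impI)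
      fix i j assume ij: "i < n" "j < n"
      have d: "target st \<notin> \<Union>(written ` set ss)" "reads st \<inter> \<Union>(written ` set ss) = {}" using dj by auto
      have 1: "cell_done n st s1 s1 i j" using h1 ij by (simp add: holds_def)
      have 2: "rreg s2 (target st) is = rreg s1 (target st) is \<and> nreg s2 (target st) is = nreg s1 (target st) is"
        if "is \<noteq> []" for "is"
        using s2(3) d(1) that unfolding frame_def by blast
      show "cell_done n st s2 s2 i j" by (rule cell_done_transfer[OF 1 wf s2(3) d(2) 2])
    qed
    have "exec sz (prog_of (st # ss)) s (1 + t + t') s2"
      unfolding prog_of.simps by (intro exec.Seq[OF s1(1) s2(1)])
    moreover have "1 + t + t' \<le> (1 + 1000 * ?K ^ 4 + a * ?K ^ k) * B ^ (8 + 2 * k)"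
    proof -
      have B1: "1 \<le> B ^ m" for m using s(3) by simp
      have "1 + t + t' \<le> 1 + 1000 * ?D ^ 4 + a * ?D ^ k" using s1(2) s2(2) by simp
      also have "?D ^ 4 = ?K ^ 4 * B ^ 8" by (simp add: power_mult_distrib flip: power_mult)
      also have "?D ^ k = ?K ^ k * B ^ (2 * k)" by (simp add: power_mult_distrib flip: power_mult)
      also have "1 + 1000 * (?K ^ 4 * B ^ 8) + a * (?K ^ k * B ^ (2 * k)) \<le>
         B ^ (8 + 2 * k) + 1000 * (?K ^ 4 * B ^ (8 + 2 * k)) + a * (?K ^ k * B ^ (8 + 2 * k))"
        using s(3) B1 by (intro add_mono mult_left_mono power_increasing) auto
      finally show ?thesis by (simp add: algebra_simps)
    qed
    moreover have "frame (\<Union>(written ` set (st # ss))) s s2" using frame_trans[OF s1(3) s2(3)] by simp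
    moreover have "\<forall>st\<in>set (st # ss). holds n st s2" using h2 s2(4) by simp
    ultimately show "\<exists>t s'. exec sz (prog_of (st # ss)) s t s' \<and> t \<le> (1 + 1000 * ?K ^ 4 + a * ?K ^ k) * B ^ (8 + 2 * k) \<and>
      frame (\<Union>(written ` set (st # ss))) s s' \<and> (\<forall>st\<in>set (st # ss). holds n st s')" by blast
  qed
qed

section \<open>The program\<close>

abbreviation "rr A x y \<equiv> RRead A [x, y]"
abbreviation "nr A x y \<equiv> ROfNat (NRead A [x, y])"
abbreviation "rc k \<equiv> ROfNat (NConst k)"
abbreviation "ntest A b \<equiv> NatS A [ni, nj] b (NConst 1) (NConst 0)"

text \<open>Unrolled in the syntax, since the exponent is a constant of the program.\<close>

fun rpow :: "rexp \<Rightarrow> nat \<Rightarrow> rexp" where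
  "rpow e 0 = rc 1"
| "rpow e (Suc m) = RMul e (rpow e m)"

lemma rval_rpow: "rval s (rpow e m) = rval s e ^ m"
  by (induction m) auto

lemma rnames_rpow: "rnames (rpow e m) \<subseteq> rnames e"
  by (induction m) auto

definition eqx :: "nexp \<Rightarrow> nexp \<Rightarrow> bexp" where
  "eqx a b = BAnd (BNot (NLess a b)) (BNot (NLess b a))"

lemma bval_eqx [simp]: "bval s (eqx a b) \<longleftrightarrow> nval s a = nval s b"
  by (auto simp: eqx_def)

lemma bnames_eqx [simp]: "bnames (eqx a b) = nnames a \<union> nnames b"
  by (auto simp: eqx_def)

text \<open>All matrices are indexed by vertices instead of atoms: a vertex stands for its atom, and a sum
  over atoms becomes a sum over vertices in which every term is divided by the size of the atom
  (array \<open>cn\<close>). Tests and membership relations are arrays of the numbers 0 and 1.\<close>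

definition "st_s0 = ntest ''s0'' (eqx (NRead ''label'' [ni]) (NRead ''label'' [nj]))"
text \<open>On values 0 and 1, p + s - 2 p s is exclusive or: it selects the symmetric difference of
  the positive neighbours and the cluster. The term \<open>k = i\<close> has weight 0.\<close>

definition "st_dv = SumS ''dv'' (RMul (rr ''w'' ni nk) (RSub (RAdd (nr ''pos'' ni nk) (nr ''s0'' ni nk))
  (RMul (rc 2) (RMul (nr ''pos'' ni nk) (nr ''s0'' ni nk)))))"
definition "st_wc = SumS ''wc'' (RMul (rr ''w'' ni nk) (nr ''s0'' ni nk))"
definition "st_mk = ntest ''mk'' (RLess (RMul (RDiv (RRead ''beta'' []) (rc 2)) (rr ''wc'' ni ni)) (rr ''dv'' ni ni))"
definition "st_lh = SumS ''lh'' (RMul (nr ''s0'' ni nk) (RMul (nr ''mk'' nk nk) (rr ''dv'' nk nk)))"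
definition "st_rh = SumS ''rh'' (RMul (nr ''s0'' ni nk) (rr ''wc'' nk nk))"
definition "st_sg = ntest ''sg'' (BNot (BAnd
  (BNot (RLess (RMul (RDiv (RMul (RRead ''beta'' []) (RRead ''beta'' [])) (rc 20)) (rr ''rh'' ni ni)) (rr ''lh'' ni ni)))
  (BNot (NLess (NConst 0) (NRead ''mk'' [ni, ni])))))"
definition "st_sm = ntest ''sm'' (BNot (BAnd (BNot (eqx ni nj)) (BNot (BAnd (NLess (NConst 0) (NRead ''s0'' [ni, nj]))
  (BAnd (BNot (NLess (NConst 0) (NRead ''sg'' [ni, ni]))) (BNot (NLess (NConst 0) (NRead ''sg'' [nj, nj]))))))))"
text \<open>Odd labels for vertices split off and even labels for the rest of a cluster cannot
  collide.\<close>

definition "st_atom = NatS ''atom'' [ni] (NLess (NConst 0) (NRead ''sg'' [ni, ni]))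
  (NAdd (NMul (NConst 2) ni) (NConst 1)) (NMul (NConst 2) (NRead ''label'' [ni]))"
definition "st_cn = SumS ''cn'' (nr ''sm'' ni nk)"
definition "st_ta = SumS ''ta'' (RMul (nr ''sm'' ni nk) (rr ''w'' nk nj))"
definition "st_tp = SumS ''tp'' (RMul (nr ''sm'' ni nk) (RMul (nr ''pos'' nk nj) (rr ''w'' nk nj)))"
definition "st_wa = SumS ''wa'' (RMul (rr ''ta'' ni nk) (nr ''sm'' nj nk))"
definition "st_wp = SumS ''wp'' (RMul (rr ''tp'' ni nk) (nr ''sm'' nj nk))"
definition "st_dg = SumS ''dg'' (RDiv (RMul (RSub (rc 1) (nr ''sm'' ni nk)) (rr ''wp'' ni nk)) (rr ''cn'' nk nk))"
definition "st_pd = ntest ''pd'' (RLess (rc 0) (rr ''dg'' ni ni))"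

text \<open>Single assignment requires an array of its own for each power. The unary suffix keeps
  the names apart, and no other array name begins with X.\<close>

definition xname :: "nat \<Rightarrow> string" where
  "xname t = CHR ''X'' # replicate t (CHR ''x'')"

definition "st_x0 = SumS (xname 0) (RDiv (RMul (nr ''sm'' ni nk) (nr ''sm'' nk nj)) (rr ''cn'' nk nk))"

abbreviation "walk_ik \<equiv> RDiv (RMul (RSub (rc 1) (nr ''sm'' ni nk)) (rr ''wp'' ni nk)) (rr ''dg'' ni ni)"
text \<open>Restricts a sum over vertices to atoms of positive degree and lets each of them count
  once.\<close>

abbreviation "weight_k \<equiv> RDiv (nr ''pd'' nk nk) (rr ''cn'' nk nk)"

definition st_x :: "nat \<Rightarrow> stage" where
  "st_x t = SumS (xname (Suc t)) (RMul (RMul weight_k (RDiv (RAdd (nr ''sm'' ni nk) walk_ik) (rc 2)))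
     (rr (xname t) nk nj))"

definition "st_q = SumS ''Q'' (RMul (RMul weight_k walk_ik) (rr (xname t0) nk nj))"
definition "st_g = SumS ''G'' (RMul weight_k (RMul (RMul (rr ''dg'' ni ni) (rr ''dg'' nj nj))
  (RDiv (RMul (rr ''Q'' ni nk) (rr ''Q'' nj nk)) (rr ''dg'' nk nk))))"
text \<open>The negative power of \<tau> becomes a positive power of 2 \<alpha> / \<epsilon>; the
  two factors \<open>''pd''\<close> extend \<Gamma> by zero.\<close>

definition "st_adm = ntest ''adm'' (BAnd (NLess (NRead ''sm'' [ni, nj]) (NConst 1))
  (RLess (rr ''wa'' ni nj)
    (RMul (RMul (rc 64) (rpow (RDiv (RMul (rc 2) (RRead ''alpha'' [])) (RRead ''eps'' [])) (2 * t0 + 1)))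
      (RMul (RMul (nr ''pd'' ni ni) (nr ''pd'' nj nj)) (rr ''G'' ni nj)))))"

definition "stages1 = [st_s0, st_dv, st_wc, st_mk, st_lh, st_rh, st_sg, st_sm, st_atom, st_cn, st_ta, st_tp,
  st_wa, st_wp, st_dg, st_pd, st_x0]"
definition "stages2 = map st_x [0..<t0]"
definition "stages3 = [st_q, st_g, st_adm]"
definition "stages = stages1 @ stages2 @ stages3"

lemmas st_defs = st_s0_def st_dv_def st_wc_def st_mk_def st_lh_def st_rh_def st_sg_def st_sm_def st_atom_def
  st_cn_def st_ta_def st_tp_def st_wa_def st_wp_def st_dg_def st_pd_def st_x0_def st_q_def st_g_def st_adm_def st_x_def

lemma xname_inj [simp]: "xname t = xname t' \<longleftrightarrow> t = t'"
proof
  assume "xname t = xname t'"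
  then have "length (xname t) = length (xname t')" by simp
  then show "t = t'" by (simp add: xname_def)
qed simp

lemma xname_neq: "c \<noteq> CHR ''X'' \<Longrightarrow> xname t \<noteq> c # cs" "c \<noteq> CHR ''X'' \<Longrightarrow> c # cs \<noteq> xname t"
  by (auto simp: xname_def)

lemma ssa_stages1: "ssa stages1"
  by (simp add: stages1_def st_defs wf_stage_def xname_neq)

lemma reads_adm: "reads st_adm \<subseteq> {''i'', ''j'', ''sm'', ''wa'', ''alpha'', ''eps'', ''pd'', ''G''}"
  using rnames_rpow[of "RDiv (RMul (rc 2) (RRead ''alpha'' [])) (RRead ''eps'' [])" "2 * t0 + 1"]
  by (auto simp: st_adm_def)

lemma wf_adm: "wf_stage st_adm"
  using rnames_rpow[of "RDiv (RMul (rc 2) (RRead ''alpha'' [])) (RRead ''eps'' [])" "2 * t0 + 1"]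
  by (auto simp: st_adm_def wf_stage_def)

lemma ssa_stages3: "ssa stages3"
  using wf_adm reads_adm by (auto simp: stages3_def st_q_def st_g_def st_adm_def wf_stage_def xname_neq)

text \<open>Induction over an arbitrary interval avoids expanding the 297 stages. Stage
  \<open>m\<close> reads the name of index \<open>m\<close> and writes the next one; later stages
  write only longer names and the accumulator.\<close>

lemma ssa_powers: "ssa (map st_x [m..<m + l])"
proof (induction l arbitrary: m)
  case (Suc l)
  have eq: "[m..<m + Suc l] = m # [Suc m..<Suc m + l]" using upt_conv_Cons[of m "m + Suc l"] by simp
  have wf: "wf_stage (st_x m)" by (simp add: st_x_def wf_stage_def xname_neq)
  let ?U = "insert (target (st_x m)) (reads (st_x m))"
  have "?U \<inter> \<Union>(written ` set (map st_x [Suc m..<Suc m + l])) = {}"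
  proof (rule equals0I)
    fix x assume x: "x \<in> ?U \<inter> \<Union>(written ` set (map st_x [Suc m..<Suc m + l]))"
    then obtain t where "t \<in> set [Suc m..<Suc m + l]" "x \<in> written (st_x t)"
      unfolding set_map by blast
    moreover from this have "?U \<inter> written (st_x t) = {}" by (auto simp: st_x_def xname_neq)
    ultimately show False using x by blast
  qed
  then show ?case unfolding eq list.map ssa.simps using wf Suc[of "Suc m"] by blast
qed simp

lemma written_stages3: "\<Union>(written ` set stages3) = {''Q'', ''G'', ''adm'', ''acc''}"
  by (auto simp: stages3_def st_q_def st_g_def st_adm_def)

lemma written_stages2: "\<Union>(written ` set stages2) \<subseteq> insert ''acc'' (xname ` {0<..})"
  by (auto simp: stages2_def st_x_def)

lemma uses_stages1:
  "\<forall>st\<in>set stages1. \<forall>x\<in>insert (target st) (reads st).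
     x \<noteq> ''acc'' \<and> x \<noteq> ''Q'' \<and> x \<noteq> ''G'' \<and> x \<noteq> ''adm'' \<and> (\<forall>t>0. x \<noteq> xname t)"
  by (simp add: stages1_def st_defs xname_neq)

lemma uses_stages2:
  "\<forall>st\<in>set stages2. \<forall>x\<in>insert (target st) (reads st). x \<noteq> ''acc'' \<and> x \<noteq> ''Q'' \<and> x \<noteq> ''G'' \<and> x \<noteq> ''adm''"
  by (auto simp: stages2_def st_x_def xname_neq)

lemma ssa_stages: "ssa stages"
proof -
  have s2: "ssa stages2" using ssa_powers[of 0 t0] by (simp add: stages2_def)
  have 23: "insert (target st) (reads st) \<inter> \<Union>(written ` set stages3) = {}" if "st \<in> set stages2" for st
    using uses_stages2 that unfolding written_stages3 by blast
  have W: "\<Union>(written ` set (stages2 @ stages3)) \<subseteq> insert ''acc'' (xname ` {0<..}) \<union> {''Q'', ''G'', ''adm'', ''acc''}"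
    using Un_mono[OF written_stages2 equalityD1[OF written_stages3]]
    by (simp only: set_append image_Un Union_Un_distrib)
  have 1: "insert (target st) (reads st) \<inter> \<Union>(written ` set (stages2 @ stages3)) = {}" if st: "st \<in> set stages1" for st
  proof (rule equals0I)
    fix x assume x: "x \<in> insert (target st) (reads st) \<inter> \<Union>(written ` set (stages2 @ stages3))"
    then have "x \<in> insert ''acc'' (xname ` {0<..}) \<union> {''Q'', ''G'', ''adm'', ''acc''}" using W by blast
    moreover have "x \<noteq> ''acc'' \<and> x \<noteq> ''Q'' \<and> x \<noteq> ''G'' \<and> x \<noteq> ''adm'' \<and> (\<forall>t>0. x \<noteq> xname t)"
      using uses_stages1 st x by blast
    ultimately show False by auto
  qed
  show ?thesis
    unfolding stages_def ssa_append[of stages1] ssa_append[of stages2]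
    by (intro conjI ballI ssa_stages1 s2 ssa_stages3 23 1)
qed

definition inputs :: "string set" where
  "inputs = {''n'', ''pos'', ''label'', ''w'', ''eps'', ''beta'', ''alpha''}"

lemma inputs_kept: "inputs \<inter> \<Union>(written ` set stages) = {}"
proof -
  have "\<forall>st\<in>set stages1. \<forall>x\<in>inputs. x \<notin> written st"
    by (simp add: inputs_def stages1_def st_defs xname_neq)
  moreover have "\<forall>x\<in>inputs. x \<noteq> ''acc'' \<and> x \<noteq> ''Q'' \<and> x \<noteq> ''G'' \<and> x \<noteq> ''adm'' \<and> (\<forall>t. x \<noteq> xname t)"
    by (simp add: inputs_def xname_neq)
  moreover have "x \<in> \<Union>(written ` set stages1) \<or> x \<in> insert ''acc'' (xname ` {0<..}) \<or> x \<in> {''Q'', ''G'', ''adm'', ''acc''}"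
    if "x \<in> \<Union>(written ` set stages)" for x
    using that written_stages2 written_stages3 unfolding stages_def set_append image_Un Union_Un_distrib by blast
  ultimately show ?thesis by (intro equals0I) fast
qed

section \<open>Correctness of the program\<close>

lemma holds_SumS: "holds n (SumS A e) s \<Longrightarrow> i < n \<Longrightarrow> j < n \<Longrightarrow>
    rreg s A [i, j] = (\<Sum>k<n. rval (cell_at i j k s) e)"
  by (simp add: holds_def)

lemma holds_ntest: "holds n (ntest A b) s \<Longrightarrow> i < n \<Longrightarrow> j < n \<Longrightarrow>
    nreg s A [i, j] = (if bval (cell_at i j 0 s) b then 1 else 0)"
  by (simp add: holds_def cell_at_def)

lemma sum_indicator:
  fixes h :: "nat \<Rightarrow> real"
  shows "(\<Sum>k<n. (if Q k then 1 else 0) * h k) = (\<Sum>k\<in>{k. k < n \<and> Q k}. h k)"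
proof -
  have "(\<Sum>k<n. (if Q k then 1 else 0) * h k) = (\<Sum>k\<in>{..<n}. if Q k then h k else 0)"
    by (intro sum.cong) auto
  also have "\<dots> = (\<Sum>k\<in>{k \<in> {..<n}. Q k}. h k)" by (rule sum.inter_filter[symmetric]) simp
  also have "{k \<in> {..<n}. Q k} = {k. k < n \<and> Q k}" by auto
  finally show ?thesis .
qed

text \<open>From here on only equations about one store remain: the inputs are untouched and all
  stages hold simultaneously.\<close>

locale final_store = cc_atoms I \<beta> \<C>\<^sub>0 for I :: "nat cc" and \<beta> and \<C>\<^sub>0 +
  fixes n :: nat and f :: "nat \<Rightarrow> nat" and \<alpha> \<epsilon> :: real and s :: store
  assumes V_eq: "V = {..<n}" and label: "label_partition n f = \<C>\<^sub>0"
    and alpha: "0 < \<alpha>" and eps: "0 < \<epsilon>"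
    and in_w: "\<And>i j. i < n \<Longrightarrow> j < n \<Longrightarrow> rreg s ''w'' [i, j] = w i j"
    and in_pos: "\<And>i j. i < n \<Longrightarrow> j < n \<Longrightarrow> nreg s ''pos'' [i, j] = (if {i, j} \<in> pos_pairs I then 1 else 0)"
    and in_label: "\<And>i. i < n \<Longrightarrow> nreg s ''label'' [i] = f i"
    and in_real: "rreg s ''beta'' [] = \<beta>" "rreg s ''alpha'' [] = \<alpha>" "rreg s ''eps'' [] = \<epsilon>"
    and stages_hold: "\<And>st. st \<in> set stages \<Longrightarrow> holds n st s"
begin

definition cl :: "nat \<Rightarrow> nat set" where
  "cl u = {v. v < n \<and> f v = f u}"

text \<open>Whether the construction splits \<open>u\<close> off explicitly. A remainder that
  happens to consist of one vertex is not \<open>single\<close>, but \<open>same\<close> still makes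
  it an atom.\<close>

definition single :: "nat \<Rightarrow> bool" where
  "single u \<longleftrightarrow> (\<Sum>v\<in>marked \<beta> I (cl u). deviation I (cl u) v) > \<beta>\<^sup>2 / 20 * wt_sets I (cl u) (cl u)
     \<or> u \<in> marked \<beta> I (cl u)"

definition same :: "nat \<Rightarrow> nat \<Rightarrow> bool" where
  "same u v \<longleftrightarrow> u = v \<or> f u = f v \<and> \<not> single u \<and> \<not> single v"

definition atom :: "nat \<Rightarrow> nat set" where
  "atom u = {v. v < n \<and> same u v}"

lemma cl_V: "cl u \<subseteq> V" by (auto simp: cl_def V_eq)

lemma cl_eq: "v \<in> cl u \<Longrightarrow> cl v = cl u" by (auto simp: cl_def)

lemma C0_eq: "\<C>\<^sub>0 = cl ` {..<n}"
  unfolding label[symmetric] label_partition_def cl_def by auto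

lemma atom_in: "u < n \<Longrightarrow> atom u \<in> \<K>"
proof -
  assume u: "u < n"
  have "atom u \<in> cluster_atoms \<beta> I (cl u)"
  proof (cases "single u")
    case True
    then have a: "atom u = {u}" using u by (auto simp: atom_def same_def)
    have "u \<in> cl u" using u by (simp add: cl_def)
    then show ?thesis using True unfolding a single_def cluster_atoms_def by auto
  next
    case False
    then have good: "\<not> (\<Sum>v\<in>marked \<beta> I (cl u). deviation I (cl u) v) > \<beta>\<^sup>2 / 20 * wt_sets I (cl u) (cl u)"
      and um: "u \<notin> marked \<beta> I (cl u)" by (auto simp: single_def)
    have sv: "single v \<longleftrightarrow> v \<in> marked \<beta> I (cl u)" if "v \<in> cl u" for v
      using good unfolding single_def cl_eq[OF that] by blast
    have uc: "u \<in> cl u" using u by (simp add: cl_def)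
    have "atom u = cl u - marked \<beta> I (cl u)"
    proof (intro set_eqI iffI)
      fix v assume "v \<in> atom u"
      then show "v \<in> cl u - marked \<beta> I (cl u)"
        using sv[of v] um uc by (auto simp: atom_def same_def cl_def)
    next
      fix v assume "v \<in> cl u - marked \<beta> I (cl u)"
      then show "v \<in> atom u"
        using sv[of v] False by (auto simp: atom_def same_def cl_def)
    qed
    then show ?thesis using good um uc by (auto simp: cluster_atoms_def)
  qed
  moreover have "cl u \<in> \<C>\<^sub>0" using u by (simp add: C0_eq)
  ultimately show ?thesis by (auto simp: atoms_def)
qed

lemma self_atom: "u < n \<Longrightarrow> u \<in> atom u" by (simp add: atom_def same_def)

lemma atom_unique: "K \<in> \<K> \<Longrightarrow> u \<in> K \<Longrightarrow> K = atom u"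
  using atom_in[of u] self_atom[of u] atom_disjoint[of K "atom u"] atom_subset[of K] by (auto simp: V_eq)

lemma same_iff: "u < n \<Longrightarrow> v < n \<Longrightarrow> same u v \<longleftrightarrow> atom u = atom v"
  using atom_unique[OF atom_in, of u v] self_atom[of v] by (auto simp: atom_def)

lemma atoms_eq: "\<K> = atom ` {..<n}"
proof
  show "\<K> \<subseteq> atom ` {..<n}"
  proof
    fix K assume K: "K \<in> \<K>"
    then obtain u where "u \<in> K" using atom_nonempty by blast
    then have "K = atom u" "u < n" using atom_unique[OF K] atom_subset[OF K] V_eq by auto
    then show "K \<in> atom ` {..<n}" by auto
  qed
qed (use atom_in in auto)

lemma vertex_sum: "(\<Sum>k<n. F (atom k) / real (card (atom k))) = (\<Sum>K\<in>\<K>. F K)"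
proof -
  have "(\<Sum>k<n. F (atom k) / real (card (atom k)))
      = (\<Sum>K\<in>\<K>. \<Sum>k\<in>{k \<in> {..<n}. atom k = K}. F (atom k) / real (card (atom k)))"
    using finite_atoms atom_in by (intro sum.group[symmetric]) auto
  also have "\<dots> = (\<Sum>K\<in>\<K>. F K)"
  proof (intro sum.cong refl)
    fix K assume K: "K \<in> \<K>"
    have "{k \<in> {..<n}. atom k = K} = K"
      using atom_unique[OF K] self_atom atom_subset[OF K] V_eq by auto
    then have "(\<Sum>k\<in>{k \<in> {..<n}. atom k = K}. F (atom k) / real (card (atom k)))
        = (\<Sum>k\<in>K. F K / real (card K))"
      using atom_unique[OF K] by (intro sum.cong) auto
    also have "\<dots> = F K" using atom_nonempty[OF K] finite_atom[OF K] by simp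
    finally show "(\<Sum>k\<in>{k \<in> {..<n}. atom k = K}. F (atom k) / real (card (atom k))) = F K" .
  qed
  finally show ?thesis .
qed

lemma
  shows hold_s0: "holds n st_s0 s"
    and hold_dv: "holds n st_dv s"
    and hold_wc: "holds n st_wc s"
    and hold_mk: "holds n st_mk s"
    and hold_lh: "holds n st_lh s"
    and hold_rh: "holds n st_rh s"
    and hold_sg: "holds n st_sg s"
    and hold_sm: "holds n st_sm s"
    and hold_atom: "holds n st_atom s"
    and hold_cn: "holds n st_cn s"
    and hold_ta: "holds n st_ta s"
    and hold_tp: "holds n st_tp s"
    and hold_wa: "holds n st_wa s"
    and hold_wp: "holds n st_wp s"
    and hold_dg: "holds n st_dg s"
    and hold_pd: "holds n st_pd s"
    and hold_x0: "holds n st_x0 s"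
    and hold_q: "holds n st_q s"
    and hold_g: "holds n st_g s"
    and hold_adm: "holds n st_adm s"
  by (rule stages_hold, simp add: stages_def stages1_def stages3_def)+

lemma val_s0: "i < n \<Longrightarrow> j < n \<Longrightarrow> nreg s ''s0'' [i, j] = (if f i = f j then 1 else 0)"
  using holds_ntest[OF hold_s0[unfolded st_s0_def], of i j] in_label
  by (simp add: cell_at_def)

lemma val_dv: "i < n \<Longrightarrow> j < n \<Longrightarrow> rreg s ''dv'' [i, j] = deviation I (cl i) i"
proof -
  assume ij: "i < n" "j < n"
  have "rreg s ''dv'' [i, j] = (\<Sum>k<n. if k \<in> cl i then wn i k else wp i k)"
  proof -
    have "rreg s ''dv'' [i, j] = (\<Sum>k<n. rreg s ''w'' [i, k] * ((real (nreg s ''pos'' [i, k]) + real (nreg s ''s0'' [i, k]))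
        - 2 * (real (nreg s ''pos'' [i, k]) * real (nreg s ''s0'' [i, k]))))"
      using holds_SumS[OF hold_dv[unfolded st_dv_def] ij] by (simp add: cell_at_def)
    also have "\<dots> = (\<Sum>k<n. if k \<in> cl i then wn i k else wp i k)"
      using ij by (intro sum.cong refl) (auto simp: in_w in_pos val_s0 cl_def wn_def wp_def)
    finally show ?thesis .
  qed
  also have "\<dots> = (\<Sum>k\<in>cl i. wn i k) + (\<Sum>k\<in>V - cl i. wp i k)"
    using cl_V[of i] unfolding V_eq
    by (subst sum.If_cases) (auto intro!: arg_cong2[of _ _ _ _ "(+)"] sum.cong)
  also have "\<dots> = deviation I (cl i) i"
    using deviation_eq[OF cl_V, of i] ij by (simp add: cl_def)
  finally show ?thesis .
qed

lemma cl_sum: "(\<Sum>k<n. (if f i = f k then 1 else 0) * h k) = (\<Sum>k\<in>cl i. h k)" for h :: "nat \<Rightarrow> real"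
  unfolding sum_indicator cl_def by (intro sum.cong) auto

lemma val_wc: "i < n \<Longrightarrow> j < n \<Longrightarrow> rreg s ''wc'' [i, j] = wt_sets I {i} (cl i)"
proof -
  assume ij: "i < n" "j < n"
  have "rreg s ''wc'' [i, j] = (\<Sum>k<n. rreg s ''w'' [i, k] * real (nreg s ''s0'' [i, k]))"
    using holds_SumS[OF hold_wc[unfolded st_wc_def] ij] by (simp add: cell_at_def)
  also have "\<dots> = (\<Sum>k<n. (if f i = f k then 1 else 0) * w i k)"
    using ij by (intro sum.cong refl) (simp add: in_w val_s0)
  finally show ?thesis by (simp add: cl_sum wt_sets_def)
qed

lemma val_mk: "i < n \<Longrightarrow> j < n \<Longrightarrow> nreg s ''mk'' [i, j] = (if i \<in> marked \<beta> I (cl i) then 1 else 0)"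
  using holds_ntest[OF hold_mk[unfolded st_mk_def], of i j] in_real val_wc[of i i] val_dv[of i i]
  by (simp add: cell_at_def marked_def cl_def)

lemma val_lh: "i < n \<Longrightarrow> j < n \<Longrightarrow> rreg s ''lh'' [i, j] = (\<Sum>u\<in>marked \<beta> I (cl i). deviation I (cl i) u)"
proof -
  assume ij: "i < n" "j < n"
  have "rreg s ''lh'' [i, j] = (\<Sum>k<n. real (nreg s ''s0'' [i, k]) * (real (nreg s ''mk'' [k, k]) * rreg s ''dv'' [k, k]))"
    using holds_SumS[OF hold_lh[unfolded st_lh_def] ij] by (simp add: cell_at_def)
  also have "\<dots> = (\<Sum>k<n. (if f i = f k then 1 else 0) * (if k \<in> marked \<beta> I (cl k) then deviation I (cl k) k else 0))"
    using ij by (intro sum.cong refl) (simp add: val_s0 val_mk val_dv)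
  also have "\<dots> = (\<Sum>k\<in>cl i. if k \<in> marked \<beta> I (cl i) then deviation I (cl i) k else 0)"
    unfolding cl_sum by (intro sum.cong refl) (simp add: cl_eq)
  also have "\<dots> = (\<Sum>k\<in>{k \<in> cl i. k \<in> marked \<beta> I (cl i)}. deviation I (cl i) k)"
    by (rule sum.inter_filter[symmetric]) (simp add: cl_def)
  also have "{k \<in> cl i. k \<in> marked \<beta> I (cl i)} = marked \<beta> I (cl i)" by (auto simp: marked_def)
  finally show ?thesis .
qed

lemma val_rh: "i < n \<Longrightarrow> j < n \<Longrightarrow> rreg s ''rh'' [i, j] = wt_sets I (cl i) (cl i)"
proof -
  assume ij: "i < n" "j < n"
  have "rreg s ''rh'' [i, j] = (\<Sum>k<n. real (nreg s ''s0'' [i, k]) * rreg s ''wc'' [k, k])"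
    using holds_SumS[OF hold_rh[unfolded st_rh_def] ij] by (simp add: cell_at_def)
  also have "\<dots> = (\<Sum>k<n. (if f i = f k then 1 else 0) * wt_sets I {k} (cl k))"
    using ij by (intro sum.cong refl) (simp add: val_s0 val_wc)
  also have "\<dots> = (\<Sum>k\<in>cl i. wt_sets I {k} (cl i))"
    unfolding cl_sum by (intro sum.cong refl) (simp add: cl_eq)
  finally show ?thesis by (simp add: wt_sets_def)
qed

lemma val_sg: "i < n \<Longrightarrow> j < n \<Longrightarrow> nreg s ''sg'' [i, j] = (if single i then 1 else 0)"
  using holds_ntest[OF hold_sg[unfolded st_sg_def], of i j] in_real val_rh[of i i] val_lh[of i i] val_mk[of i i]
  by (simp add: cell_at_def single_def power2_eq_square)

lemma val_sm: "i < n \<Longrightarrow> j < n \<Longrightarrow> nreg s ''sm'' [i, j] = (if atom i = atom j then 1 else 0)"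
  using holds_ntest[OF hold_sm[unfolded st_sm_def], of i j] val_s0[of i j] val_sg[of i i] val_sg[of j j] same_iff[of i j]
  by (auto simp: cell_at_def same_def)

lemma val_atom: "i < n \<Longrightarrow> nreg s ''atom'' [i] = (if single i then 2 * i + 1 else 2 * f i)"
proof -
  assume i: "i < n"
  have "cell_done n st_atom s s i i" using i hold_atom by (simp add: holds_def)
  then show ?thesis using i val_sg[of i i] in_label by (simp add: st_atom_def cell_at_def)
qed

lemma output_atoms: "label_partition n (\<lambda>u. nreg s ''atom'' [u]) = \<K>"
proof -
  let ?g = "\<lambda>u. nreg s ''atom'' [u]"
  have same: "?g v = ?g u \<longleftrightarrow> same u v" if "u < n" "v < n" for u v
  proof -
    have "2 * x + 1 \<noteq> 2 * y" "2 * y \<noteq> 2 * x + 1" for x y :: nat by presburger+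
    then show ?thesis unfolding val_atom[OF that(1)] val_atom[OF that(2)] same_def
      by (cases "single u"; cases "single v") auto
  qed
  have "label_partition n ?g = (\<lambda>u. {v. v < n \<and> ?g v = ?g u}) ` {..<n}"
    unfolding label_partition_def by auto
  also have "\<dots> = atom ` {..<n}"
    by (intro image_cong refl Collect_cong) (auto simp: same atom_def)
  finally show ?thesis using atoms_eq by simp
qed

lemma atom_sum:
  fixes h :: "nat \<Rightarrow> real"
  assumes "i < n"
  shows "(\<Sum>k<n. (if atom i = atom k then 1 else 0) * h k) = (\<Sum>k\<in>atom i. h k)"
proof -
  have "{k. k < n \<and> atom i = atom k} = {k. k < n \<and> same i k}" using assms by (auto simp: same_iff)
  also have "\<dots> = atom i" by (simp add: atom_def)
  finally show ?thesis unfolding sum_indicator by simp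
qed

lemma val_cn: "i < n \<Longrightarrow> j < n \<Longrightarrow> rreg s ''cn'' [i, j] = real (card (atom i))"
proof -
  assume ij: "i < n" "j < n"
  have "rreg s ''cn'' [i, j] = (\<Sum>k<n. real (nreg s ''sm'' [i, k]))"
    using holds_SumS[OF hold_cn[unfolded st_cn_def] ij] by (simp add: cell_at_def)
  also have "\<dots> = (\<Sum>k<n. (if atom i = atom k then 1 else 0) * 1)"
    using ij by (intro sum.cong refl) (simp add: val_sm)
  finally show ?thesis using atom_sum[OF ij(1), of "\<lambda>_. 1"] by simp
qed

lemma val_ta: "i < n \<Longrightarrow> j < n \<Longrightarrow> rreg s ''ta'' [i, j] = (\<Sum>a\<in>atom i. w a j)"
proof -
  assume ij: "i < n" "j < n"
  have "rreg s ''ta'' [i, j] = (\<Sum>k<n. real (nreg s ''sm'' [i, k]) * rreg s ''w'' [k, j])"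
    using holds_SumS[OF hold_ta[unfolded st_ta_def] ij] by (simp add: cell_at_def)
  also have "\<dots> = (\<Sum>k<n. (if atom i = atom k then 1 else 0) * w k j)"
    using ij by (intro sum.cong refl) (simp add: val_sm in_w)
  finally show ?thesis using atom_sum[OF ij(1), of "\<lambda>k. w k j"] by simp
qed

lemma val_tp: "i < n \<Longrightarrow> j < n \<Longrightarrow> rreg s ''tp'' [i, j] = (\<Sum>a\<in>atom i. wp a j)"
proof -
  assume ij: "i < n" "j < n"
  have "rreg s ''tp'' [i, j] = (\<Sum>k<n. real (nreg s ''sm'' [i, k]) * (real (nreg s ''pos'' [k, j]) * rreg s ''w'' [k, j]))"
    using holds_SumS[OF hold_tp[unfolded st_tp_def] ij] by (simp add: cell_at_def)
  also have "\<dots> = (\<Sum>k<n. (if atom i = atom k then 1 else 0) * wp k j)"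
    using ij by (intro sum.cong refl) (simp add: val_sm in_w in_pos wp_def)
  finally show ?thesis using atom_sum[OF ij(1), of "\<lambda>k. wp k j"] by simp
qed

lemma val_wa: "i < n \<Longrightarrow> j < n \<Longrightarrow> rreg s ''wa'' [i, j] = dsum w (atom i) (atom j)"
proof -
  assume ij: "i < n" "j < n"
  have "rreg s ''wa'' [i, j] = (\<Sum>k<n. rreg s ''ta'' [i, k] * real (nreg s ''sm'' [j, k]))"
    using holds_SumS[OF hold_wa[unfolded st_wa_def] ij] by (simp add: cell_at_def)
  also have "\<dots> = (\<Sum>k<n. (if atom j = atom k then 1 else 0) * (\<Sum>a\<in>atom i. w a k))"
    using ij by (intro sum.cong refl) (simp add: val_sm val_ta)
  also have "\<dots> = (\<Sum>k\<in>atom j. \<Sum>a\<in>atom i. w a k)" by (rule atom_sum[OF ij(2)])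
  finally show ?thesis unfolding dsum_def by (subst sum.swap)
qed

lemma val_wp: "i < n \<Longrightarrow> j < n \<Longrightarrow> rreg s ''wp'' [i, j] = dsum wp (atom i) (atom j)"
proof -
  assume ij: "i < n" "j < n"
  have "rreg s ''wp'' [i, j] = (\<Sum>k<n. rreg s ''tp'' [i, k] * real (nreg s ''sm'' [j, k]))"
    using holds_SumS[OF hold_wp[unfolded st_wp_def] ij] by (simp add: cell_at_def)
  also have "\<dots> = (\<Sum>k<n. (if atom j = atom k then 1 else 0) * (\<Sum>a\<in>atom i. wp a k))"
    using ij by (intro sum.cong refl) (simp add: val_sm val_tp)
  also have "\<dots> = (\<Sum>k\<in>atom j. \<Sum>a\<in>atom i. wp a k)" by (rule atom_sum[OF ij(2)])
  finally show ?thesis unfolding dsum_def by (subst sum.swap)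
qed

lemma val_wat: "i < n \<Longrightarrow> j < n \<Longrightarrow> (1 - real (nreg s ''sm'' [i, j])) * rreg s ''wp'' [i, j] = Wat (atom i) (atom j)"
  by (simp add: val_sm val_wp Wat_def)

lemma val_dg: "i < n \<Longrightarrow> j < n \<Longrightarrow> rreg s ''dg'' [i, j] = dg (atom i)"
proof -
  assume ij: "i < n" "j < n"
  have "rreg s ''dg'' [i, j] = (\<Sum>k<n. (1 - real (nreg s ''sm'' [i, k])) * rreg s ''wp'' [i, k] / rreg s ''cn'' [k, k])"
    using holds_SumS[OF hold_dg[unfolded st_dg_def] ij] by (simp add: cell_at_def)
  also have "\<dots> = (\<Sum>k<n. Wat (atom i) (atom k) / real (card (atom k)))"
    using ij by (intro sum.cong refl) (simp add: val_wat val_cn)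
  also have "\<dots> = dg (atom i)" unfolding vertex_sum using dg_Wat[OF atom_in] ij by simp
  finally show ?thesis .
qed

lemma val_pd: "i < n \<Longrightarrow> j < n \<Longrightarrow> nreg s ''pd'' [i, j] = (if atom i \<in> \<K>\<^sub>p then 1 else 0)"
  using holds_ntest[OF hold_pd[unfolded st_pd_def], of i j] val_dg[of i i] atom_in[of i]
  by (simp add: cell_at_def pos_atoms_def)

lemma weighted_vertex_sum:
  "(\<Sum>k<n. real (nreg s ''pd'' [k, k]) / rreg s ''cn'' [k, k] * F (atom k)) = (\<Sum>K\<in>\<K>\<^sub>p. F K)"
proof -
  have "(\<Sum>k<n. real (nreg s ''pd'' [k, k]) / rreg s ''cn'' [k, k] * F (atom k))
     = (\<Sum>k<n. (if atom k \<in> \<K>\<^sub>p then F (atom k) else 0) / real (card (atom k)))"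
    by (intro sum.cong refl) (simp add: val_pd val_cn)
  also have "\<dots> = (\<Sum>K\<in>\<K>. if K \<in> \<K>\<^sub>p then F K else 0)" by (rule vertex_sum)
  also have "\<dots> = (\<Sum>K\<in>{K \<in> \<K>. K \<in> \<K>\<^sub>p}. F K)" using finite_atoms by (rule sum.inter_filter[symmetric])
  also have "{K \<in> \<K>. K \<in> \<K>\<^sub>p} = \<K>\<^sub>p" using pos_atoms_sub by auto
  finally show ?thesis .
qed

text \<open>Valid for atoms of degree 0 as well: program and \<open>G.A\<close> share the convention
  x / 0 = 0 in the row of such an atom, and the inner sums run over atoms of positive
  degree.\<close>

lemma val_x: "t \<le> t0 \<Longrightarrow> i < n \<Longrightarrow> j < n \<Longrightarrow> rreg s (xname t) [i, j] = mtx_pow \<K>\<^sub>p G.A t (atom i) (atom j)"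
proof (induction t arbitrary: i j)
  case 0
  have "rreg s (xname 0) [i, j] = (\<Sum>k<n. real (nreg s ''sm'' [i, k]) * real (nreg s ''sm'' [k, j]) / rreg s ''cn'' [k, k])"
    using holds_SumS[OF hold_x0[unfolded st_x0_def], of i j] 0 by (simp add: cell_at_def)
  also have "\<dots> = (\<Sum>k<n. (if atom k = atom i \<and> atom i = atom j then 1 else 0) / real (card (atom k)))"
    using 0 by (intro sum.cong refl) (auto simp: val_sm val_cn)
  also have "\<dots> = (\<Sum>K\<in>\<K>. if K = atom i \<and> atom i = atom j then 1 else 0)"
    by (rule vertex_sum)
  also have "\<dots> = (if atom i = atom j then 1 else 0)"
    using finite_atoms atom_in[of i] 0 by auto
  finally show ?case by (simp add: mtx_diag_def)
next
  case (Suc t)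
  have "holds n (st_x t) s" using Suc.prems by (intro stages_hold) (auto simp: stages_def stages2_def)
  then have "rreg s (xname (Suc t)) [i, j] = (\<Sum>k<n. real (nreg s ''pd'' [k, k]) / rreg s ''cn'' [k, k] *
     ((real (nreg s ''sm'' [i, k]) + (1 - real (nreg s ''sm'' [i, k])) * rreg s ''wp'' [i, k] / rreg s ''dg'' [i, i]) / 2)
     * rreg s (xname t) [k, j])"
    using holds_SumS[of n "xname (Suc t)" _ s i j] Suc.prems by (simp add: st_x_def cell_at_def)
  also have "\<dots> = (\<Sum>k<n. real (nreg s ''pd'' [k, k]) / rreg s ''cn'' [k, k] *
     (G.A (atom i) (atom k) * mtx_pow \<K>\<^sub>p G.A t (atom k) (atom j)))"
  proof (intro sum.cong refl)
    fix k assume "k \<in> {..<n}"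
    then have k: "k < n" by simp
    have "(real (nreg s ''sm'' [i, k]) + (1 - real (nreg s ''sm'' [i, k])) * rreg s ''wp'' [i, k] / rreg s ''dg'' [i, i]) / 2
        = G.A (atom i) (atom k)"
      using Suc.prems k by (simp add: val_sm val_wp val_dg Wat_def G.A_def G.P_def mtx_diag_def)
    moreover have "rreg s (xname t) [k, j] = mtx_pow \<K>\<^sub>p G.A t (atom k) (atom j)"
      using Suc.prems k by (intro Suc.IH) auto
    ultimately show "real (nreg s ''pd'' [k, k]) / rreg s ''cn'' [k, k] *
     ((real (nreg s ''sm'' [i, k]) + (1 - real (nreg s ''sm'' [i, k])) * rreg s ''wp'' [i, k] / rreg s ''dg'' [i, i]) / 2)
     * rreg s (xname t) [k, j] = real (nreg s ''pd'' [k, k]) / rreg s ''cn'' [k, k] *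
     (G.A (atom i) (atom k) * mtx_pow \<K>\<^sub>p G.A t (atom k) (atom j))" by simp
  qed
  also have "\<dots> = mtx_pow \<K>\<^sub>p G.A (Suc t) (atom i) (atom j)"
    unfolding mtx_pow.simps mtx_mult_def by (rule weighted_vertex_sum)
  finally show ?case .
qed

lemma val_Q: "i < n \<Longrightarrow> j < n \<Longrightarrow> rreg s ''Q'' [i, j] = G.Q t0 (atom i) (atom j)"
proof -
  assume ij: "i < n" "j < n"
  have "rreg s ''Q'' [i, j] = (\<Sum>k<n. real (nreg s ''pd'' [k, k]) / rreg s ''cn'' [k, k] *
     ((1 - real (nreg s ''sm'' [i, k])) * rreg s ''wp'' [i, k] / rreg s ''dg'' [i, i]) * rreg s (xname t0) [k, j])"
    using holds_SumS[OF hold_q[unfolded st_q_def] ij] by (simp add: cell_at_def)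
  also have "\<dots> = (\<Sum>k<n. real (nreg s ''pd'' [k, k]) / rreg s ''cn'' [k, k] *
     (G.P (atom i) (atom k) * mtx_pow \<K>\<^sub>p G.A t0 (atom k) (atom j)))"
    using ij by (intro sum.cong refl) (simp add: val_x val_wat val_dg G.P_def)
  also have "\<dots> = G.Q t0 (atom i) (atom j)"
    unfolding G.Q_def mtx_mult_def by (rule weighted_vertex_sum)
  finally show ?thesis .
qed

lemma val_G: "i < n \<Longrightarrow> j < n \<Longrightarrow> rreg s ''G'' [i, j] = G.Gam t0 (atom i) (atom j)"
proof -
  assume ij: "i < n" "j < n"
  have "rreg s ''G'' [i, j] = (\<Sum>k<n. real (nreg s ''pd'' [k, k]) / rreg s ''cn'' [k, k] *
     (rreg s ''dg'' [i, i] * rreg s ''dg'' [j, j] * (rreg s ''Q'' [i, k] * rreg s ''Q'' [j, k] / rreg s ''dg'' [k, k])))"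
    using holds_SumS[OF hold_g[unfolded st_g_def] ij] by (simp add: cell_at_def)
  also have "\<dots> = (\<Sum>k<n. real (nreg s ''pd'' [k, k]) / rreg s ''cn'' [k, k] *
     (dg (atom i) * dg (atom j) * (G.Q t0 (atom i) (atom k) * G.Q t0 (atom j) (atom k) / dg (atom k))))"
    using ij by (intro sum.cong refl) (simp add: val_Q val_dg)
  also have "\<dots> = (\<Sum>K\<in>\<K>\<^sub>p. dg (atom i) * dg (atom j) * (G.Q t0 (atom i) K * G.Q t0 (atom j) K / dg K))"
    by (rule weighted_vertex_sum)
  finally show ?thesis by (simp add: G.Gam_def sum_distrib_left)
qed

lemma output_adm:
  assumes ij: "i < n" "j < n"
  shows "nreg s ''adm'' [i, j] = (if {i, j} \<in> admissible \<alpha> \<epsilon> I \<K> then 1 else 0)"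
proof -
  have "nreg s ''adm'' [i, j] = (if nreg s ''sm'' [i, j] < 1 \<and> rreg s ''wa'' [i, j] <
     64 * (2 * rreg s ''alpha'' [] / rreg s ''eps'' []) ^ (2 * t0 + 1) *
     (real (nreg s ''pd'' [i, i]) * real (nreg s ''pd'' [j, j]) * rreg s ''G'' [i, j]) then 1 else 0)"
    using holds_ntest[OF hold_adm[unfolded st_adm_def] ij]
    by (simp add: cell_at_def rval_rpow del: rpow.simps)
  also have "\<dots> = (if atom i \<noteq> atom j \<and> dsum w (atom i) (atom j) <
      64 * (2 * \<alpha> / \<epsilon>) ^ (2 * t0 + 1) * Gamma_mat I \<K> (atom i) (atom j) then 1 else 0)"
    using ij by (simp add: val_sm val_wa val_pd val_G in_real Gamma_eq)
  also have "(2 * \<alpha> / \<epsilon>) ^ (2 * t0 + 1) = (\<epsilon> / (2 * \<alpha>)) powi (- (2 * int t0 + 1))"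
    unfolding powi_eq power_inverse[symmetric] using alpha eps by simp
  finally show ?thesis
    using admissible_iff[OF atom_in[OF ij(1)] atom_in[OF ij(2)] self_atom[OF ij(1)] self_atom[OF ij(2)], of \<alpha> \<epsilon>]
    by simp
qed

lemma output_ok: "output_correct n \<K> (admissible \<alpha> \<epsilon> I \<K>) s"
  unfolding output_correct_def using output_atoms output_adm by blast

end

lemma polytime:
  assumes beta: "0 < \<beta>" "\<beta> \<le> 1 / 20" and alpha: "1 \<le> \<alpha>"
  shows "polytime_atoms_admissible \<beta> \<alpha>"
proof -
  obtain a k where run: "\<forall>sz X n s B. size_model sz X \<longrightarrow> nreg s ''n'' [] = n \<longrightarrow> n \<le> B \<longrightarrow> 1 \<le> B \<longrightarrow>
    bnd sz X UNIV B s \<longrightarrow> (\<exists>t s'. exec sz (prog_of stages) s t s' \<and> t \<le> a * B ^ k \<and>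
      frame (\<Union>(written ` set stages)) s s' \<and> (\<forall>st\<in>set stages. holds n st s'))"
    using prog_run[OF ssa_stages] by (elim exE)
  \<comment> \<open>\<beta> and \<alpha> are not part of the input, so their sizes go into the
    constant. If one of them is irrational, only the unit-cost model remains, where the summand 2
    suffices.\<close>
  define c where "c = 2 + real_bits \<beta> + real_bits \<alpha>"
  show ?thesis
    unfolding polytime_atoms_admissible_def
  proof (rule exI[of _ "prog_of stages"], rule exI[of _ "a * c ^ k"], rule exI[of _ k], intro allI impI, elim conjE)
    fix n :: nat and I :: "nat cc" and \<C>\<^sub>0 f and \<epsilon> :: real and sz
    assume inst: "cc_instance I" and V: "verts I = {..<n}" and n: "2 \<le> n" and eps: "0 < \<epsilon>" "\<epsilon> \<le> 1"
      and part: "partition_on (verts I) \<C>\<^sub>0" and lab: "label_partition n f = \<C>\<^sub>0"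
      and sz: "sz = (\<lambda>_. 1) \<or> sz = real_bits \<and> \<beta> \<in> \<rat> \<and> \<alpha> \<in> \<rat> \<and> \<epsilon> \<in> \<rat> \<and> (\<forall>u<n. \<forall>v<n. wt I u v \<in> \<rat>)"
    let ?N = "input_size sz \<epsilon> n I f"
    let ?s = "input_store \<beta> \<alpha> \<epsilon> n I f"
    \<comment> \<open>\<open>X\<close> is the range of the real registers: all reals at unit cost,
      the rationals at logarithmic cost.\<close>
    obtain X where model: "size_model sz X" and X: "\<beta> \<in> X" "\<alpha> \<in> X" "\<epsilon> \<in> X" "\<And>u v. u < n \<Longrightarrow> v < n \<Longrightarrow> wt I u v \<in> X"
      and szc: "sz \<beta> \<le> c" "sz \<alpha> \<le> c"
    proof (cases "sz = (\<lambda>_. 1)")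
      case True
      with that[of UNIV] show ?thesis by (simp add: size_model_unit[simplified] c_def)
    next
      case False
      with sz that[of \<rat>] show ?thesis by (simp add: size_model_rat c_def)
    qed
    have row: "1 + nat_bits (f u) \<le> ?N" "n \<le> ?N" if "u < n" for u
    proof -
      have "1 + nat_bits (f u) \<le> (\<Sum>u<n. 1 + nat_bits (f u))"
        using that member_le_sum[of u "{..<n}" "\<lambda>u. 1 + nat_bits (f u)"] by simp
      then show "1 + nat_bits (f u) \<le> ?N" by (simp add: input_size_def)
      have "(\<Sum>u<n. 1) \<le> (\<Sum>u<n. 1 + nat_bits (f u))" by (intro sum_mono) simp
      then show "n \<le> ?N" by (simp add: input_size_def)
    qed
    have wN: "sz (wt I u v) \<le> ?N" if "u < n" "v < n" for u v
    proof -
      have "1 + sz (wt I u v) \<le> (\<Sum>v<n. 1 + sz (wt I u v))"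
        using that member_le_sum[of v "{..<n}" "\<lambda>v. 1 + sz (wt I u v)"] by simp
      also have "\<dots> \<le> (\<Sum>u<n. \<Sum>v<n. 1 + sz (wt I u v))"
        using that member_le_sum[of u "{..<n}" "\<lambda>u. \<Sum>v<n. 1 + sz (wt I u v)"] by simp
      finally show ?thesis by (simp add: input_size_def)
    qed
    have eN: "sz \<epsilon> \<le> ?N" by (simp add: input_size_def)
    let ?B = "c * ?N"
    have nN: "n \<le> ?N" using row(2)[of 0] n by simp
    have c2: "2 \<le> c" by (simp add: c_def)
    have NB: "?N \<le> ?B" and cB: "c \<le> ?B" using c2 nN n by simp_all
    have B: "n \<le> ?B" using nN NB by (rule order_trans)
    have B1: "1 \<le> ?B" by (rule order_trans[OF _ B]) (use n in simp)
    have sz0: "sz 0 \<le> 1" "0 \<in> X"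
      using size_model.of_nat_size[OF model, of 0] size_model.of_nat_in[OF model, of 0] by simp_all
    have bn: "nat_bits (nreg ?s x is) \<le> ?B" for x "is"
    proof -
      have "nreg ?s x is \<in> {n, 1, 0} \<union> f ` {..<n}"
        by (auto simp: input_store_def)
      then have "nat_bits (nreg ?s x is) \<le> ?N"
        using nat_bits_le_self[of n] nN n row(1) by fastforce
      then show ?thesis using NB by (rule order_trans)
    qed
    have br: "rreg ?s x is \<in> X \<and> sz (rreg ?s x is) \<le> ?B" for x "is"
    proof -
      have "rreg ?s x is \<in> {\<beta>, \<alpha>, \<epsilon>, 0} \<union> {wt I u v | u v. u < n \<and> v < n}"
        by (auto simp: input_store_def)
      moreover have "x \<in> X \<and> sz x \<le> ?B" if "x \<in> {\<beta>, \<alpha>, \<epsilon>, 0}" for x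
        using that X(1-3) sz0(2) order_trans[OF szc(1) cB] order_trans[OF szc(2) cB] order_trans[OF eN NB]
          order_trans[OF sz0(1) B1] by auto
      moreover have "x \<in> X \<and> sz x \<le> ?B" if "x \<in> {wt I u v | u v. u < n \<and> v < n}" for x
        using that X(4) order_trans[OF wN NB] by blast
      ultimately show ?thesis by blast
    qed
    have "bnd sz X UNIV ?B ?s" unfolding bnd_def using bn br by blast
    moreover have "nreg ?s ''n'' [] = n" by (simp add: input_store_def)
    ultimately obtain t s' where s': "exec sz (prog_of stages) ?s t s'" "t \<le> a * ?B ^ k"
      "frame (\<Union>(written ` set stages)) ?s s'" "\<forall>st\<in>set stages. holds n st s'"
      using run model B B1 by blast
    have keep: "rreg s' x is = rreg ?s x is" "x \<notin> {''i'', ''j'', ''k''} \<Longrightarrow> nreg s' x is = nreg ?s x is"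
      if "x \<in> inputs" for x "is"
      using that inputs_kept s'(3) unfolding frame_def by blast+
    interpret cc I by unfold_locales (rule inst)
    interpret cc_atoms I \<beta> \<C>\<^sub>0 by unfold_locales (use beta part in auto)
    interpret final_store I \<beta> \<C>\<^sub>0 n f \<alpha> \<epsilon> s'
    proof
      show "verts I = {..<n}" "label_partition n f = \<C>\<^sub>0" "0 < \<epsilon>" by fact+
      show "0 < \<alpha>" using alpha by simp
      show "rreg s' ''w'' [i, j] = wt I i j" if "i < n" "j < n" for i j
        using that keep(1)[of "''w''"] by (simp add: inputs_def input_store_def)
      show "nreg s' ''pos'' [i, j] = (if {i, j} \<in> pos_pairs I then 1 else 0)" if "i < n" "j < n" for i j
        using that keep(2)[of "''pos''"] by (simp add: inputs_def input_store_def)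
      show "nreg s' ''label'' [i] = f i" if "i < n" for i
        using that keep(2)[of "''label''"] by (simp add: inputs_def input_store_def)
      show "rreg s' ''beta'' [] = \<beta>" using keep(1)[of "''beta''"] by (simp add: inputs_def input_store_def)
      show "rreg s' ''alpha'' [] = \<alpha>" using keep(1)[of "''alpha''"] by (simp add: inputs_def input_store_def)
      show "rreg s' ''eps'' [] = \<epsilon>" using keep(1)[of "''eps''"] by (simp add: inputs_def input_store_def)
      show "holds n st s'" if "st \<in> set stages" for st using that s'(4) by blast
    qed
    have "t \<le> a * c ^ k * ?N ^ k" using s'(2) by (simp add: power_mult_distrib)
    with s'(1) output_ok
    show "\<exists>t s. exec sz (prog_of stages) ?s t s \<and> t \<le> a * c ^ k * ?N ^ k \<and>
       output_correct n (atoms \<beta> I \<C>\<^sub>0) (admissible \<alpha> \<epsilon> I (atoms \<beta> I \<C>\<^sub>0)) s" by blast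
  qed
qed

section \<open>The theorem\<close>

theorem theorem3p10:
  fixes \<beta> \<alpha> \<epsilon> :: real
    and I :: "'a cc"
    and \<C>\<^sub>0 \<K> E\<^sub>a\<^sub>d\<^sub>m :: "'a set set"
  assumes "0 < \<beta>" and "\<beta> \<le> (2 * sqrt 7 - 5) / 6"
    and "1 \<le> \<alpha>" and "atom_cost_bound TYPE('a) \<beta> \<alpha>"
    and "0 < \<epsilon>" and "\<epsilon> \<le> 1"
    and "cc_instance I" and "2 \<le> card (verts I)"
    and "partition_on (verts I) \<C>\<^sub>0" and "obj I \<C>\<^sub>0 \<le> 20 / 3 * OPT I"
  defines "\<K> \<equiv> atoms \<beta> I \<C>\<^sub>0"
    and "E\<^sub>a\<^sub>d\<^sub>m \<equiv> admissible \<alpha> \<epsilon> I \<K>"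
  shows "polytime_atoms_admissible \<beta> \<alpha> \<and>
    (\<exists>\<C>\<^sub>1. partition_on (verts I) \<C>\<^sub>1 \<and> atom_respecting \<K> \<C>\<^sub>1 \<and>
          obj I \<C>\<^sub>1 \<le> (1 + \<epsilon>) * OPT I \<and>
          (\<forall>K\<in>\<K>. \<forall>L\<in>\<K>. K \<noteq> L \<and> (\<exists>C\<in>\<C>\<^sub>1. K \<subseteq> C \<and> L \<subseteq> C) \<longrightarrow>
             (\<forall>u\<in>K. \<forall>v\<in>L. {u, v} \<in> E\<^sub>a\<^sub>d\<^sub>m))) \<and>
    wt_pairs I E\<^sub>a\<^sub>d\<^sub>m \<le> 128 * \<alpha> * (2 * \<alpha> / \<epsilon>) ^ (2 * t0 + 1) * OPT I"
proof -
  interpret cc I by unfold_locales (fact assms)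
  interpret cc_atoms I \<beta> \<C>\<^sub>0
    by unfold_locales (use assms beta_bound in auto)
  have bound: "obj I (atoms \<beta> I \<C>\<^sub>0) \<le> \<alpha> * OPT I"
    using assms unfolding atom_cost_bound_def by blast
  have "polytime_atoms_admissible \<beta> \<alpha>"
    using assms beta_bound by (intro polytime) auto
  then show ?thesis
    using atom_structure[OF assms(3,5,6) bound] unfolding \<K>_def E\<^sub>a\<^sub>d\<^sub>m_def by blast
qed

end
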